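(* Consider a TIM-MP instance with $K$ users whose conflict digraph $\mathcal D$ contains no clique $Q_n$ with $n\ge3$ and whose dicycle-vertex incidence matrix $\boldsymbol B$ is an ideal matrix. Then the optimal DoF region, achieved by orthogonal access, is given (up to the substitution $y_k=1-d_k$, a set covering polytope) by $$\mathscr D=\Big\{(d_1,\dots,d_K): 0\le d_k\le1\ \forall k\in\mathcal K,\ \ \sum_{k\in C}d_k\le|C|-1\ \forall C\in\mathcal C\Big\},$$ where $\mathcal C$ is the collection of all dicycles of $\mathcal D$ without chord.
   Context: TIM-MP (topological interference management with decoded message passing) model. Let $\mathcal K=\{1,\dots,K\}$. Transmitter (user) $i$ has a message $W_i$ for receiver (base station) $i$, $i\in\mathcal K$. The network topology $\mathcal G$, fixed throughout the communication, is given by sets $\mathcal T_j\subseteq\mathcal K$ with $j\in\mathcal T_j$ (the transmitters connected to receiver $j$). At time $t$ receiver $j$ observes $Y_j(t)=\sum_{i\in\mathcal T_j}h_{ji}(t)X_i(t)+Z_j(t)$, where $X_i(t)$ is the complex transmitted signal with average power constraint $\mathbb E|X_i|^2\le P$, $Z_j(t)$ is Gaussian noise with zero mean and unit variance, and $h_{ji}(t)$ is the channel coefficient between transmitter $i$ and receiver $j$. The channel coefficients are not known to the transmitters, which know only $\mathcal G$; the receivers know $\mathcal G$ and $\mathcal H=\{h_{ji}(t)\}$. A decoding order $\pi$ is a partial order $\prec_\pi$ on $\mathcal K$; $i\prec_\pi j$ means $W_i$ is decoded before $W_j$. A rate tuple $(R_1,\dots,R_K)$ is achievable under $\pi$ if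 there are length-$n$ codes with $W_i$ uniform on $[1:2^{nR_i}]$, encoders $X_i^n=f_i(W_i,\mathcal G)$, and decoders $\hat W_j=g_j(Y_j^n,\{\hat W_k:k\prec_\pi j\},\mathcal G,\mathcal H)$ (earlier decoded messages are passed to receiver $j$), such that the decoding error $\max_j\Pr(W_j\ne\hat W_j)$ tends to $0$ as $n\to\infty$. $\mathcal R^\pi$ is the set of rate tuples achievable under $\pi$ (single-round message passing); the capacity region is $\mathscr C=\mathrm{conv}(\bigcup_\pi\mathcal R^\pi)$ (multiple-round message passing). The DoF region $\mathscr D$ is the set of $(d_1,\dots,d_K)\in\mathbb R_+^K$ with $d_i=\limsup_{P\to\infty}R_i/\log P$ for all $i$, where $(R_1,\dots,R_K)\in\mathscr C$. Conflict digraph: $\mathcal D=(\mathcal K,\mathcal A)$ with $(i,j)\in\mathcal A$ iff $i\neq j$ and $i\in\mathcal T_j$. An acyclic set is a set of vertices inducing a sub-digraph without directed cycles. Orthogonal access schedules acyclic sets of $\mathcal D$ orthogonally across time or frequency (messages of one acyclic set are sent simultaneously and decoded successively via message passing); with time sharing it achieves the convex hull of the $0/1$ incidence vectors of acyclic sets. A clique $Q_n$ is a set of $n$ vertices with both arcs $(u,v),(v,u)$ present for all distinct $u,v$ in it. A dicycle is a directed cycle of length at least 2 (length 2: two vertices joined in both directions); it is without chord if its vertices induce no further arcs. $\boldsymbol B$ is the $0/1$ matrix whose rows are the incidence vectors of (the vertex sets of) all chordless dicycles of $\mathcal D$. A $0/1$ matrix $\boldsymbol M$ with $n$ columns is ideal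 if $\{y\in[0,1]^n:\boldsymbol My\ge\mathbf 1\}$ has only integral extreme points.
   Formalization: The limsups d_i are required to be attained jointly along one sequence of powers (separate limsups make the claim false), and the channel coefficients of connected links are assumed a.s. nonzero with time-averaged |ln|h|| bounded with probability tending to 1 (zero coefficients make it false). *)

theory Defs
  imports "HOL-Probability.Probability" "Graph_Theory.Kuratowski"
begin

section \<open>Conflict digraph\<close>

text \<open>
  The users are the elements of a finite type \<open>'k\<close> (so \<open>K = CARD('k)\<close>);
  \<open>T j\<close> is the set of transmitters connected to receiver \<open>j\<close>.
\<close>

definition conflict_digraph :: "('k \<Rightarrow> 'k set) \<Rightarrow> ('k, 'k \<times> 'k) pre_digraph" where
  "conflict_digraph T =
     \<lparr>verts = UNIV, arcs = {(i, j). i \<noteq> j \<and> i \<in> T j}, tail = fst, head = snd\<rparr>"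

definition acyclic_set :: "('v, 'v \<times> 'v) pre_digraph \<Rightarrow> 'v set \<Rightarrow> bool" where
  "acyclic_set D S \<longleftrightarrow> S \<subseteq> verts D \<and> \<not> (\<exists>p. pre_digraph.cycle (D \<restriction> S) p)"

text \<open>
  Dicycles are lists of arcs. A chordless dicycle is determined by its vertex set (its arcs are all
  the arcs induced on that set), so the collection is given by vertex sets.
\<close>

definition chordless_dicycles :: "('v, 'v \<times> 'v) pre_digraph \<Rightarrow> 'v set set" where
  "chordless_dicycles D =
     {C. \<exists>p. pre_digraph.cycle D p \<and> 2 \<le> length p \<and> C = fst ` set p \<and> arcs (D \<restriction> C) = set p}"

definition incidence :: "'k set \<Rightarrow> real ^ 'k" where
  "incidence S = (\<chi> k. indicator S k)"

text \<open>
  A matrix with \<open>CARD('k)\<close> columns is a family \<open>M\<close> of row vectors over a set \<open>I\<close> of row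
  indices. An index set rather than a type, so that there may be no rows at all. The
  dicycle-vertex incidence matrix is the family \<open>incidence\<close> over \<open>chordless_dicycles\<close>.
\<close>

definition covering_polytope :: "'r set \<Rightarrow> ('r \<Rightarrow> real ^ 'k) \<Rightarrow> (real ^ 'k) set" where
  "covering_polytope I M =
     {y. (\<forall>k. 0 \<le> y $ k \<and> y $ k \<le> 1) \<and> (\<forall>r\<in>I. (\<Sum>k\<in>UNIV. M r $ k * y $ k) \<ge> 1)}"

definition ideal_matrix :: "'r set \<Rightarrow> ('r \<Rightarrow> real ^ 'k) \<Rightarrow> bool" where
  "ideal_matrix I M \<longleftrightarrow>
     (\<forall>r\<in>I. \<forall>k. M r $ k \<in> {0, 1}) \<and>
     (\<forall>y. y extreme_point_of covering_polytope I M \<longrightarrow> (\<forall>k. y $ k \<in> \<int>))"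

definition orthogonal_access_region :: "('k \<Rightarrow> 'k set) \<Rightarrow> (real ^ 'k) set" where
  "orthogonal_access_region T =
     convex hull (incidence ` {S. acyclic_set (conflict_digraph T) S})"


section \<open>Channel and noise\<close>

text \<open>A realization \<open>h\<close> of the channel has \<open>h t $ j $ i\<close> as coefficient from transmitter \<open>i\<close> to
  receiver \<open>j\<close> at time \<open>t\<close>.\<close>

type_synonym 'k channel = "nat \<Rightarrow> complex ^ 'k ^ 'k"

abbreviation channel_space :: "'k::finite channel measure" where
  "channel_space \<equiv> Pi\<^sub>M UNIV (\<lambda>_. borel)"

text \<open>
  \<open>L\<close> is the set of laws that the channel process may have; since the transmitters know the topology
  only, a code has to work for every law in \<open>L\<close>. If \<open>L\<close> consists of point masses, this is a
  compound channel with arbitrary unknown coefficients; if \<open>L\<close> is a singleton, it is a fading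
  channel with known statistics and unknown realization.

  Regularity: the coefficients of the links of the topology are almost surely nonzero, and on the
  logarithmic scale they are bounded on time average. This holds if the magnitudes lie between
  two positive constants (constant channels in particular) and, by the law of large numbers, for
  i.i.d. or stationary ergodic fading with integrable \<open>ln |h|\<close>. The nonvanishing condition is not
  redundant, as \<open>ln 0 = 0\<close>.
\<close>

definition regular_channel_laws :: "('k::finite \<Rightarrow> 'k set) \<Rightarrow> 'k channel measure set \<Rightarrow> bool" where
  "regular_channel_laws T L \<longleftrightarrow>
     L \<noteq> {} \<and>
     (\<forall>\<mu>\<in>L. prob_space \<mu> \<and> sets \<mu> = sets channel_space) \<and>
     (\<exists>c. \<forall>\<mu>\<in>L. \<forall>j. \<forall>i\<in>T j.
        (AE h in \<mu>. \<forall>t. h t $ j $ i \<noteq> 0) \<and>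
        (\<lambda>n. measure \<mu> {h \<in> space \<mu>. (\<Sum>t<n. \<bar>ln (cmod (h t $ j $ i))\<bar>) / n \<le> c}) \<longlonglongrightarrow> 1)"

text \<open>Circularly symmetric complex Gaussian noise: real and imaginary part have variance 1/2.\<close>

definition complex_normal :: "complex measure" where
  "complex_normal =
     distr (density lborel (normal_density 0 (1 / sqrt 2)) \<Otimes>\<^sub>M
            density lborel (normal_density 0 (1 / sqrt 2))) borel (\<lambda>(x, y). Complex x y)"

definition noise_measure :: "(nat \<Rightarrow> 'k::finite \<Rightarrow> complex) measure" where
  "noise_measure = Pi\<^sub>M UNIV (\<lambda>t. Pi\<^sub>M UNIV (\<lambda>j. complex_normal))"


section \<open>Codes with message passing\<close>

text \<open>Message \<open>i\<close> ranges over \<open>{1..M i}\<close>. Channel, noise and messages are independent.\<close>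

definition message_measure :: "('k::finite \<Rightarrow> nat) \<Rightarrow> ('k \<Rightarrow> nat) measure" where
  "message_measure M = Pi\<^sub>M UNIV (\<lambda>i. uniform_count_measure {1..M i})"

definition tim_measure ::
  "'k::finite channel measure \<Rightarrow> ('k \<Rightarrow> nat) \<Rightarrow> ('k channel \<times> (nat \<Rightarrow> 'k \<Rightarrow> complex) \<times> ('k \<Rightarrow> nat)) measure"
where
  "tim_measure \<mu> M = \<mu> \<Otimes>\<^sub>M (noise_measure \<Otimes>\<^sub>M message_measure M)"

type_synonym 'k encoders = "'k \<Rightarrow> nat \<Rightarrow> nat \<Rightarrow> complex"

text \<open>Decoder \<open>j\<close> gets its channel output, the messages passed to it, and the channel realization.\<close>

type_synonym 'k decoders = "'k \<Rightarrow> (nat \<Rightarrow> complex) \<Rightarrow> ('k \<Rightarrow> nat) \<Rightarrow> 'k channel \<Rightarrow> nat"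

definition avg_power :: "nat \<Rightarrow> ('k \<Rightarrow> nat) \<Rightarrow> 'k encoders \<Rightarrow> 'k \<Rightarrow> real" where
  "avg_power n M f i =
     (\<integral>w. (\<Sum>t<n. (cmod (f i w t))\<^sup>2) / n \<partial>uniform_count_measure {1..M i})"

definition received ::
  "('k::finite \<Rightarrow> 'k set) \<Rightarrow> nat \<Rightarrow> 'k encoders \<Rightarrow> 'k channel \<Rightarrow> (nat \<Rightarrow> 'k \<Rightarrow> complex) \<Rightarrow> ('k \<Rightarrow> nat)
     \<Rightarrow> 'k \<Rightarrow> nat \<Rightarrow> complex" where
  "received T n f h z w j =
     restrict (\<lambda>t. (\<Sum>i\<in>T j. h t $ j $ i * f i (w i) t) + z t j) {..<n}"

text \<open>A decoding order is a strict partial order; \<open>(i, j) \<in> \<pi>\<close> means that \<open>i\<close> is decoded before \<open>j\<close>.\<close>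

definition decoding_order :: "'k rel \<Rightarrow> bool" where
  "decoding_order \<pi> \<longleftrightarrow> irrefl \<pi> \<and> trans \<pi>"

definition decoded ::
  "'k rel \<Rightarrow> 'k decoders \<Rightarrow> 'k channel \<Rightarrow> ('k \<Rightarrow> nat \<Rightarrow> complex) \<Rightarrow> 'k \<Rightarrow> nat" where
  "decoded \<pi> g h y = wfrec \<pi> (\<lambda>v j. g j (y j) (restrict v {k. (k, j) \<in> \<pi>}) h)"

lemma decoded_unfold:
  fixes \<pi> :: "'k::finite rel"
  assumes "decoding_order \<pi>"
  shows "decoded \<pi> g h y j = g j (y j) (restrict (decoded \<pi> g h y) {k. (k, j) \<in> \<pi>}) h"
proof -
  have "wf \<pi>"
    using assms by (auto simp: decoding_order_def acyclic_irrefl wf_iff_acyclic_if_finite)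
  then have "decoded \<pi> g h y j =
      g j (y j) (restrict (cut (decoded \<pi> g h y) \<pi> j) {k. (k, j) \<in> \<pi>}) h"
    unfolding decoded_def by (subst wfrec) auto
  also have "restrict (cut (decoded \<pi> g h y) \<pi> j) {k. (k, j) \<in> \<pi>} =
      restrict (decoded \<pi> g h y) {k. (k, j) \<in> \<pi>}"
    by (auto simp: cut_def fun_eq_iff)
  finally show ?thesis .
qed

definition measurable_decoders :: "nat \<Rightarrow> 'k::finite decoders \<Rightarrow> bool" where
  "measurable_decoders n g \<longleftrightarrow>
     (\<forall>j v. (\<lambda>(y, h). g j y v h) \<in>
        (Pi\<^sub>M {..<n} (\<lambda>_. borel) \<Otimes>\<^sub>M channel_space) \<rightarrow>\<^sub>M count_space UNIV)"

definition error_prob ::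
  "('k::finite \<Rightarrow> 'k set) \<Rightarrow> 'k channel measure \<Rightarrow> 'k rel \<Rightarrow> nat \<Rightarrow> ('k \<Rightarrow> nat) \<Rightarrow> 'k encoders
     \<Rightarrow> 'k decoders \<Rightarrow> 'k \<Rightarrow> real" where
  "error_prob T \<mu> \<pi> n M f g j =
     measure (tim_measure \<mu> M)
       {(h, z, w) \<in> space (tim_measure \<mu> M). decoded \<pi> g h (received T n f h z w) j \<noteq> w j}"

definition num_messages :: "nat \<Rightarrow> real ^ 'k \<Rightarrow> 'k \<Rightarrow> nat" where
  "num_messages n R i = nat \<lceil>2 powr (n * R $ i)\<rceil>"


section \<open>Capacity and DoF region\<close>

definition achievable ::
  "('k::finite \<Rightarrow> 'k set) \<Rightarrow> 'k channel measure set \<Rightarrow> real \<Rightarrow> 'k rel \<Rightarrow> real ^ 'k \<Rightarrow> bool" where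
  "achievable T L P \<pi> R \<longleftrightarrow>
     (\<forall>i. 0 \<le> R $ i) \<and>
     (\<exists>f g. (\<forall>n. (\<forall>i. avg_power n (num_messages n R) (f n) i \<le> P) \<and> measurable_decoders n (g n)) \<and>
        (\<forall>\<mu>\<in>L. (\<lambda>n. Max (range (error_prob T \<mu> \<pi> n (num_messages n R) (f n) (g n)))) \<longlonglongrightarrow> 0))"

definition capacity_region ::
  "('k::finite \<Rightarrow> 'k set) \<Rightarrow> 'k channel measure set \<Rightarrow> real \<Rightarrow> (real ^ 'k) set" where
  "capacity_region T L P =
     convex hull (\<Union>\<pi>\<in>{\<pi>. decoding_order \<pi>}. {R. achievable T L P \<pi> R})"

text \<open>
  The limit superior of the rate tuple is a joint one: the limits superior of the components are
  attained along a common sequence of powers. With unrelated sequences one could let the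
  users alternate as the power grows and would get one degree of freedom for all of them.
\<close>

definition dof_region :: "('k::finite \<Rightarrow> 'k set) \<Rightarrow> 'k channel measure set \<Rightarrow> (real ^ 'k) set" where
  "dof_region T L =
     {d. (\<forall>k. 0 \<le> d $ k) \<and>
         (\<exists>R. (\<forall>P>0. R P \<in> capacity_region T L P) \<and>
              (\<forall>k. Limsup at_top (\<lambda>P. ereal (R P $ k / log 2 P)) = ereal (d $ k)) \<and>
              (\<exists>P :: nat \<Rightarrow> real. filterlim P at_top sequentially \<and>
                 (\<forall>k. (\<lambda>m. R (P m) $ k / log 2 (P m)) \<longlonglongrightarrow> d $ k)))}"

end

theory Submission
  imports Defs "HOL-Real_Asymp.Real_Asymp"
begin

text \<open>
  Converse. If \<open>i\<close> interferes at receiver \<open>j\<close> and \<open>W\<^sub>i\<close> is not passed to \<open>j\<close>, then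
  \<open>R\<^sub>i + R\<^sub>j \<le> log P + O(1)\<close>; every dicycle contains such an arc, whatever the decoding order. The bound
  needs no entropies: replace the noisy outputs \<open>(Y\<^sub>j, Y\<^sub>i)\<close> by Gaussian surrogates such that the one
  for \<open>Y\<^sub>j\<close> does not depend on the messages, and the one for \<open>Y\<^sub>i\<close>, which is centred at what receiver
  \<open>j\<close> can guess after having decoded \<open>W\<^sub>j\<close>, does not depend on \<open>W\<^sub>i\<close>. On typical realizations
  the density ratio is at most \<open>(const \<cdot> P)\<^sup>n\<close>, and for the surrogates the decoding sets of the different
  pairs \<open>(w\<^sub>i, w\<^sub>j)\<close> are disjoint, so that the numbers of messages satisfy
  \<open>M\<^sub>i M\<^sub>j \<le> (const \<cdot> P)\<^sup>n\<close>.

  Achievability. The users of an acyclic set decode along the arcs and cancel all interference, so that only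
  a point-to-point code is needed that works for all channels at once. A channel
  whose \<open>\<bar>ln |h|\<bar>\<close> is bounded on time average is weak at a small fraction of the times only,
  hence a Gilbert-Varshamov code of small relative Hamming distance over a square QAM alphabet with
  minimum distance decoding will do.

  Combinatorics. Complements of the extreme points of the covering polytope are incidence vectors of sets without
  chordless dicycles. These sets are acyclic, as a shortest dicycle has no chord.
\<close>

section \<open>Gaussian noise and change of measure\<close>

text \<open>The proof closes a circle of inclusions: the DoF region lies in
  \<open>dicycle_polytope\<close>, this in \<open>orthogonal_access_region\<close>, and this in the
  DoF region. Idealness enters in the second one. Why two users share one log P: the density of the
  complex noise is at most 1/pi wherever it is centred, and a centred complex Gaussian of variance s
  has density exp(-|y|^2/s)/(pi s). So replacing the first by the second costs a factor s
  exp(|y|^2/s). The output of receiver j needs s of order P to keep the exponents O(n) in total. The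
  output of receiver i differs from its guess by noise alone, so there a variance free of P will do.
  All factors exp(O(n)) shift the rate bound by a constant only, which is lost against log P. Two
  quantifiers shape the statements. The capacity region is a convex hull over all decoding orders,
  so the constant of the converse must depend neither on the order nor on the power; one law from
  \<open>L\<close> is enough for it. A code, in contrast, has to serve all laws in \<open>L\<close>;
  hence everything after its choice is deterministic on a set of typical channels and
  noises.\<close>

abbreviation real_noise :: "real measure" where
  "real_noise \<equiv> density lborel (normal_density 0 (1 / sqrt 2))"

lemma prob_space_real_noise: "prob_space real_noise"
  by (rule prob_space_normal_density) simp

lemma measurable_Complex [measurable]: "(\<lambda>(x, y). Complex x y) \<in> borel \<Otimes>\<^sub>M borel \<rightarrow>\<^sub>M borel"
proof -
  have eq: "(\<lambda>(x, y). Complex x y) = (\<lambda>p. complex_of_real (fst p) + \<i> * complex_of_real (snd p))"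
    by (auto simp: Complex_eq)
  show ?thesis unfolding eq by measurable
qed

lemma sets_complex_normal [simp, measurable_cong]: "sets complex_normal = sets borel"
  by (simp add: complex_normal_def)

lemma space_complex_normal [simp]: "space complex_normal = UNIV"
  by (simp add: complex_normal_def)

lemma prob_space_complex_normal: "prob_space complex_normal"
proof -
  interpret N: prob_space real_noise by (rule prob_space_real_noise)
  interpret NN: pair_prob_space real_noise real_noise ..
  have "(\<lambda>(x, y). Complex x y) \<in> real_noise \<Otimes>\<^sub>M real_noise \<rightarrow>\<^sub>M borel" by measurable
  then show ?thesis unfolding complex_normal_def by (rule NN.prob_space_distr)
qed

lemma nn_integral_complex_normal:
  assumes [measurable]: "f \<in> borel_measurable borel"
  shows "(\<integral>\<^sup>+z. f z \<partial>complex_normal) = (\<integral>\<^sup>+x. \<integral>\<^sup>+y. f (Complex x y) \<partial>real_noise \<partial>real_noise)"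
proof -
  interpret N: prob_space real_noise by (rule prob_space_real_noise)
  interpret NN: pair_prob_space real_noise real_noise ..
  have *: "(\<lambda>(x, y). Complex x y) \<in> real_noise \<Otimes>\<^sub>M real_noise \<rightarrow>\<^sub>M borel" by measurable
  have "(\<integral>\<^sup>+z. f z \<partial>complex_normal) = (\<integral>\<^sup>+p. f (case p of (x, y) \<Rightarrow> Complex x y) \<partial>(real_noise \<Otimes>\<^sub>M real_noise))"
    unfolding complex_normal_def by (rule nn_integral_distr[OF *]) simp
  also have "\<dots> = (\<integral>\<^sup>+x. \<integral>\<^sup>+y. f (Complex x y) \<partial>real_noise \<partial>real_noise)"
    by (subst N.nn_integral_fst[symmetric]) simp_all
  finally show ?thesis .
qed

text \<open>The noise density \<open>exp (- x\<^sup>2) / sqrt pi\<close> is replaced by its maximum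
  \<open>1 / sqrt pi\<close>, which makes the shift \<open>b\<close> irrelevant. What remains is the
  weight \<open>exp (- y\<^sup>2 / s) / sqrt pi\<close>, that is \<open>sqrt s\<close> times the
  density of the noise scaled by \<open>sqrt s\<close>.\<close>

lemma nn_integral_real_noise_shift:
  assumes [measurable]: "f \<in> borel_measurable borel" and s: "0 < s"
  shows "(\<integral>\<^sup>+x. f (b + x) * ennreal (exp (- (b + x)\<^sup>2 / s)) \<partial>real_noise)
     \<le> ennreal (sqrt s) * (\<integral>\<^sup>+x. f (sqrt s * x) \<partial>real_noise)"
proof -
  have dens: "normal_density 0 (1 / sqrt 2) x = exp (- x\<^sup>2) / sqrt pi" for x
    by (simp add: normal_density_def power_divide)
  let ?g = "\<lambda>y. f y * ennreal (exp (- y\<^sup>2 / s) / sqrt pi)"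
  have "(\<integral>\<^sup>+x. f (b + x) * ennreal (exp (- (b + x)\<^sup>2 / s)) \<partial>real_noise) =
    (\<integral>\<^sup>+x. ennreal (exp (- x\<^sup>2) / sqrt pi) * (f (b + x) * ennreal (exp (- (b + x)\<^sup>2 / s))) \<partial>lborel)"
    by (subst nn_integral_density) (auto simp: dens)
  \<comment> \<open>The factor 1 brings the translation into the form of the affine substitution
    rule.\<close>
  also have "\<dots> \<le> (\<integral>\<^sup>+x. ?g (b + 1 * x) \<partial>lborel)"
  proof (rule nn_integral_mono)
    fix x :: real
    have "ennreal (exp (- x\<^sup>2) / sqrt pi) * ennreal (exp (- (b + x)\<^sup>2 / s)) \<le> ennreal (exp (- (b + x)\<^sup>2 / s) / sqrt pi)"
      by (subst ennreal_mult[symmetric]) (auto intro!: ennreal_leI simp: divide_simps)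
    from mult_left_mono[OF this, of "f (b + x)"]
    show "ennreal (exp (- x\<^sup>2) / sqrt pi) * (f (b + x) * ennreal (exp (- (b + x)\<^sup>2 / s))) \<le> ?g (b + 1 * x)"
      by (simp add: mult_ac)
  qed
  also have "\<dots> = (\<integral>\<^sup>+x. ?g x \<partial>lborel)"
    using nn_integral_real_affine[of ?g 1 b] by simp
  also have "\<dots> = ennreal (sqrt s) * (\<integral>\<^sup>+x. ?g (sqrt s * x) \<partial>lborel)"
    using nn_integral_real_affine[of ?g "sqrt s" 0] s by simp
  also have "(\<integral>\<^sup>+x. ?g (sqrt s * x) \<partial>lborel) = (\<integral>\<^sup>+x. f (sqrt s * x) \<partial>real_noise)"
    using s by (subst nn_integral_density) (auto simp: dens power_mult_distrib mult_ac)
  finally show ?thesis .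
qed

text \<open>One real dimension after the other, each at the price \<open>sqrt s\<close>. Hence a
  complex symbol costs \<open>s\<close>, and a variance proportional to the power costs a full log
  P.\<close>

lemma nn_integral_complex_normal_shift:
  assumes [measurable]: "f \<in> borel_measurable borel" and s: "0 < s"
  shows "(\<integral>\<^sup>+z. f (b + z) * ennreal (exp (- (cmod (b + z))\<^sup>2 / s)) \<partial>complex_normal)
     \<le> ennreal s * (\<integral>\<^sup>+z. f (complex_of_real (sqrt s) * z) \<partial>complex_normal)"
proof -
  interpret N: prob_space real_noise by (rule prob_space_real_noise)
  interpret NN: pair_prob_space real_noise real_noise ..
  let ?e = "\<lambda>b x. ennreal (exp (- (b + x)\<^sup>2 / s))"
  have plus: "b + Complex x y = Complex (Re b + x) (Im b + y)" for x y
    by (simp add: complex_eq_iff)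
  have scale: "complex_of_real (sqrt s) * Complex x y = Complex (sqrt s * x) (sqrt s * y)" for x y
    by (simp add: complex_eq_iff)
  have e: "ennreal (exp (- ((cmod (Complex (b + x) (b' + y)))\<^sup>2 / s))) =
      ennreal (exp (- ((b' + y)\<^sup>2 / s))) * ennreal (exp (- ((b + x)\<^sup>2 / s)))" for b b' x y
    by (subst ennreal_mult[symmetric]) (auto simp: cmod_def exp_add[symmetric] add_divide_distrib diff_divide_distrib)
  have "(\<integral>\<^sup>+z. f (b + z) * ennreal (exp (- (cmod (b + z))\<^sup>2 / s)) \<partial>complex_normal) =
      (\<integral>\<^sup>+x. (\<integral>\<^sup>+y. f (Complex (Re b + x) (Im b + y)) * ?e (Im b) y \<partial>real_noise) * ?e (Re b) x \<partial>real_noise)"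
    by (subst nn_integral_complex_normal) (auto simp: plus e mult.assoc[symmetric] nn_integral_multc)
  also have "\<dots> \<le> (\<integral>\<^sup>+x. (ennreal (sqrt s) * (\<integral>\<^sup>+y. f (Complex (Re b + x) (sqrt s * y)) \<partial>real_noise)) * ?e (Re b) x \<partial>real_noise)"
    by (intro nn_integral_mono mult_right_mono nn_integral_real_noise_shift s) auto
  also have "\<dots> \<le> ennreal (sqrt s) * (\<integral>\<^sup>+x. ennreal (sqrt s) * (\<integral>\<^sup>+y. f (Complex (sqrt s * x) (sqrt s * y)) \<partial>real_noise) \<partial>real_noise)"
    by (rule nn_integral_real_noise_shift[OF _ s]) measurable
  also have "\<dots> = ennreal s * (\<integral>\<^sup>+z. f (complex_of_real (sqrt s) * z) \<partial>complex_normal)"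
    using s by (simp add: nn_integral_complex_normal scale nn_integral_cmult mult.assoc[symmetric] ennreal_mult[symmetric])
  finally show ?thesis .
qed

text \<open>An exponential moment for Chernoff's bound on the noise energy. The exponent 1/2 is half
  the critical value 1 for variance 1/2, and the integrand becomes a Gaussian of variance 1.\<close>

lemma nn_integral_real_noise_exp: "(\<integral>\<^sup>+x. ennreal (exp (x\<^sup>2 / 2)) \<partial>real_noise) = ennreal (sqrt 2)"
proof -
  have *: "ennreal (normal_density 0 (1 / sqrt 2) x) * ennreal (exp (x\<^sup>2 / 2)) = ennreal (sqrt 2) * ennreal (std_normal_density x)" for x
  proof -
    have "exp (- x\<^sup>2) * exp (x\<^sup>2 / 2) = exp (- (x\<^sup>2 / 2))" by (simp add: exp_add[symmetric])
    then show ?thesis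
      by (subst (1 2) ennreal_mult[symmetric]) (auto simp: normal_density_def real_sqrt_mult power_divide field_simps)
  qed
  interpret S: prob_space "density lborel std_normal_density" by (rule prob_space_normal_density) simp
  have "(\<integral>\<^sup>+x. ennreal (std_normal_density x) \<partial>lborel) = 1"
    using S.emeasure_space_1 by (subst (asm) emeasure_density) auto
  then show ?thesis
    by (simp add: nn_integral_density * nn_integral_cmult)
qed

lemma nn_integral_complex_normal_exp: "(\<integral>\<^sup>+z. ennreal (exp ((cmod z)\<^sup>2 / 2)) \<partial>complex_normal) = 2"
proof -
  have e: "ennreal (exp ((cmod (Complex x y))\<^sup>2 / 2)) = ennreal (exp (x\<^sup>2 / 2)) * ennreal (exp (y\<^sup>2 / 2))" for x y
    by (subst ennreal_mult[symmetric]) (auto simp: cmod_def exp_add[symmetric] add_divide_distrib)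
  have "ennreal (sqrt 2) * ennreal (sqrt 2) = 2"
    by (subst ennreal_mult[symmetric]) auto
  then show ?thesis
    by (subst nn_integral_complex_normal) (simp_all add: e nn_integral_cmult nn_integral_multc nn_integral_real_noise_exp)
qed

section \<open>Integrals over product measures, one coordinate at a time\<close>

text \<open>Redrawing a coordinate independently does not change the product law. This isolates a
  coordinate without splitting the index set \<open>UNIV\<close>.\<close>

lemma nn_integral_PiM_resample:
  assumes M: "\<And>i. prob_space (M i)" and f [measurable]: "f \<in> borel_measurable (PiM UNIV M)"
  shows "(\<integral>\<^sup>+x. f x \<partial>PiM UNIV M) = (\<integral>\<^sup>+u. \<integral>\<^sup>+x. f (x(i := u)) \<partial>PiM UNIV M \<partial>M i)"
proof -
  interpret P: prob_space "PiM UNIV M" by (rule prob_space_PiM) (rule M)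
  interpret I: prob_space "M i" by (rule M)
  interpret PP: pair_prob_space "M i" "PiM UNIV M" ..
  have m: "(\<lambda>(u, x). x(i := u)) \<in> M i \<Otimes>\<^sub>M PiM UNIV M \<rightarrow>\<^sub>M PiM UNIV M"
    unfolding split_beta' by (rule measurable_fun_upd[where J = UNIV]) simp_all
  have "(\<integral>\<^sup>+x. f x \<partial>PiM UNIV M) = (\<integral>\<^sup>+x. f x \<partial>distr (M i \<Otimes>\<^sub>M PiM UNIV M) (PiM UNIV M) (\<lambda>(u, x). x(i := u)))"
    using distr_pair_PiM_eq_PiM[of UNIV M i] M by simp
  also have "\<dots> = (\<integral>\<^sup>+p. f (case p of (u, x) \<Rightarrow> x(i := u)) \<partial>(M i \<Otimes>\<^sub>M PiM UNIV M))"
    by (rule nn_integral_distr[OF m]) simp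
  also have "\<dots> = (\<integral>\<^sup>+u. \<integral>\<^sup>+x. f (x(i := u)) \<partial>PiM UNIV M \<partial>M i)"
    using measurable_compose[OF m f] by (subst P.nn_integral_fst[symmetric]) auto
  finally show ?thesis .
qed

lemma nn_integral_PiM_component:
  assumes M: "\<And>i. prob_space (M i)" and [measurable]: "f \<in> borel_measurable (M i)"
  shows "(\<integral>\<^sup>+x. f (x i) \<partial>PiM UNIV M) = (\<integral>\<^sup>+u. f u \<partial>M i)"
proof -
  interpret P: prob_space "PiM UNIV M" by (rule prob_space_PiM) (rule M)
  show ?thesis
    by (subst nn_integral_PiM_resample[of M _ i]) (auto simp: M P.emeasure_space_1)
qed

lemma nn_integral_PiM_two_components:
  assumes M: "\<And>i. prob_space (M i)" and "i \<noteq> j"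
    and f [measurable]: "(\<lambda>(u, v). f u v) \<in> borel_measurable (M i \<Otimes>\<^sub>M M j)"
  shows "(\<integral>\<^sup>+x. f (x i) (x j) \<partial>PiM UNIV M) = (\<integral>\<^sup>+u. \<integral>\<^sup>+v. f u v \<partial>M j \<partial>M i)"
proof -
  interpret P: prob_space "PiM UNIV M" by (rule prob_space_PiM) (rule M)
  have "(\<integral>\<^sup>+x. f (x i) (x j) \<partial>PiM UNIV M) = (\<integral>\<^sup>+u. \<integral>\<^sup>+x. f u (x j) \<partial>PiM UNIV M \<partial>M i)"
    using assms(2) by (subst nn_integral_PiM_resample[of M _ i]) (auto simp: M)
  also have "\<dots> = (\<integral>\<^sup>+u. \<integral>\<^sup>+v. f u v \<partial>M j \<partial>M i)"
    by (intro nn_integral_cong nn_integral_PiM_component M) measurable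
  finally show ?thesis .
qed

text \<open>Tensorization of a one-letter inequality. \<open>step\<close> is assumed for every
  \<open>G\<close> because the induction applies it to sections of \<open>F\<close> in which all
  other letters are fixed.\<close>

lemma nn_integral_PiM_tensor:
  fixes \<nu> :: "'a measure" and Y :: "'b measure"
  assumes \<nu>: "prob_space \<nu>"
    and [measurable]: "\<And>t. A t \<in> \<nu> \<rightarrow>\<^sub>M Y" "\<And>t. B t \<in> \<nu> \<rightarrow>\<^sub>M Y" "\<And>t. \<omega> t \<in> borel_measurable \<nu>"
    and step: "\<And>t G. t < n \<Longrightarrow> G \<in> borel_measurable Y \<Longrightarrow>
       (\<integral>\<^sup>+u. G (A t u) * \<omega> t u \<partial>\<nu>) \<le> c t * (\<integral>\<^sup>+u. G (B t u) \<partial>\<nu>)"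
    and F: "F \<in> borel_measurable (PiM {..<n} (\<lambda>_. Y))"
  shows "(\<integral>\<^sup>+z. F (\<lambda>t\<in>{..<n}. A t (z t)) * (\<Prod>t<n. \<omega> t (z t)) \<partial>PiM UNIV (\<lambda>_::nat. \<nu>))
    \<le> (\<Prod>t<n. c t) * (\<integral>\<^sup>+z. F (\<lambda>t\<in>{..<n}. B t (z t)) \<partial>PiM UNIV (\<lambda>_. \<nu>))"
  using step F
proof (induction n arbitrary: F)
  case 0
  interpret P: prob_space "PiM UNIV (\<lambda>_::nat. \<nu>)" by (rule prob_space_PiM) (rule \<nu>)
  show ?case by (simp add: restrict_def)
next
  case (Suc n)
  note [measurable] = Suc.prems(2)
  interpret \<nu>: prob_space \<nu> by (rule \<nu>)
  interpret P: prob_space "PiM UNIV (\<lambda>_::nat. \<nu>)" by (rule prob_space_PiM) (rule \<nu>)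
  interpret PP: pair_prob_space \<nu> "PiM UNIV (\<lambda>_::nat. \<nu>)" ..
  let ?P = "PiM UNIV (\<lambda>_::nat. \<nu>)"
  have mC: "(\<lambda>z. \<lambda>t\<in>{..<n}. C t (z t)) \<in> ?P \<rightarrow>\<^sub>M PiM {..<n} (\<lambda>_. Y)" if [measurable]: "\<And>t. C t \<in> \<nu> \<rightarrow>\<^sub>M Y" for C
    by measurable
  define a where "a z = (\<lambda>t\<in>{..<n}. A t (z t))" for z
  define b where "b z = (\<lambda>t\<in>{..<n}. B t (z t))" for z
  have [measurable]: "a \<in> ?P \<rightarrow>\<^sub>M PiM {..<n} (\<lambda>_. Y)" "b \<in> ?P \<rightarrow>\<^sub>M PiM {..<n} (\<lambda>_. Y)"
    unfolding a_def b_def by (intro mC; simp)+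
  have restr: "(\<lambda>t\<in>{..<Suc n}. A t ((z(n := u)) t)) = (a z)(n := A n u)"
    "(\<lambda>t\<in>{..<Suc n}. B t ((z(n := u)) t)) = (b z)(n := B n u)" for z u
    by (auto simp: fun_eq_iff a_def b_def)
  have FP: "(\<lambda>p. F ((f p)(n := g p))) \<in> borel_measurable Q"
    if [measurable]: "f \<in> Q \<rightarrow>\<^sub>M PiM {..<n} (\<lambda>_. Y)" "g \<in> Q \<rightarrow>\<^sub>M Y" for f g and Q :: "'z measure"
    by (rule measurable_compose[OF measurable_fun_upd[where J = "{..<n}"] Suc.prems(2)]) (auto intro: that)
  have Fa [measurable (raw)]: "(\<lambda>u. F ((a z)(n := D u))) \<in> borel_measurable Q"
    if z: "z \<in> space ?P" and D: "D \<in> Q \<rightarrow>\<^sub>M Y" for z D and Q :: "'z measure"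
    by (rule FP[OF measurable_const D]) (rule measurable_space[OF _ z], measurable)
  have mA: "(\<lambda>z. F (\<lambda>t\<in>{..<Suc n}. A t (z t)) * (\<Prod>t<Suc n. \<omega> t (z t))) \<in> borel_measurable ?P" by measurable
  have "(\<integral>\<^sup>+z. F (\<lambda>t\<in>{..<Suc n}. A t (z t)) * (\<Prod>t<Suc n. \<omega> t (z t)) \<partial>?P)
     = (\<integral>\<^sup>+u. \<integral>\<^sup>+z. F ((a z)(n := A n u)) * (\<Prod>t<n. \<omega> t (z t)) * \<omega> n u \<partial>?P \<partial>\<nu>)"
    by (subst nn_integral_PiM_resample[OF \<nu> mA, of n]) (intro nn_integral_cong, subst restr, simp add: mult.assoc)
  \<comment> \<open>Letter \<open>n\<close> goes innermost, so that \<open>step\<close> applies for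
    fixed remaining letters.\<close>
  also have "\<dots> = (\<integral>\<^sup>+z. \<integral>\<^sup>+u. F ((a z)(n := A n u)) * (\<Prod>t<n. \<omega> t (z t)) * \<omega> n u \<partial>\<nu> \<partial>?P)"
    by (rule PP.Fubini'[symmetric]) (use FP in measurable)
  also have "\<dots> = (\<integral>\<^sup>+z. (\<Prod>t<n. \<omega> t (z t)) * (\<integral>\<^sup>+u. F ((a z)(n := A n u)) * \<omega> n u \<partial>\<nu>) \<partial>?P)"
    by (intro nn_integral_cong, subst nn_integral_cmult[symmetric]) (auto simp: mult_ac)
  also have "\<dots> \<le> (\<integral>\<^sup>+z. (\<Prod>t<n. \<omega> t (z t)) * (c n * (\<integral>\<^sup>+u. F ((a z)(n := B n u)) \<partial>\<nu>)) \<partial>?P)"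
    by (intro nn_integral_mono mult_left_mono Suc.prems(1)[of n "\<lambda>y. F ((a _)(n := y))"]) (use FP in auto)
  also have "\<dots> = c n * (\<integral>\<^sup>+z. \<integral>\<^sup>+u. F ((a z)(n := B n u)) * (\<Prod>t<n. \<omega> t (z t)) \<partial>\<nu> \<partial>?P)"
  proof -
    have "(\<integral>\<^sup>+z. (\<Prod>t<n. \<omega> t (z t)) * (c n * (\<integral>\<^sup>+u. F ((a z)(n := B n u)) \<partial>\<nu>)) \<partial>?P) =
        (\<integral>\<^sup>+z. c n * (\<integral>\<^sup>+u. F ((a z)(n := B n u)) * (\<Prod>t<n. \<omega> t (z t)) \<partial>\<nu>) \<partial>?P)"
      by (intro nn_integral_cong, subst nn_integral_multc) (auto simp: mult_ac)
    also have "\<dots> = c n * (\<integral>\<^sup>+z. \<integral>\<^sup>+u. F ((a z)(n := B n u)) * (\<Prod>t<n. \<omega> t (z t)) \<partial>\<nu> \<partial>?P)"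
      by (rule nn_integral_cmult) (use FP in measurable)
    finally show ?thesis .
  qed
  \<comment> \<open>Now letter \<open>n\<close> goes outermost: for fixed \<open>u\<close> the
    remaining letters fall under the induction hypothesis.\<close>
  also have "\<dots> = c n * (\<integral>\<^sup>+u. \<integral>\<^sup>+z. F ((a z)(n := B n u)) * (\<Prod>t<n. \<omega> t (z t)) \<partial>?P \<partial>\<nu>)"
    by (intro arg_cong2[of _ _ _ _ "(*)"] refl PP.Fubini') (use FP in measurable)
  also have "\<dots> \<le> c n * (\<integral>\<^sup>+u. (\<Prod>t<n. c t) * (\<integral>\<^sup>+z. F ((b z)(n := B n u)) \<partial>?P) \<partial>\<nu>)"
  proof (intro mult_left_mono nn_integral_mono)
    fix u assume u: "u \<in> space \<nu>"
    have "(\<lambda>y. F (y(n := B n u))) \<in> borel_measurable (PiM {..<n} (\<lambda>_. Y))"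
      by (rule FP[OF measurable_ident_sets[OF refl] measurable_const]) (rule measurable_space[OF _ u], measurable)
    from Suc.IH[OF Suc.prems(1) this] less_SucI
    show "(\<integral>\<^sup>+z. F ((a z)(n := B n u)) * (\<Prod>t<n. \<omega> t (z t)) \<partial>?P) \<le> (\<Prod>t<n. c t) * (\<integral>\<^sup>+z. F ((b z)(n := B n u)) \<partial>?P)"
      unfolding a_def b_def by blast
  qed simp
  also have "\<dots> = (\<Prod>t<Suc n. c t) * (\<integral>\<^sup>+u. \<integral>\<^sup>+z. F ((b z)(n := B n u)) \<partial>?P \<partial>\<nu>)"
  proof -
    have "(\<lambda>(u, z). F ((b z)(n := B n u))) \<in> borel_measurable (\<nu> \<Otimes>\<^sub>M ?P)"
      unfolding split_beta' by (rule FP) measurable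
    from P.borel_measurable_nn_integral[OF this] show ?thesis
      by (simp add: nn_integral_cmult mult_ac)
  qed
  also have "(\<integral>\<^sup>+u. \<integral>\<^sup>+z. F ((b z)(n := B n u)) \<partial>?P \<partial>\<nu>)
     = (\<integral>\<^sup>+z. F (\<lambda>t\<in>{..<Suc n}. B t (z t)) \<partial>?P)"
    by (subst nn_integral_PiM_resample[OF \<nu>, of _ n]) (measurable, subst restr, rule refl)
  finally show ?case .
qed

section \<open>Energy of the noise\<close>

abbreviation noise_vector :: "('k::finite \<Rightarrow> complex) measure" where
  "noise_vector \<equiv> PiM UNIV (\<lambda>_. complex_normal)"

lemma prob_space_noise_vector: "prob_space noise_vector"
  by (intro prob_space_PiM prob_space_complex_normal)

lemma prob_space_noise: "prob_space noise_measure"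
  unfolding noise_measure_def by (intro prob_space_PiM prob_space_noise_vector)

lemma sets_noise_measure [measurable_cong]:
  "sets (noise_measure :: (nat \<Rightarrow> 'k::finite \<Rightarrow> complex) measure) = sets (PiM UNIV (\<lambda>_. PiM UNIV (\<lambda>_. borel)))"
  unfolding noise_measure_def by (intro sets_PiM_cong refl) simp_all

lemma measurable_noise_component:
  fixes f :: "'n \<Rightarrow> nat \<Rightarrow> 'k::finite \<Rightarrow> complex"
  assumes "f \<in> N \<rightarrow>\<^sub>M (noise_measure :: (nat \<Rightarrow> 'k::finite \<Rightarrow> complex) measure)"
  shows "(\<lambda>x. f x t k) \<in> borel_measurable N"
proof -
  have "(\<lambda>z. z t k) \<in> PiM UNIV (\<lambda>_. noise_vector) \<rightarrow>\<^sub>M complex_normal"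
    by (rule measurable_compose[OF measurable_component_singleton[of t UNIV "\<lambda>_. noise_vector"]
          measurable_component_singleton[of k UNIV "\<lambda>_. complex_normal"]]) auto
  then have "(\<lambda>z. z t k) \<in> borel_measurable (noise_measure :: (nat \<Rightarrow> 'k \<Rightarrow> complex) measure)"
    by (subst (asm) measurable_cong_sets[OF refl sets_complex_normal]) (simp add: noise_measure_def)
  from measurable_compose[OF assms this] show ?thesis .
qed

lemma measurable_cmod_noise_component [measurable (raw)]:
  fixes f :: "'n \<Rightarrow> nat \<Rightarrow> 'k::finite \<Rightarrow> complex"
  assumes "f \<in> N \<rightarrow>\<^sub>M (noise_measure :: (nat \<Rightarrow> 'k::finite \<Rightarrow> complex) measure)"
  shows "(\<lambda>x. cmod (f x t k)) \<in> borel_measurable N"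
  using measurable_noise_component[OF assms] by measurable

lemma nn_integral_noise_exp:
  "(\<integral>\<^sup>+z. (\<Prod>t<n. ennreal (exp ((cmod (z t k))\<^sup>2 / 2))) \<partial>noise_measure) \<le> 2 ^ n"
proof -
  \<comment> \<open>Tensorization with a one-point output space: \<open>A\<close> and
    \<open>B\<close> carry no information and only the weights are left.\<close>
  have "(\<integral>\<^sup>+z. (\<lambda>_. 1) (\<lambda>t\<in>{..<n}. ()) * (\<Prod>t<n. ennreal (exp ((cmod (z t k))\<^sup>2 / 2))) \<partial>noise_measure)
     \<le> (\<Prod>t<n. 2) * (\<integral>\<^sup>+z. (\<lambda>_. 1) (\<lambda>t\<in>{..<n}. ()) \<partial>(noise_measure :: (nat \<Rightarrow> 'a \<Rightarrow> complex) measure))"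
    unfolding noise_measure_def
  proof (rule nn_integral_PiM_tensor[where A = "\<lambda>_ _. ()" and B = "\<lambda>_ _. ()" and Y = "count_space UNIV"
        and \<omega> = "\<lambda>_ u. ennreal (exp ((cmod (u k))\<^sup>2 / 2))"])
    interpret prob_space "noise_vector :: ('a \<Rightarrow> complex) measure" by (rule prob_space_noise_vector)
    fix G :: "unit \<Rightarrow> ennreal"
    have "(\<integral>\<^sup>+u. ennreal (exp ((cmod (u k))\<^sup>2 / 2)) \<partial>noise_vector) = 2"
    proof -
      have "(\<lambda>z. ennreal (exp ((cmod z)\<^sup>2 / 2))) \<in> borel_measurable complex_normal" by measurable
      from nn_integral_PiM_component[of "\<lambda>_. complex_normal", OF prob_space_complex_normal this, of k]
      show ?thesis by (simp only: nn_integral_complex_normal_exp)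
    qed
    then show "(\<integral>\<^sup>+u. G () * ennreal (exp ((cmod (u k))\<^sup>2 / 2)) \<partial>noise_vector) \<le>
       2 * (\<integral>\<^sup>+u. G () \<partial>(noise_vector :: ('a \<Rightarrow> complex) measure))"
      by (subst nn_integral_cmult) (auto simp: emeasure_space_1 mult_ac)
  qed (auto intro: prob_space_noise_vector)
  then show ?thesis
    using prob_space.emeasure_space_1[OF prob_space_noise[where 'a = 'a]] by simp
qed

text \<open>The mean of the energy is \<open>n\<close>. The factor 4 makes Chernoff's bound decay
  and determines the squared distance \<open>16 * n\<close> asked of codewords below.\<close>

definition noise_good :: "nat \<Rightarrow> (nat \<Rightarrow> 'k \<Rightarrow> complex) \<Rightarrow> bool" where
  "noise_good n z \<longleftrightarrow> (\<forall>k. (\<Sum>t<n. (cmod (z t k))\<^sup>2) \<le> 4 * n)"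

lemma measurable_noise_good [measurable]: "Measurable.pred noise_measure (noise_good n)"
  unfolding noise_good_def by measurable

text \<open>Chernoff: half the energy exceeds \<open>2 * n\<close> on this event, while its
  exponential has mean at most \<open>2 ^ n\<close>; and 2 is less than
  \<open>exp 2\<close>.\<close>

lemma prob_noise_energy_le:
  "measure noise_measure {z \<in> space noise_measure. \<not> (\<Sum>t<n. (cmod (z t k))\<^sup>2) \<le> 4 * n} \<le> (2 / exp 2) ^ n"
proof -
  interpret prob_space "noise_measure :: (nat \<Rightarrow> 'a \<Rightarrow> complex) measure" by (rule prob_space_noise)
  let ?S = "{z \<in> space (noise_measure :: (nat \<Rightarrow> 'a \<Rightarrow> complex) measure). \<not> (\<Sum>t<n. (cmod (z t k))\<^sup>2) \<le> 4 * n}"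
  have "emeasure noise_measure ?S = (\<integral>\<^sup>+z. indicator ?S z \<partial>noise_measure)"
    by (subst nn_integral_indicator) auto
  also have "\<dots> \<le> (\<integral>\<^sup>+z. ennreal (exp (- (2 * n))) * (\<Prod>t<n. ennreal (exp ((cmod (z t k))\<^sup>2 / 2))) \<partial>noise_measure)"
  proof (rule nn_integral_mono)
    fix z :: "nat \<Rightarrow> 'a \<Rightarrow> complex"
    have *: "ennreal (exp (- (2 * n))) * (\<Prod>t<n. ennreal (exp ((cmod (z t k))\<^sup>2 / 2)))
        = ennreal (exp ((\<Sum>t<n. (cmod (z t k))\<^sup>2) / 2 - 2 * n))"
      by (simp add: prod_ennreal ennreal_mult[symmetric] prod_nonneg exp_sum[symmetric] exp_add[symmetric] sum_divide_distrib)
    show "indicator ?S z \<le> ennreal (exp (- (2 * n))) * (\<Prod>t<n. ennreal (exp ((cmod (z t k))\<^sup>2 / 2)))"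
      unfolding * by (auto simp: indicator_def)
  qed
  also have "\<dots> \<le> ennreal (exp (- (2 * n))) * 2 ^ n"
    by (subst nn_integral_cmult) (auto intro!: mult_left_mono nn_integral_noise_exp)
  also have "\<dots> = ennreal ((2 / exp 2) ^ n)"
  proof -
    have "exp (- (2 * n)) * 2 ^ n = (2 / exp 2 :: real) ^ n"
      by (simp add: power_divide exp_minus field_simps flip: exp_of_nat_mult)
    then have "ennreal ((2 / exp 2) ^ n) = ennreal (exp (- (2 * n)) * 2 ^ n)" by simp
    also have "\<dots> = ennreal (exp (- (2 * n))) * ennreal 2 ^ n"
      by (subst ennreal_mult) (simp_all flip: ennreal_power)
    finally show ?thesis by simp
  qed
  finally show ?thesis by (simp add: emeasure_eq_measure)
qed

lemma prob_noise_good: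
  "1 - CARD('k) * (2 / exp 2) ^ n \<le> measure noise_measure {z \<in> space noise_measure. noise_good n (z :: nat \<Rightarrow> 'k::finite \<Rightarrow> complex)}"
proof -
  interpret prob_space "noise_measure :: (nat \<Rightarrow> 'k \<Rightarrow> complex) measure" by (rule prob_space_noise)
  let ?S = "\<lambda>k. {z \<in> space (noise_measure :: (nat \<Rightarrow> 'k \<Rightarrow> complex) measure). \<not> (\<Sum>t<n. (cmod (z t k))\<^sup>2) \<le> 4 * n}"
  have "prob (\<Union>k\<in>UNIV. ?S k) \<le> (\<Sum>k\<in>UNIV. prob (?S k))"
    by (rule finite_measure_subadditive_finite) auto
  also have "\<dots> \<le> (\<Sum>k\<in>(UNIV::'k set). (2 / exp 2) ^ n)"
    by (intro sum_mono prob_noise_energy_le)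
  finally have "prob (\<Union>k\<in>UNIV. ?S k) \<le> CARD('k) * (2 / exp 2) ^ n" by simp
  moreover have "{z \<in> space noise_measure. noise_good n (z :: nat \<Rightarrow> 'k \<Rightarrow> complex)} = space noise_measure - (\<Union>k\<in>UNIV. ?S k)"
    by (auto simp: noise_good_def)
  moreover have "(\<Union>k\<in>UNIV. ?S k) \<in> events" by measurable
  ultimately show ?thesis by (simp add: prob_compl)
qed

section \<open>Uniform messages\<close>

lemma space_message_measure: "space (message_measure M) = (\<Pi>\<^sub>E i\<in>UNIV. {1..M i})"
  by (simp add: message_measure_def space_PiM space_uniform_count_measure)

lemma sets_message_measure: "sets (message_measure M) = Pow (space (message_measure (M :: 'k::finite \<Rightarrow> nat)))"
proof -
  have "sets (message_measure M) = sets (PiM UNIV (\<lambda>i. count_space {1..M i}))"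
    unfolding message_measure_def by (rule sets_PiM_cong) (auto simp: sets_uniform_count_measure)
  also have "\<dots> = Pow (space (message_measure M))"
    by (subst count_space_PiM_finite) (auto simp: space_message_measure)
  finally show ?thesis .
qed

lemma measurable_message [measurable]: "(\<lambda>w. w) \<in> message_measure (M :: 'k::finite \<Rightarrow> nat) \<rightarrow>\<^sub>M count_space UNIV"
  by (auto simp: measurable_def sets_message_measure)

lemma measurable_message_any: "f \<in> message_measure (M :: 'k::finite \<Rightarrow> nat) \<rightarrow>\<^sub>M N" if "\<And>w. f w \<in> space N"
  using that by (auto simp: measurable_def sets_message_measure)

lemma prob_space_message:
  assumes "\<And>i. M i \<ge> 1" shows "prob_space (message_measure M)"
  unfolding message_measure_def using assms
  by (intro prob_space_PiM prob_space_uniform_count_measure) auto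

text \<open>Trades the average over message \<open>i\<close> for a sum over its values, the form in
  which disjointness of decoding sets can be used. The other messages keep their law.\<close>

lemma nn_integral_message_resample:
  fixes M :: "'k::finite \<Rightarrow> nat" and G :: "('k \<Rightarrow> nat) \<Rightarrow> ennreal"
  assumes M: "\<And>i. M i \<ge> 1"
  shows "M i * (\<integral>\<^sup>+w. G w \<partial>message_measure M) = (\<integral>\<^sup>+w. (\<Sum>a\<in>{1..M i}. G (w(i := a))) \<partial>message_measure M)"
proof -
  have m: "G \<in> borel_measurable (message_measure M)" for G :: "('k \<Rightarrow> nat) \<Rightarrow> ennreal"
    by (rule measurable_message_any) simp
  have "(\<integral>\<^sup>+w. G w \<partial>message_measure M) =
      (\<integral>\<^sup>+a. \<integral>\<^sup>+w. G (w(i := a)) \<partial>message_measure M \<partial>uniform_count_measure {1..M i})"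
    unfolding message_measure_def
    by (rule nn_integral_PiM_resample)
      (use M m[of G] in \<open>auto intro!: prob_space_uniform_count_measure simp: message_measure_def\<close>)
  also have "\<dots> = (\<Sum>a\<in>{1..M i}. ennreal (1 / M i) * (\<integral>\<^sup>+w. G (w(i := a)) \<partial>message_measure M))"
    by (simp add: uniform_count_measure_def nn_integral_point_measure_finite mult.commute)
  also have "\<dots> = ennreal (1 / M i) * (\<integral>\<^sup>+w. (\<Sum>a\<in>{1..M i}. G (w(i := a))) \<partial>message_measure M)"
    by (subst nn_integral_sum) (auto simp: m sum_distrib_left)
  finally have "M i * (\<integral>\<^sup>+w. G w \<partial>message_measure M) =
     ennreal (M i) * ennreal (1 / M i) * (\<integral>\<^sup>+w. (\<Sum>a\<in>{1..M i}. G (w(i := a))) \<partial>message_measure M)"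
    by (simp only: mult.assoc ennreal_of_nat_eq_real_of_nat)
  also have "ennreal (M i) * ennreal (1 / M i) = 1"
    using M[of i] by (subst ennreal_mult[symmetric]) auto
  finally show ?thesis by (simp only: mult_1_left)
qed

lemma nn_integral_message_le:
  fixes M :: "'k::finite \<Rightarrow> nat" and G :: "('k \<Rightarrow> nat) \<Rightarrow> ennreal"
  assumes M: "\<And>i. M i \<ge> 1" and B: "\<And>w. (\<Sum>a\<in>{1..M i}. G (w(i := a))) \<le> B"
  shows "M i * (\<integral>\<^sup>+w. G w \<partial>message_measure M) \<le> B"
proof -
  interpret prob_space "message_measure M" by (rule prob_space_message) (rule M)
  have "(\<integral>\<^sup>+w. (\<Sum>a\<in>{1..M i}. G (w(i := a))) \<partial>message_measure M) \<le> (\<integral>\<^sup>+w. B \<partial>message_measure M)"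
    by (intro nn_integral_mono B)
  then show ?thesis
    by (simp add: nn_integral_message_resample[where M = M and i = i and G = G, OF M] emeasure_space_1 del: One_nat_def)
qed

section \<open>The channel model\<close>

lemma measurable_channel_component [measurable (raw)]:
  fixes f :: "'n \<Rightarrow> 'k::finite channel"
  assumes "f \<in> N \<rightarrow>\<^sub>M channel_space"
  shows "(\<lambda>x. f x t $ j $ i) \<in> borel_measurable N"
proof -
  have c: "(\<lambda>a :: complex ^ 'k ^ 'k. a $ j $ i) \<in> borel_measurable borel"
    by (intro borel_measurable_continuous_onI continuous_intros)
  have "(\<lambda>x. f x t) \<in> borel_measurable N"
    using measurable_compose[OF assms measurable_component_singleton[of t UNIV "\<lambda>_. borel"]] by simp
  from measurable_compose[OF this c] show ?thesis .
qed

text \<open>A measurable set of channels on which the converse and the code are treated realization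
  by realization. The time average extends over the block only; nonvanishing is asked at all times,
  as the almost sure condition on the laws provides it.\<close>

definition chan_good :: "('k \<Rightarrow> 'k set) \<Rightarrow> real \<Rightarrow> nat \<Rightarrow> 'k::finite channel \<Rightarrow> bool" where
  "chan_good T c n h \<longleftrightarrow> (\<forall>j. \<forall>i\<in>T j. (\<forall>t. h t $ j $ i \<noteq> 0) \<and> (\<Sum>t<n. \<bar>ln (cmod (h t $ j $ i))\<bar>) / n \<le> c)"

lemma measurable_chan_good [measurable]: "Measurable.pred channel_space (chan_good T c n)"
  unfolding chan_good_def by measurable

text \<open>A union bound over the finitely many links; the almost sure condition makes the channels
  with a zero coefficient negligible in the exceptional set.\<close>

lemma prob_chan_good:
  fixes T :: "'k::finite \<Rightarrow> 'k set"
  assumes "regular_channel_laws T L"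
  obtains c where "c \<ge> 1"
    "\<And>\<mu>. \<mu> \<in> L \<Longrightarrow> (\<lambda>n. measure \<mu> {h \<in> space \<mu>. chan_good T c n h}) \<longlonglongrightarrow> 1"
proof -
  obtain c0 where "\<forall>\<mu>\<in>L. \<forall>j. \<forall>i\<in>T j. (AE h in \<mu>. \<forall>t. h t $ j $ i \<noteq> 0) \<and>
      (\<lambda>n. measure \<mu> {h \<in> space \<mu>. (\<Sum>t<n. \<bar>ln (cmod (h t $ j $ i))\<bar>) / n \<le> c0}) \<longlonglongrightarrow> 1"
    using assms unfolding regular_channel_laws_def by auto
  then have c0: "\<And>\<mu> j i. \<mu> \<in> L \<Longrightarrow> i \<in> T j \<Longrightarrow> (AE h in \<mu>. \<forall>t. h t $ j $ i \<noteq> 0)"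
    "\<And>\<mu> j i. \<mu> \<in> L \<Longrightarrow> i \<in> T j \<Longrightarrow>
       (\<lambda>n. measure \<mu> {h \<in> space \<mu>. (\<Sum>t<n. \<bar>ln (cmod (h t $ j $ i))\<bar>) / n \<le> c0}) \<longlonglongrightarrow> 1"
    by auto
  \<comment> \<open>Raised to at least 1, as later arguments divide by \<open>c\<close>; enlarging
    it only weakens the condition.\<close>
  define c where "c = max c0 1"
  have "(\<lambda>n. measure \<mu> {h \<in> space \<mu>. chan_good T c n h}) \<longlonglongrightarrow> 1" if \<mu>: "\<mu> \<in> L" for \<mu>
  proof -
    interpret prob_space \<mu> using assms \<mu> by (auto simp: regular_channel_laws_def)
    have sets [measurable_cong]: "sets \<mu> = sets channel_space"
      using assms \<mu> by (auto simp: regular_channel_laws_def)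
    define \<Lambda> where "\<Lambda> = {(j, i). i \<in> T j}"
    let ?A = "\<lambda>n p. {h \<in> space \<mu>. (\<Sum>t<n. \<bar>ln (cmod (h t $ fst p $ snd p))\<bar>) / n \<le> c0}"
    let ?B = "\<lambda>n p. {h \<in> space \<mu>. \<not> ((\<forall>t. h t $ fst p $ snd p \<noteq> 0) \<and> (\<Sum>t<n. \<bar>ln (cmod (h t $ fst p $ snd p))\<bar>) / n \<le> c)}"
    have B: "prob (?B n p) \<le> 1 - prob (?A n p)" if "p \<in> \<Lambda>" for n p
    proof -
      have "prob (?B n p) \<le> prob (space \<mu> - ?A n p)"
      proof (rule finite_measure_mono_AE)
        have "AE h in \<mu>. \<forall>t. h t $ fst p $ snd p \<noteq> 0" using c0(1)[OF \<mu>] that by (auto simp: \<Lambda>_def)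
        then show "AE h in \<mu>. h \<in> ?B n p \<longrightarrow> h \<in> space \<mu> - ?A n p"
          by eventually_elim (auto simp: c_def)
      qed measurable
      also have "\<dots> = 1 - prob (?A n p)"
        by (rule prob_compl) measurable
      finally show ?thesis .
    qed
    have lower: "1 - (\<Sum>p\<in>\<Lambda>. 1 - prob (?A n p)) \<le> prob {h \<in> space \<mu>. chan_good T c n h}" for n
    proof -
      have eq: "{h \<in> space \<mu>. chan_good T c n h} = space \<mu> - (\<Union>p\<in>\<Lambda>. ?B n p)"
        by (auto simp: chan_good_def \<Lambda>_def)
      have "prob (\<Union>p\<in>\<Lambda>. ?B n p) \<le> (\<Sum>p\<in>\<Lambda>. prob (?B n p))"
        by (rule finite_measure_subadditive_finite) (auto, measurable)
      also have "\<dots> \<le> (\<Sum>p\<in>\<Lambda>. 1 - prob (?A n p))" by (intro sum_mono B)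
      finally have "prob (\<Union>p\<in>\<Lambda>. ?B n p) \<le> (\<Sum>p\<in>\<Lambda>. 1 - prob (?A n p))" .
      moreover have "(\<Union>p\<in>\<Lambda>. ?B n p) \<in> events" by measurable
      ultimately show ?thesis unfolding eq by (simp only: prob_compl)
    qed
    have "(\<lambda>n. 1 - (\<Sum>p\<in>\<Lambda>. 1 - prob (?A n p))) \<longlonglongrightarrow> 1 - (\<Sum>p\<in>\<Lambda>. 1 - 1)"
      by (intro tendsto_intros c0(2)[OF \<mu>]) (auto simp: \<Lambda>_def)
    then have lim: "(\<lambda>n. 1 - (\<Sum>p\<in>\<Lambda>. 1 - prob (?A n p))) \<longlonglongrightarrow> 1" by simp
    show ?thesis
    proof (rule tendsto_sandwich[OF _ _ lim tendsto_const])
      show "\<forall>\<^sub>F n in sequentially. 1 - (\<Sum>p\<in>\<Lambda>. 1 - prob (?A n p)) \<le> prob {h \<in> space \<mu>. chan_good T c n h}"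
        by (rule always_eventually) (rule allI, rule lower)
      show "\<forall>\<^sub>F n in sequentially. prob {h \<in> space \<mu>. chan_good T c n h} \<le> 1"
        by (rule always_eventually) simp
    qed
  qed
  with that[of c] show ?thesis by (auto simp: c_def)
qed

section \<open>The joint probability space\<close>

lemma num_messages_ge_1: "num_messages n R i \<ge> 1"
proof -
  have "0 < \<lceil>2 powr (n * R $ i)\<rceil>" by simp
  then show ?thesis unfolding num_messages_def by linarith
qed

lemma num_messages_ge: "2 powr (n * R $ i) \<le> num_messages n R i"
  unfolding num_messages_def by linarith

lemma space_noise_measure [simp]: "space noise_measure = UNIV"
  by (simp add: noise_measure_def space_PiM)

lemma UNIV_in_sets_noise_measure [simp]: "UNIV \<in> sets noise_measure"
  using sets.top[of noise_measure] by simp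

lemma prob_space_tim_measure:
  assumes "prob_space \<mu>" "\<And>i. M i \<ge> 1"
  shows "prob_space (tim_measure \<mu> M)"
proof -
  interpret \<mu>: prob_space \<mu> by fact
  interpret N: prob_space "noise_measure :: (nat \<Rightarrow> 'a \<Rightarrow> complex) measure" by (rule prob_space_noise)
  interpret W: prob_space "message_measure M" by (rule prob_space_message) (rule assms)
  interpret NW: pair_prob_space "noise_measure :: (nat \<Rightarrow> 'a \<Rightarrow> complex) measure" "message_measure M" ..
  interpret P: pair_prob_space \<mu> "(noise_measure :: (nat \<Rightarrow> 'a \<Rightarrow> complex) measure) \<Otimes>\<^sub>M message_measure M" ..
  show ?thesis unfolding tim_measure_def by unfold_locales
qed

text \<open>The noise is integrated innermost and the channel outermost: the converse fixes the
  channel, changes the measure of the noise for given messages, and sums over the messages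
  afterwards.\<close>

lemma emeasure_tim_measure:
  assumes "prob_space \<mu>" "\<And>i. M i \<ge> 1"
    and S: "{(h, z, w) \<in> space (tim_measure \<mu> M). Q h z w} \<in> sets (tim_measure \<mu> M)"
  shows "emeasure (tim_measure \<mu> M) {(h, z, w) \<in> space (tim_measure \<mu> M). Q h z w} =
    (\<integral>\<^sup>+h. \<integral>\<^sup>+w. \<integral>\<^sup>+z. indicator {z. Q h z w} z \<partial>noise_measure \<partial>message_measure M \<partial>\<mu>)"
proof -
  interpret \<mu>: prob_space \<mu> by fact
  interpret N: prob_space "noise_measure :: (nat \<Rightarrow> 'a \<Rightarrow> complex) measure" by (rule prob_space_noise)
  interpret W: prob_space "message_measure M" by (rule prob_space_message) (rule assms)
  interpret NW: pair_prob_space "noise_measure :: (nat \<Rightarrow> 'a \<Rightarrow> complex) measure" "message_measure M" ..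
  let ?N = "noise_measure :: (nat \<Rightarrow> 'a \<Rightarrow> complex) measure"
  let ?S = "{(h, z, w) \<in> space (tim_measure \<mu> M). Q h z w}"
  have S': "?S \<in> sets (\<mu> \<Otimes>\<^sub>M (?N \<Otimes>\<^sub>M message_measure M))" using S by (simp add: tim_measure_def)
  have "emeasure (tim_measure \<mu> M) ?S = (\<integral>\<^sup>+x. indicator ?S x \<partial>(\<mu> \<Otimes>\<^sub>M (?N \<Otimes>\<^sub>M message_measure M)))"
    using S by (simp add: tim_measure_def)
  also have "\<dots> = (\<integral>\<^sup>+h. \<integral>\<^sup>+p. indicator ?S (h, p) \<partial>(?N \<Otimes>\<^sub>M message_measure M) \<partial>\<mu>)"
    using S' by (intro NW.nn_integral_fst[symmetric]) simp
  also have "\<dots> = (\<integral>\<^sup>+h. \<integral>\<^sup>+w. \<integral>\<^sup>+z. indicator ?S (h, z, w) \<partial>?N \<partial>message_measure M \<partial>\<mu>)"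
  proof (intro nn_integral_cong)
    fix h assume h: "h \<in> space \<mu>"
    have "(\<lambda>p. indicator ?S (h, p) :: ennreal) \<in> borel_measurable (?N \<Otimes>\<^sub>M message_measure M)"
      by (rule measurable_compose[OF measurable_Pair1'[OF h]]) (use S' in simp)
    then show "(\<integral>\<^sup>+p. indicator ?S (h, p) \<partial>(?N \<Otimes>\<^sub>M message_measure M)) =
        (\<integral>\<^sup>+w. \<integral>\<^sup>+z. indicator ?S (h, z, w) \<partial>?N \<partial>message_measure M)"
      by (subst NW.nn_integral_snd[symmetric]) (auto simp: split_beta')
  qed
  also have "\<dots> = (\<integral>\<^sup>+h. \<integral>\<^sup>+w. \<integral>\<^sup>+z. indicator {z. Q h z w} z \<partial>noise_measure \<partial>message_measure M \<partial>\<mu>)"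
    by (intro nn_integral_cong) (auto simp: indicator_def tim_measure_def space_pair_measure)
  finally show ?thesis .
qed

lemma measure_tim_measure_marginals:
  fixes \<mu> :: "'k::finite channel measure"
  assumes \<mu>: "prob_space \<mu>" and M: "\<And>i. M i \<ge> 1"
  shows "Measurable.pred \<mu> Q1 \<Longrightarrow> measure (tim_measure \<mu> M) {(h, z, w) \<in> space (tim_measure \<mu> M). Q1 h} = measure \<mu> {h \<in> space \<mu>. Q1 h}"
    and "Measurable.pred noise_measure Q2 \<Longrightarrow> measure (tim_measure \<mu> M) {(h, z, w) \<in> space (tim_measure \<mu> M). Q2 z} = measure noise_measure {z \<in> space noise_measure. Q2 z}"
    and "measure (tim_measure \<mu> M) {(h, z, w) \<in> space (tim_measure \<mu> M). Q3 w} = measure (message_measure M) {w \<in> space (message_measure M). Q3 w}"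
proof -
  interpret \<mu>: prob_space \<mu> by fact
  interpret N: prob_space "noise_measure :: (nat \<Rightarrow> 'k \<Rightarrow> complex) measure" by (rule prob_space_noise)
  interpret W: prob_space "message_measure M" by (rule prob_space_message) (rule assms)
  interpret NW: pair_prob_space "noise_measure :: (nat \<Rightarrow> 'k \<Rightarrow> complex) measure" "message_measure M" ..
  have t: "measure (tim_measure \<mu> M) (A \<times> B \<times> C) = measure \<mu> A * (measure noise_measure B * measure (message_measure M) C)"
    if "A \<in> sets \<mu>" "B \<in> sets noise_measure" "C \<in> sets (message_measure M)" for A B C
    using that by (simp add: tim_measure_def measure_def NW.emeasure_pair_measure_Times W.emeasure_pair_measure_Times enn2real_mult)
  have sp: "space (tim_measure \<mu> M) = space \<mu> \<times> space noise_measure \<times> space (message_measure M)"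
    by (simp add: tim_measure_def space_pair_measure)
  show "measure (tim_measure \<mu> M) {(h, z, w) \<in> space (tim_measure \<mu> M). Q1 h} = measure \<mu> {h \<in> space \<mu>. Q1 h}"
    if [measurable]: "Measurable.pred \<mu> Q1"
  proof -
    have "{(h, z, w) \<in> space (tim_measure \<mu> M). Q1 h} = {h \<in> space \<mu>. Q1 h} \<times> space noise_measure \<times> space (message_measure M)"
      by (auto simp: sp)
    then show ?thesis using t[of "{h \<in> space \<mu>. Q1 h}" "space noise_measure" "space (message_measure M)"]
      by (simp only: N.prob_space W.prob_space) (simp add: that)
  qed
  show "measure (tim_measure \<mu> M) {(h, z, w) \<in> space (tim_measure \<mu> M). Q2 z} = measure noise_measure {z \<in> space noise_measure. Q2 z}"
    if [measurable]: "Measurable.pred noise_measure Q2"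
  proof -
    have "{(h, z, w) \<in> space (tim_measure \<mu> M). Q2 z} = space \<mu> \<times> {z \<in> space noise_measure. Q2 z} \<times> space (message_measure M)"
      by (auto simp: sp)
    then show ?thesis using t[of "space \<mu>" "{z \<in> space noise_measure. Q2 z}" "space (message_measure M)"]
      by (simp only: \<mu>.prob_space W.prob_space) (use that in \<open>simp add: pred_def\<close>)
  qed
  show "measure (tim_measure \<mu> M) {(h, z, w) \<in> space (tim_measure \<mu> M). Q3 w} = measure (message_measure M) {w \<in> space (message_measure M). Q3 w}"
  proof -
    have "{(h, z, w) \<in> space (tim_measure \<mu> M). Q3 w} = space \<mu> \<times> space noise_measure \<times> {w \<in> space (message_measure M). Q3 w}"
      by (auto simp: sp)
    then show ?thesis using t[of "space \<mu>" "space noise_measure" "{w \<in> space (message_measure M). Q3 w}"]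
      by (simp only: \<mu>.prob_space N.prob_space) (auto simp: sets_message_measure N.prob_space[simplified])
  qed
qed

lemma measurable_received:
  fixes h :: "'n \<Rightarrow> 'k::finite channel"
  assumes [measurable]: "h \<in> N \<rightarrow>\<^sub>M channel_space" "z \<in> N \<rightarrow>\<^sub>M noise_measure" and w: "w \<in> N \<rightarrow>\<^sub>M count_space UNIV"
  shows "(\<lambda>x. received T n f (h x) (z x) (w x) j) \<in> N \<rightarrow>\<^sub>M PiM {..<n} (\<lambda>_. borel)"
proof -
  have [measurable]: "(\<lambda>x. f i (w x i) t) \<in> borel_measurable N" for i t
    by (rule measurable_compose[OF w]) simp
  have [measurable]: "(\<lambda>x. z x t j) \<in> borel_measurable N" for t
    by (rule measurable_noise_component) measurable
  show ?thesis unfolding received_def by measurable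
qed

lemma measurable_tim_components:
  fixes \<mu> :: "'k::finite channel measure"
  assumes "sets \<mu> = sets channel_space"
  shows "fst \<in> tim_measure \<mu> M \<rightarrow>\<^sub>M channel_space" "(\<lambda>x. fst (snd x)) \<in> tim_measure \<mu> M \<rightarrow>\<^sub>M noise_measure"
    "(\<lambda>x. snd (snd x)) \<in> tim_measure \<mu> M \<rightarrow>\<^sub>M count_space UNIV"
proof -
  have [measurable_cong]: "sets \<mu> = sets channel_space" by fact
  show "fst \<in> tim_measure \<mu> M \<rightarrow>\<^sub>M channel_space" "(\<lambda>x. fst (snd x)) \<in> tim_measure \<mu> M \<rightarrow>\<^sub>M noise_measure"
    unfolding tim_measure_def by measurable
  have "(\<lambda>x. snd (snd x)) \<in> tim_measure \<mu> M \<rightarrow>\<^sub>M message_measure M"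
    unfolding tim_measure_def by measurable
  from measurable_compose[OF this measurable_message]
  show "(\<lambda>x. snd (snd x)) \<in> tim_measure \<mu> M \<rightarrow>\<^sub>M count_space UNIV" .
qed

text \<open>By induction along the order. A decoder is measurable for each fixed tuple of passed
  messages, and there are only countably many such tuples.\<close>

lemma measurable_decoded:
  fixes \<mu> :: "'k::finite channel measure"
  assumes \<mu>: "sets \<mu> = sets channel_space" and \<pi>: "decoding_order \<pi>" and g: "measurable_decoders n g"
  shows "(\<lambda>(h, z, w). decoded \<pi> g h (received T n f h z w) j) \<in> tim_measure \<mu> M \<rightarrow>\<^sub>M count_space UNIV"
proof -
  have "wf \<pi>"
    using \<pi> by (auto simp: decoding_order_def acyclic_irrefl wf_iff_acyclic_if_finite)
  note [measurable] = measurable_tim_components[OF \<mu>]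
  let ?y = "\<lambda>x. received T n f (fst x) (fst (snd x)) (snd (snd x))"
  let ?d = "\<lambda>x. decoded \<pi> g (fst x) (?y x)"
  have "(\<lambda>x. ?d x j) \<in> tim_measure \<mu> M \<rightarrow>\<^sub>M count_space UNIV"
    using \<open>wf \<pi>\<close>
  proof (induction j rule: wf_induct_rule)
    case (less j)
    let ?v = "\<lambda>x. restrict (?d x) {k. (k, j) \<in> \<pi>}"
    have v: "?v \<in> tim_measure \<mu> M \<rightarrow>\<^sub>M count_space UNIV"
    proof (subst measurable_count_space_eq2_countable, intro conjI ballI)
      fix a :: "'k \<Rightarrow> nat"
      have [measurable]: "(\<lambda>x. ?v x k) \<in> tim_measure \<mu> M \<rightarrow>\<^sub>M count_space UNIV" for k
        using less.IH[of k] by (cases "(k, j) \<in> \<pi>") auto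
      have "{x \<in> space (tim_measure \<mu> M). \<forall>k. ?v x k = a k} \<in> sets (tim_measure \<mu> M)" by measurable
      also have "{x \<in> space (tim_measure \<mu> M). \<forall>k. ?v x k = a k} = ?v -` {a} \<inter> space (tim_measure \<mu> M)"
        by (auto simp: fun_eq_iff)
      finally show "?v -` {a} \<inter> space (tim_measure \<mu> M) \<in> sets (tim_measure \<mu> M)" .
    qed auto
    have "(\<lambda>x. g j (?y x j) v (fst x)) \<in> tim_measure \<mu> M \<rightarrow>\<^sub>M count_space UNIV" for v
    proof -
      have 1: "(\<lambda>x. (?y x j, fst x)) \<in> tim_measure \<mu> M \<rightarrow>\<^sub>M PiM {..<n} (\<lambda>_. borel) \<Otimes>\<^sub>M channel_space"
        by (intro measurable_Pair measurable_received) measurable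
      have 2: "(\<lambda>(y, h). g j y v h) \<in> (Pi\<^sub>M {..<n} (\<lambda>_. borel) \<Otimes>\<^sub>M channel_space) \<rightarrow>\<^sub>M count_space UNIV"
        using g by (simp add: measurable_decoders_def)
      from measurable_compose[OF 1 2] show ?thesis by simp
    qed
    from measurable_compose_countable[OF this v]
    show ?case by (subst decoded_unfold[OF \<pi>])
  qed
  then show ?thesis by (simp add: split_beta')
qed

section \<open>Converse\<close>

lemma nn_integral_noise_vector_shift:
  assumes [measurable]: "G \<in> borel_measurable borel" and s: "0 < s"
  shows "(\<integral>\<^sup>+u. G (b + u k) * ennreal (exp (- (cmod (b + u k))\<^sup>2 / s)) \<partial>noise_vector)
    \<le> ennreal s * (\<integral>\<^sup>+u. G (complex_of_real (sqrt s) * u k) \<partial>noise_vector)"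
proof -
  let ?G = "\<lambda>z. G (b + z) * ennreal (exp (- (cmod (b + z))\<^sup>2 / s))" and ?H = "\<lambda>z. G (complex_of_real (sqrt s) * z)"
  have G: "?G \<in> borel_measurable complex_normal" and H: "?H \<in> borel_measurable complex_normal" by measurable
  show ?thesis
    using nn_integral_complex_normal_shift[of G s b] s
    by (simp only: nn_integral_PiM_component[of "\<lambda>_. complex_normal", OF prob_space_complex_normal G]
        nn_integral_PiM_component[of "\<lambda>_. complex_normal", OF prob_space_complex_normal H] assms)
qed

text \<open>The second output is treated first: once the first output is fixed, the centre given by
  \<open>m\<close> is a constant, and the one-output lemma applies with variance \<open>v\<close>.
  The first output follows with variance \<open>s\<close>.\<close>

lemma nn_integral_noise_vector_shift2:
  fixes G :: "complex \<times> complex \<Rightarrow> ennreal"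
  assumes [measurable]: "G \<in> borel_measurable borel" "m \<in> borel_measurable borel"
    and s: "0 < s" and v: "0 < v" and "j \<noteq> i"
  shows "(\<integral>\<^sup>+u. G (b + u j, b' + u i) * (ennreal (exp (- (cmod (b + u j))\<^sup>2 / s)) *
            ennreal (exp (- (cmod (b' + u i - m (b + u j)))\<^sup>2 / v))) \<partial>noise_vector)
    \<le> ennreal (s * v) * (\<integral>\<^sup>+u. G (complex_of_real (sqrt s) * u j,
            m (complex_of_real (sqrt s) * u j) + complex_of_real (sqrt v) * u i) \<partial>noise_vector)"
    (is "?L \<le> _ * ?R")
proof -
  let ?w = "\<lambda>x. ennreal (exp (- (cmod x)\<^sup>2 / s))"
  let ?w' = "\<lambda>x. ennreal (exp (- (cmod x)\<^sup>2 / v))"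
  let ?I = "\<lambda>y. \<integral>\<^sup>+z. G (y, complex_of_real (sqrt v) * z + m y) \<partial>complex_normal"
  interpret N: prob_space complex_normal by (rule prob_space_complex_normal)
  have G [measurable]: "(\<lambda>x. G (f x, g x)) \<in> borel_measurable Q"
    if "f \<in> borel_measurable Q" "g \<in> borel_measurable Q" for f g and Q :: "'q measure"
    using measurable_compose[OF borel_measurable_Pair[OF that] assms(1)] .
  have "?L = (\<integral>\<^sup>+y. \<integral>\<^sup>+z. G (b + y, b' + z) * (?w (b + y) * ?w' (b' + z - m (b + y))) \<partial>complex_normal \<partial>complex_normal)"
    by (rule nn_integral_PiM_two_components[where M = "\<lambda>_. complex_normal", OF prob_space_complex_normal \<open>j \<noteq> i\<close>])
      measurable
  also have "\<dots> \<le> (\<integral>\<^sup>+y. (ennreal v * ?I (b + y)) * ?w (b + y) \<partial>complex_normal)"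
  proof (rule nn_integral_mono)
    fix y
    \<comment> \<open>Recentred, the integral over the second output has the form of the one-output
      lemma, with the centre moved into the test function.\<close>
    have "(\<integral>\<^sup>+z. G (b + y, b' + z) * (?w (b + y) * ?w' (b' + z - m (b + y))) \<partial>complex_normal) =
      (\<integral>\<^sup>+z. G (b + y, (b' - m (b + y) + z) + m (b + y)) * ?w' (b' - m (b + y) + z) \<partial>complex_normal) * ?w (b + y)"
    proof -
      have "b' - m (b + y) + z + m (b + y) = b' + z" "b' - m (b + y) + z = b' + z - m (b + y)" for z
        by simp_all
      then show ?thesis by (simp only:) (subst nn_integral_multc[symmetric]; simp add: mult_ac)
    qed
    also have "\<dots> \<le> (ennreal v * ?I (b + y)) * ?w (b + y)"
      by (intro mult_right_mono nn_integral_complex_normal_shift[where f = "\<lambda>z. G (b + y, z + m (b + y))"] v) auto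
    finally show "(\<integral>\<^sup>+z. G (b + y, b' + z) * (?w (b + y) * ?w' (b' + z - m (b + y))) \<partial>complex_normal)
      \<le> (ennreal v * ?I (b + y)) * ?w (b + y)" .
  qed
  also have "\<dots> \<le> ennreal s * (\<integral>\<^sup>+y. ennreal v * ?I (complex_of_real (sqrt s) * y) \<partial>complex_normal)"
    by (rule nn_integral_complex_normal_shift[OF _ s]) measurable
  also have "\<dots> = ennreal (s * v) * (\<integral>\<^sup>+y. ?I (complex_of_real (sqrt s) * y) \<partial>complex_normal)"
    using s v by (subst nn_integral_cmult) (auto simp: ennreal_mult mult.assoc)
  also have "(\<integral>\<^sup>+y. ?I (complex_of_real (sqrt s) * y) \<partial>complex_normal) = ?R"
    by (subst nn_integral_PiM_two_components[where M = "\<lambda>_. complex_normal", OF prob_space_complex_normal \<open>j \<noteq> i\<close>])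
      (measurable, simp add: add.commute)
  finally show ?thesis .
qed

text \<open>Where the exponents \<open>e\<close> add up to at most \<open>\<kappa>\<close>,
  \<open>exp \<kappa>\<close> times the product of the weights is at least 1. So the weights may be
  inserted, and tensorization replaces the outputs \<open>A\<close> by the surrogates
  \<open>B\<close>.\<close>

lemma nn_integral_noise_change_of_measure:
  fixes A B :: "nat \<Rightarrow> ('k::finite \<Rightarrow> complex) \<Rightarrow> 'y" and e :: "nat \<Rightarrow> ('k \<Rightarrow> complex) \<Rightarrow> real"
  assumes A: "\<And>t. A t \<in> noise_vector \<rightarrow>\<^sub>M Y" and B: "\<And>t. B t \<in> noise_vector \<rightarrow>\<^sub>M Y"
    and e: "\<And>t. e t \<in> borel_measurable noise_vector" and c: "\<And>t. 0 \<le> c t"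
    and step: "\<And>t G. G \<in> borel_measurable Y \<Longrightarrow>
      (\<integral>\<^sup>+u. G (A t u) * ennreal (exp (- e t u)) \<partial>noise_vector) \<le> ennreal (c t) * (\<integral>\<^sup>+u. G (B t u) \<partial>noise_vector)"
    and D: "D \<in> sets (PiM {..<n} (\<lambda>_. Y))"
  shows "(\<integral>\<^sup>+z. indicator {z. (\<lambda>t\<in>{..<n}. A t (z t)) \<in> D \<and> (\<Sum>t<n. e t (z t)) \<le> \<kappa>} z \<partial>noise_measure)
    \<le> ennreal (exp \<kappa> * (\<Prod>t<n. c t)) * (\<integral>\<^sup>+z. indicator D (\<lambda>t\<in>{..<n}. B t (z t)) \<partial>noise_measure)"
    (is "_ \<le> _ * ?J")
proof -
  let ?N = "noise_measure :: (nat \<Rightarrow> 'k \<Rightarrow> complex) measure"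
  let ?w = "\<lambda>z. \<Prod>t<n. ennreal (exp (- e t (z t)))"
  let ?E = "{z. (\<lambda>t\<in>{..<n}. A t (z t)) \<in> D \<and> (\<Sum>t<n. e t (z t)) \<le> \<kappa>}"
  have z: "(\<lambda>z. z t) \<in> ?N \<rightarrow>\<^sub>M noise_vector" for t
    unfolding noise_measure_def by (rule measurable_component_singleton) simp
  have "(\<lambda>z. \<lambda>t\<in>{..<n}. A t (z t)) \<in> ?N \<rightarrow>\<^sub>M PiM {..<n} (\<lambda>_. Y)"
    by (intro measurable_restrict measurable_compose[OF z A])
  from measurable_compose[OF this borel_measurable_indicator[OF D]]
  have [measurable]: "(\<lambda>z. indicator D (\<lambda>t\<in>{..<n}. A t (z t)) :: ennreal) \<in> borel_measurable ?N" .
  have [measurable]: "(\<lambda>z. e t (z t)) \<in> borel_measurable ?N" for t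
    by (rule measurable_compose[OF z e])
  have "(\<integral>\<^sup>+z. indicator ?E z \<partial>?N) \<le> (\<integral>\<^sup>+z. ennreal (exp \<kappa>) * (indicator D (\<lambda>t\<in>{..<n}. A t (z t)) * ?w z) \<partial>?N)"
  proof (rule nn_integral_mono)
    fix z :: "nat \<Rightarrow> 'k \<Rightarrow> complex"
    have *: "ennreal (exp \<kappa>) * ?w z = ennreal (exp (\<kappa> - (\<Sum>t<n. e t (z t))))"
      by (simp add: prod_ennreal ennreal_mult[symmetric] prod_nonneg exp_sum[symmetric] exp_add[symmetric] sum_negf)
    show "indicator ?E z \<le> ennreal (exp \<kappa>) * (indicator D (\<lambda>t\<in>{..<n}. A t (z t)) * ?w z)"
      unfolding mult.left_commute[of "ennreal (exp \<kappa>)"] * by (auto simp: indicator_def)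
  qed
  also have "\<dots> = ennreal (exp \<kappa>) * (\<integral>\<^sup>+z. indicator D (\<lambda>t\<in>{..<n}. A t (z t)) * ?w z \<partial>?N)"
    by (rule nn_integral_cmult) measurable
  also have "\<dots> \<le> ennreal (exp \<kappa>) * ((\<Prod>t<n. ennreal (c t)) * ?J)"
    unfolding noise_measure_def
    by (intro mult_left_mono nn_integral_PiM_tensor[where Y = Y, OF prob_space_noise_vector A B _ step borel_measurable_indicator[OF D]])
      (use e in simp_all)
  also have "\<dots> = ennreal (exp \<kappa> * (\<Prod>t<n. c t)) * ?J"
    using c by (simp add: prod_ennreal ennreal_mult prod_nonneg mult.assoc)
  finally show ?thesis .
qed

text \<open>Think of \<open>I w\<close> as the probability of success for the messages
  \<open>w\<close> and of \<open>J w\<close> as the same event for the surrogates. The surrogates do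
  not see message \<open>k\<close>, so at most one of its values can be decoded from them; that is
  \<open>disj\<close>.\<close>

lemma nn_integral_message_noise_le:
  fixes M :: "'k::finite \<Rightarrow> nat" and J :: "('k \<Rightarrow> nat) \<Rightarrow> (nat \<Rightarrow> 'k \<Rightarrow> complex) \<Rightarrow> ennreal"
  assumes M: "\<And>i. M i \<ge> 1" and I: "\<And>w. I w \<le> C * (\<integral>\<^sup>+z. J w z \<partial>noise_measure)"
    and J: "\<And>w. J w \<in> borel_measurable noise_measure"
    and disj: "\<And>w z. (\<Sum>a\<in>{1..M k}. J (w(k := a)) z) \<le> (1 :: ennreal)"
  shows "M k * (\<integral>\<^sup>+w. I w \<partial>message_measure M) \<le> C"
proof (rule nn_integral_message_le, rule M)
  fix w
  have "(\<Sum>a\<in>{1..M k}. \<integral>\<^sup>+z. J (w(k := a)) z \<partial>noise_measure) =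
      (\<integral>\<^sup>+z. (\<Sum>a\<in>{1..M k}. J (w(k := a)) z) \<partial>noise_measure)"
    by (rule nn_integral_sum[symmetric]) (rule J)
  also have "\<dots> \<le> (\<integral>\<^sup>+z. 1 \<partial>(noise_measure :: (nat \<Rightarrow> 'k \<Rightarrow> complex) measure))"
    by (intro nn_integral_mono disj)
  also have "\<dots> = 1" using prob_space.emeasure_space_1[OF prob_space_noise[where 'a = 'k]] by simp
  finally have 1: "(\<Sum>a\<in>{1..M k}. \<integral>\<^sup>+z. J (w(k := a)) z \<partial>noise_measure) \<le> 1" .
  have "(\<Sum>a\<in>{1..M k}. I (w(k := a))) \<le> C * (\<Sum>a\<in>{1..M k}. \<integral>\<^sup>+z. J (w(k := a)) z \<partial>noise_measure)"
    unfolding sum_distrib_left by (intro sum_mono I)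
  also have "\<dots> \<le> C * 1" by (intro mult_left_mono 1) simp
  finally show "(\<Sum>a\<in>{1..M k}. I (w(k := a))) \<le> C" by (simp only: mult_1_right)
qed

text \<open>Message \<open>i\<close> is summed inside: the surrogate of output \<open>i\<close> may
  depend on message \<open>j\<close>, which is therefore settled first.\<close>

lemma nn_integral_message_noise_le2:
  fixes M :: "'k::finite \<Rightarrow> nat" and J :: "('k \<Rightarrow> nat) \<Rightarrow> (nat \<Rightarrow> 'k \<Rightarrow> complex) \<Rightarrow> ennreal"
  assumes M: "\<And>i. M i \<ge> 1" and I: "\<And>w. I w \<le> C * (\<integral>\<^sup>+z. J w z \<partial>noise_measure)"
    and J: "\<And>w. J w \<in> borel_measurable noise_measure"
    and disj: "\<And>w z. (\<Sum>a\<in>{1..M j}. \<Sum>b\<in>{1..M i}. J (w(j := a, i := b)) z) \<le> (1 :: ennreal)"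
  shows "M j * (M i * (\<integral>\<^sup>+w. I w \<partial>message_measure M)) \<le> C"
  unfolding nn_integral_message_resample[where M = M and i = i and G = I, OF M]
proof (rule nn_integral_message_noise_le[OF M, where J = "\<lambda>w z. \<Sum>b\<in>{1..M i}. J (w(i := b)) z"])
  fix w
  have "(\<Sum>b\<in>{1..M i}. I (w(i := b))) \<le> (\<Sum>b\<in>{1..M i}. C * (\<integral>\<^sup>+z. J (w(i := b)) z \<partial>noise_measure))"
    by (intro sum_mono I)
  then show "(\<Sum>b\<in>{1..M i}. I (w(i := b))) \<le> C * (\<integral>\<^sup>+z. (\<Sum>b\<in>{1..M i}. J (w(i := b)) z) \<partial>noise_measure)"
    by (subst nn_integral_sum) (use J in \<open>auto simp: sum_distrib_left\<close>)
qed (use J disj in \<open>auto intro!: borel_measurable_sum\<close>)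

section \<open>Codewords of typical energy\<close>

text \<open>The power constraint is an average over the messages. Markov's inequality with the
  factor \<open>4 * CARD('k)\<close> leaves each user a failure probability of
  \<open>1 / (4 * CARD('k))\<close>, hence at most 1/4 in total.\<close>

definition power_good :: "nat \<Rightarrow> real \<Rightarrow> 'k::finite encoders \<Rightarrow> ('k \<Rightarrow> nat) \<Rightarrow> bool" where
  "power_good n P f w \<longleftrightarrow> (\<forall>k. (\<Sum>t<n. (cmod (f k (w k) t))\<^sup>2) \<le> 4 * real CARD('k) * (real n * P))"

lemma prob_power_bad_user:
  fixes M :: "'k::finite \<Rightarrow> nat"
  assumes M: "\<And>i. M i \<ge> 1" and P: "0 < P" and avg: "avg_power n M f k \<le> P"
  shows "measure (message_measure M) {w \<in> space (message_measure M). \<not> (\<Sum>t<n. (cmod (f k (w k) t))\<^sup>2) \<le> 4 * real CARD('k) * (real n * P)}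
     \<le> 1 / (4 * CARD('k))"
proof (cases "n = 0")
  case False
  interpret W: prob_space "message_measure M" by (rule prob_space_message) (rule M)
  define g where "g a = (\<Sum>t<n. (cmod (f k a t))\<^sup>2)" for a
  let ?c = "4 * real CARD('k)"
  define Bad where "Bad = {a \<in> {1..M k}. \<not> g a \<le> ?c * (real n * P)}"
  let ?S = "{w \<in> space (message_measure M). \<not> g (w k) \<le> ?c * (real n * P)}"
  have "real (card Bad) * (?c * (real n * P)) = (\<Sum>a\<in>Bad. ?c * (real n * P))" by simp
  also have "\<dots> \<le> (\<Sum>a\<in>Bad. g a)" by (intro sum_mono) (auto simp: Bad_def)
  also have "\<dots> \<le> (\<Sum>a\<in>{1..M k}. g a)" by (intro sum_mono2) (auto simp: Bad_def g_def intro!: sum_nonneg)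
  also have "\<dots> = n * (M k * avg_power n M f k)"
    using False M[of k]
    by (simp add: avg_power_def integral_uniform_count_measure g_def sum_divide_distrib[symmetric])
  also have "\<dots> \<le> n * (M k * P)" by (intro mult_left_mono avg) auto
  finally have "(real n * P) * (real (card Bad) * ?c) \<le> (real n * P) * real (M k)" by (simp add: mult_ac)
  then have card: "real (card Bad) * ?c \<le> real (M k)" using False P by (subst (asm) mult_le_cancel_left_pos) auto
  have "M k * emeasure (message_measure M) ?S = M k * (\<integral>\<^sup>+w. indicator Bad (w k) \<partial>message_measure M)"
    by (subst nn_integral_indicator[symmetric])
      (auto simp: sets_message_measure space_message_measure Bad_def indicator_def PiE_def Pi_def
        intro!: nn_integral_cong arg_cong2[of _ _ _ _ "(*)"])
  also have "\<dots> = (\<integral>\<^sup>+w. (\<Sum>a\<in>{1..M k}. indicator Bad a) \<partial>message_measure M)"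
    by (subst nn_integral_message_resample[where M = M and i = k and G = "\<lambda>w. indicator Bad (w k)", OF M]) (simp only: fun_upd_same)
  also have "(\<Sum>a\<in>{1..M k}. indicator Bad a :: ennreal) = of_nat (card Bad)"
  proof -
    have "(\<Sum>a\<in>{1..M k}. indicator Bad a :: ennreal) = (\<Sum>a\<in>Bad. 1)"
      by (rule sum.mono_neutral_cong_right) (auto simp: Bad_def)
    then show ?thesis by simp
  qed
  finally have "M k * emeasure (message_measure M) ?S = of_nat (card Bad)"
    by (simp add: W.emeasure_space_1)
  then have "real (M k) * W.prob ?S = card Bad"
    by (simp add: W.emeasure_eq_measure ennreal_of_nat_eq_real_of_nat flip: ennreal_mult)
  with card have "real (M k) * (W.prob ?S * ?c) \<le> real (M k) * 1" by (simp add: mult.assoc[symmetric])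
  then have "W.prob ?S * ?c \<le> 1" using M[of k] by (subst (asm) mult_le_cancel_left_pos) auto
  then show ?thesis by (simp add: g_def field_simps)
qed simp

lemma prob_power_good:
  fixes M :: "'k::finite \<Rightarrow> nat"
  assumes M: "\<And>i. M i \<ge> 1" and P: "0 < P" and avg: "\<And>k. avg_power n M f k \<le> P"
  shows "3 / 4 \<le> measure (message_measure M) {w \<in> space (message_measure M). power_good n P f w}"
proof -
  interpret W: prob_space "message_measure M" by (rule prob_space_message) (rule M)
  let ?S = "\<lambda>k. {w \<in> space (message_measure M). \<not> (\<Sum>t<n. (cmod (f k (w k) t))\<^sup>2) \<le> 4 * real CARD('k) * (real n * P)}"
  have "W.prob (\<Union>k\<in>UNIV. ?S k) \<le> (\<Sum>k\<in>UNIV. W.prob (?S k))"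
    by (rule W.finite_measure_subadditive_finite) (auto simp: sets_message_measure)
  also have "\<dots> \<le> (\<Sum>k\<in>(UNIV :: 'k set). 1 / (4 * CARD('k)))"
    by (intro sum_mono prob_power_bad_user M P avg)
  finally have "W.prob (\<Union>k\<in>UNIV. ?S k) \<le> 1 / 4" by simp
  moreover have "{w \<in> space (message_measure M). power_good n P f w} = space (message_measure M) - (\<Union>k\<in>UNIV. ?S k)"
    by (auto simp: power_good_def)
  moreover have "(\<Union>k\<in>UNIV. ?S k) \<in> W.events" by (auto simp: sets_message_measure)
  ultimately show ?thesis by (simp only: W.prob_compl)
qed

section \<open>From counting messages to rates\<close>

text \<open>Everything is typical and decoded correctly with probability at least 3/4 - o(1). By
  \<open>bound\<close> and \<open>num_messages_ge\<close> this probability is at most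
  \<open>(D / 2 powr r) ^ n\<close>, where \<open>r\<close> is the sum of the rates, and that would
  tend to 0 if \<open>D\<close> were less than \<open>2 powr r\<close>. This takes the place of
  Fano's inequality.\<close>

lemma rate_bound:
  fixes T :: "'k::finite \<Rightarrow> 'k set" and R :: "real ^ 'k"
  assumes \<mu>: "prob_space \<mu>" and sets: "sets \<mu> = sets channel_space"
    and \<pi>: "decoding_order \<pi>" and g: "\<And>n. measurable_decoders n (g n)" and P: "0 < P"
    and pw: "\<And>n k. avg_power n (num_messages n R) (f n) k \<le> P"
    and err: "(\<lambda>n. Max (range (error_prob T \<mu> \<pi> n (num_messages n R) (f n) (g n)))) \<longlonglongrightarrow> 0"
    and chan: "(\<lambda>n. measure \<mu> {h \<in> space \<mu>. chan_good T c n h}) \<longlonglongrightarrow> 1"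
    and D: "0 < D"
    and bound: "\<And>n h. chan_good T c n h \<Longrightarrow>
      (\<Prod>u\<in>U. of_nat (num_messages n R u)) * (\<integral>\<^sup>+w. \<integral>\<^sup>+z. indicator {z. noise_good n z \<and> power_good n P (f n) w \<and>
         (\<forall>k. decoded \<pi> (g n) h (received T n (f n) h z w) k = w k)} z \<partial>noise_measure \<partial>message_measure (num_messages n R))
      \<le> ennreal (D ^ n)"
  shows "(\<Sum>u\<in>U. R $ u) \<le> log 2 D"
proof -
  interpret \<mu>: prob_space \<mu> by fact
  interpret N: prob_space "noise_measure :: (nat \<Rightarrow> 'k \<Rightarrow> complex) measure" by (rule prob_space_noise)
  let ?M = "\<lambda>n. num_messages n R"
  let ?\<Omega> = "\<lambda>n. tim_measure \<mu> (?M n)"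
  let ?r = "\<Sum>u\<in>U. R $ u"
  define correct where "correct n h z w \<longleftrightarrow> (\<forall>k. decoded \<pi> (g n) h (received T n (f n) h z w) k = w k)" for n h z w
  define Ok where "Ok n = {(h, z, w) \<in> space (?\<Omega> n). chan_good T c n h \<and> noise_good n z \<and> power_good n P (f n) w \<and> correct n h z w}" for n
  let ?q = "\<lambda>n. measure \<mu> {h \<in> space \<mu>. chan_good T c n h}"
  let ?e = "\<lambda>n. Max (range (error_prob T \<mu> \<pi> n (?M n) (f n) (g n)))"
  \<comment> \<open>A union bound over atypical channel, noise and codewords, and decoding errors.
    Only the 1/4 of the power constraint persists in the limit, and any number below 1 would
    do.\<close>
  let ?low = "\<lambda>n. 1 - ((1 - ?q n) + real CARD('k) * (2 / exp 2) ^ n + 1 / 4 + real CARD('k) * ?e n)"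
  have [measurable_cong]: "sets \<mu> = sets channel_space" by fact
  have sets_Err: "{(h, z, w) \<in> space (?\<Omega> n). decoded \<pi> (g n) h (received T n (f n) h z w) k \<noteq> w k} \<in> sets (?\<Omega> n)" for n k
  proof -
    define d where "d = (\<lambda>x. decoded \<pi> (g n) (fst x) (received T n (f n) (fst x) (fst (snd x)) (snd (snd x))) k)"
    define e where "e = (\<lambda>x :: 'k channel \<times> (nat \<Rightarrow> 'k \<Rightarrow> complex) \<times> ('k \<Rightarrow> nat). snd (snd x) k)"
    have [measurable]: "d \<in> ?\<Omega> n \<rightarrow>\<^sub>M count_space UNIV"
      using measurable_decoded[where T = T and n = n and f = "f n" and j = k and M = "?M n" and g = "g n", OF sets \<pi> g]
      by (simp add: split_beta' d_def)
    have [measurable]: "e \<in> ?\<Omega> n \<rightarrow>\<^sub>M count_space UNIV"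
      unfolding e_def by (rule measurable_compose[OF measurable_tim_components(3)[OF sets]]) simp
    have "(\<lambda>x. d x \<noteq> e x) \<in> ?\<Omega> n \<rightarrow>\<^sub>M count_space UNIV"
      by (rule measurable_compose_countable[where f = "\<lambda>i x. d x \<noteq> i" and g = e]) measurable
    then have "{x \<in> space (?\<Omega> n). d x \<noteq> e x} \<in> sets (?\<Omega> n)" by (simp add: pred_def)
    then show ?thesis by (simp add: split_beta' d_def e_def)
  qed
  have sets_h: "{(h, z, w) \<in> space (?\<Omega> n). \<not> chan_good T c n h} \<in> sets (?\<Omega> n)" for n
  proof -
    note [measurable] = measurable_tim_components(1)[OF sets]
    have "{x \<in> space (?\<Omega> n). \<not> chan_good T c n (fst x)} \<in> sets (?\<Omega> n)" by measurable
    then show ?thesis by (simp add: split_beta')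
  qed
  have sets_z: "{(h, z, w) \<in> space (?\<Omega> n). \<not> noise_good n z} \<in> sets (?\<Omega> n)" for n
  proof -
    note [measurable] = measurable_tim_components(2)[OF sets]
    have "{x \<in> space (?\<Omega> n). \<not> noise_good n (fst (snd x))} \<in> sets (?\<Omega> n)" by measurable
    then show ?thesis by (simp add: split_beta')
  qed
  have sets_w: "{(h, z, w) \<in> space (?\<Omega> n). \<not> power_good n P (f n) w} \<in> sets (?\<Omega> n)" for n
  proof -
    have [measurable]: "(\<lambda>x. power_good n P (f n) (snd (snd x))) \<in> ?\<Omega> n \<rightarrow>\<^sub>M count_space UNIV"
      by (rule measurable_compose[OF measurable_tim_components(3)[OF sets]]) simp
    have "{x \<in> space (?\<Omega> n). \<not> power_good n P (f n) (snd (snd x))} \<in> sets (?\<Omega> n)" by measurable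
    then show ?thesis by (simp add: split_beta')
  qed
  have Ok_eq: "Ok n = space (?\<Omega> n) - ({(h, z, w) \<in> space (?\<Omega> n). \<not> chan_good T c n h} \<union> {(h, z, w) \<in> space (?\<Omega> n). \<not> noise_good n z}
      \<union> {(h, z, w) \<in> space (?\<Omega> n). \<not> power_good n P (f n) w}
      \<union> (\<Union>k\<in>UNIV. {(h, z, w) \<in> space (?\<Omega> n). decoded \<pi> (g n) h (received T n (f n) h z w) k \<noteq> w k}))" for n
    by (auto simp: Ok_def correct_def)
  have sets_Ok: "Ok n \<in> sets (?\<Omega> n)" for n
    unfolding Ok_eq by (intro sets.Diff sets.top sets.Un sets_h sets_z sets_w sets.finite_UN sets_Err) simp
  have lower: "?low n \<le> measure (?\<Omega> n) (Ok n)" for n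
  proof -
    interpret \<Omega>: prob_space "?\<Omega> n" by (rule prob_space_tim_measure[OF \<mu> num_messages_ge_1])
    interpret W: prob_space "message_measure (?M n)" by (rule prob_space_message) (rule num_messages_ge_1)
    let ?H = "{(h, z, w) \<in> space (?\<Omega> n). \<not> chan_good T c n h}" and ?Z = "{(h, z, w) \<in> space (?\<Omega> n). \<not> noise_good n z}"
      and ?W = "{(h, z, w) \<in> space (?\<Omega> n). \<not> power_good n P (f n) w}"
      and ?E = "\<lambda>k. {(h, z, w) \<in> space (?\<Omega> n). decoded \<pi> (g n) h (received T n (f n) h z w) k \<noteq> w k}"
    have "\<Omega>.prob ?H = \<mu>.prob {h \<in> space \<mu>. \<not> chan_good T c n h}"
      by (rule measure_tim_measure_marginals[OF \<mu> num_messages_ge_1]) measurable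
    also have "\<dots> = 1 - ?q n" by (rule \<mu>.prob_neg) measurable
    finally have H: "\<Omega>.prob ?H = 1 - ?q n" .
    have "\<Omega>.prob ?Z = N.prob {z \<in> space noise_measure. \<not> noise_good n z}"
      by (rule measure_tim_measure_marginals[OF \<mu> num_messages_ge_1]) measurable
    also have "\<dots> = 1 - N.prob {z \<in> space noise_measure. noise_good n z}" by (rule N.prob_neg) measurable
    also have "\<dots> \<le> CARD('k) * (2 / exp 2) ^ n" using prob_noise_good[of n, where 'k = 'k] by linarith
    finally have Z: "\<Omega>.prob ?Z \<le> CARD('k) * (2 / exp 2) ^ n" .
    have "\<Omega>.prob ?W = W.prob {w \<in> space (message_measure (?M n)). \<not> power_good n P (f n) w}"
      by (rule measure_tim_measure_marginals[OF \<mu> num_messages_ge_1])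
    also have "\<dots> = 1 - W.prob {w \<in> space (message_measure (?M n)). power_good n P (f n) w}"
      by (rule W.prob_neg) (auto simp: sets_message_measure)
    also have "\<dots> \<le> 1 / 4" using prob_power_good[OF num_messages_ge_1 P pw] by simp
    finally have W: "\<Omega>.prob ?W \<le> 1 / 4" .
    have "\<Omega>.prob (\<Union>k\<in>UNIV. ?E k) \<le> (\<Sum>k\<in>UNIV. \<Omega>.prob (?E k))"
      by (rule \<Omega>.finite_measure_subadditive_finite) (use sets_Err in auto)
    also have "\<dots> \<le> (\<Sum>k\<in>(UNIV :: 'k set). ?e n)"
      by (intro sum_mono Max_ge) (auto simp: error_prob_def image_iff)
    finally have E: "\<Omega>.prob (\<Union>k\<in>UNIV. ?E k) \<le> CARD('k) * ?e n" by simp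
    have sE: "(\<Union>k\<in>UNIV. ?E k) \<in> \<Omega>.events" by (intro sets.finite_UN sets_Err) simp
    have "\<Omega>.prob (?H \<union> ?Z \<union> ?W \<union> (\<Union>k\<in>UNIV. ?E k)) \<le> \<Omega>.prob ?H + \<Omega>.prob ?Z + \<Omega>.prob ?W + \<Omega>.prob (\<Union>k\<in>UNIV. ?E k)"
      by (intro order.trans[OF measure_Un_le] add_right_mono sets.Un sets_h sets_z sets_w sE order.refl)
    also have "\<dots> \<le> (1 - ?q n) + CARD('k) * (2 / exp 2) ^ n + 1 / 4 + CARD('k) * ?e n"
      by (intro add_mono E W Z) (simp add: H)
    finally show ?thesis unfolding Ok_eq
      by (subst \<Omega>.prob_compl) (auto intro!: sets.Un sets_h sets_z sets_w sE)
  qed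
  have upper: "measure (?\<Omega> n) (Ok n) \<le> (D / 2 powr ?r) ^ n" for n
  proof -
    interpret \<Omega>: prob_space "?\<Omega> n" by (rule prob_space_tim_measure[OF \<mu> num_messages_ge_1])
    interpret W: prob_space "message_measure (?M n)" by (rule prob_space_message) (rule num_messages_ge_1)
    let ?I = "\<lambda>h. \<integral>\<^sup>+w. \<integral>\<^sup>+z. indicator {z. chan_good T c n h \<and> noise_good n z \<and> power_good n P (f n) w \<and> correct n h z w} z
         \<partial>noise_measure \<partial>message_measure (?M n)"
    let ?p = "\<Prod>u\<in>U. of_nat (?M n u) :: ennreal"
    have p: "?p = ennreal (\<Prod>u\<in>U. real (?M n u))"
      by (simp add: prod_ennreal ennreal_of_nat_eq_real_of_nat)
    have p0: "0 < (\<Prod>u\<in>U. real (?M n u))"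
      by (intro prod_pos) (use num_messages_ge_1 in \<open>simp add: Suc_le_eq\<close>)
    have I: "?I h \<le> ennreal (D ^ n / (\<Prod>u\<in>U. real (?M n u)))" for h
    proof (cases "chan_good T c n h")
      case True
      from bound[OF True] have *: "?p * ?I h \<le> ennreal (D ^ n)" by (simp add: True correct_def)
      \<comment> \<open>Finiteness, so that the number of messages can be divided out in the
        extended reals.\<close>
      have "?I h \<noteq> \<top>"
      proof
        assume "?I h = \<top>"
        moreover have "ennreal (\<Prod>u\<in>U. real (?M n u)) * \<top> = \<top>"
          using p0 by (metis ennreal_eq_0_iff ennreal_mult_top not_less)
        ultimately have "\<top> \<le> ennreal (D ^ n)" using * by (simp only: p)
        then show False by (simp add: top_unique)
      qed
      then obtain x where x: "0 \<le> x" "?I h = ennreal x" by (cases "?I h") auto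
      from * have "(\<Prod>u\<in>U. real (?M n u)) * x \<le> D ^ n"
        using p0 x D by (simp add: p flip: ennreal_mult)
      then show ?thesis using p0 x by (auto intro!: ennreal_leI simp: field_simps)
    qed simp
    have "emeasure (?\<Omega> n) (Ok n) = (\<integral>\<^sup>+h. ?I h \<partial>\<mu>)"
      using emeasure_tim_measure[OF \<mu> num_messages_ge_1 sets_Ok[unfolded Ok_def], of n] by (simp add: Ok_def)
    also have "\<dots> \<le> (\<integral>\<^sup>+h. ennreal (D ^ n / (\<Prod>u\<in>U. real (?M n u))) \<partial>\<mu>)"
      by (intro nn_integral_mono I)
    also have "\<dots> = ennreal (D ^ n / (\<Prod>u\<in>U. real (?M n u)))" by (simp add: \<mu>.emeasure_space_1)
    finally have "\<Omega>.prob (Ok n) \<le> D ^ n / (\<Prod>u\<in>U. real (?M n u))"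
      using D p0 by (simp add: \<Omega>.emeasure_eq_measure)
    also have "\<dots> \<le> D ^ n / (\<Prod>u\<in>U. 2 powr (n * R $ u))"
      using D p0 by (intro divide_left_mono prod_mono mult_pos_pos) (auto intro: num_messages_ge prod_pos)
    also have "(\<Prod>u\<in>U. 2 powr (n * R $ u)) = (2 powr ?r) ^ n"
      by (simp add: powr_sum[symmetric] sum_distrib_left[symmetric] powr_power mult.commute)
    finally show ?thesis by (simp add: power_divide)
  qed
  have "2 powr ?r \<le> D"
  proof (rule ccontr)
    assume "\<not> 2 powr ?r \<le> D"
    then have up0: "(\<lambda>n. (D / 2 powr ?r) ^ n) \<longlonglongrightarrow> 0"
      using D by (intro LIMSEQ_power_zero) (auto simp: field_simps)
    have pw0: "(\<lambda>n. (2 / exp 2 :: real) ^ n) \<longlonglongrightarrow> 0"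
      using exp_ge_add_one_self[of "2::real"] by (intro LIMSEQ_power_zero) auto
    have low: "?low \<longlonglongrightarrow> 1 - ((1 - 1) + real CARD('k) * 0 + 1 / 4 + real CARD('k) * 0)"
      by (intro tendsto_diff tendsto_add tendsto_mult tendsto_const chan err pw0)
    have "1 - ((1 - 1) + real CARD('k) * 0 + 1 / 4 + real CARD('k) * 0) \<le> (0 :: real)"
      by (rule LIMSEQ_le[OF low up0]) (use lower upper in \<open>blast intro: order.trans\<close>)
    then show False by simp
  qed
  then show ?thesis using D by (simp add: le_log_iff)
qed

section \<open>Energy of the outputs\<close>

lemma exp_abs_ln_ge: "0 < x \<Longrightarrow> x\<^sup>2 \<le> exp (2 * \<bar>ln x\<bar>)" for x :: real
proof -
  assume "0 < x"
  then have "x\<^sup>2 = exp (2 * ln x)" by (simp add: exp_double)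
  also have "\<dots> \<le> exp (2 * \<bar>ln x\<bar>)" by simp
  finally show ?thesis .
qed

text \<open>Cauchy-Schwarz for at most K + 1 summands; \<open>None\<close> is the index of the
  noise.\<close>

lemma cmod_sum_add_squared_le:
  fixes u :: "'k::finite \<Rightarrow> complex"
  shows "(cmod ((\<Sum>l\<in>A. u l) + z))\<^sup>2 \<le> (real CARD('k) + 1) * ((\<Sum>l\<in>A. (cmod (u l))\<^sup>2) + (cmod z)\<^sup>2)"
proof -
  have "cmod ((\<Sum>l\<in>A. u l) + z) \<le> (\<Sum>l\<in>A. cmod (u l)) + cmod z"
    by (rule order.trans[OF norm_triangle_ineq]) (simp add: norm_sum)
  also have "\<dots> = (\<Sum>q\<in>insert None (Some ` A). case q of None \<Rightarrow> cmod z | Some l \<Rightarrow> cmod (u l))"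
    by (subst sum.insert) (auto simp: sum.reindex)
  finally have "(cmod ((\<Sum>l\<in>A. u l) + z))\<^sup>2 \<le> (\<Sum>q\<in>insert None (Some ` A). case q of None \<Rightarrow> cmod z | Some l \<Rightarrow> cmod (u l))\<^sup>2"
    by (intro power_mono) auto
  also have "\<dots> \<le> (\<Sum>q\<in>insert None (Some ` A). (case q of None \<Rightarrow> cmod z | Some l \<Rightarrow> cmod (u l))\<^sup>2) * card (insert None (Some ` A))"
    by (rule sum_squared_le_sum_of_squares)
  also have "(\<Sum>q\<in>insert None (Some ` A). (case q of None \<Rightarrow> cmod z | Some l \<Rightarrow> cmod (u l))\<^sup>2) = (\<Sum>l\<in>A. (cmod (u l))\<^sup>2) + (cmod z)\<^sup>2"
    by (subst sum.insert) (auto simp: sum.reindex)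
  also have "((\<Sum>l\<in>A. (cmod (u l))\<^sup>2) + (cmod z)\<^sup>2) * card (insert None (Some ` A)) \<le> ((\<Sum>l\<in>A. (cmod (u l))\<^sup>2) + (cmod z)\<^sup>2) * (real CARD('k) + 1)"
  proof (intro mult_left_mono)
    have "card (insert None (Some ` A)) = card A + 1" by (subst card_insert_disjoint) (auto simp: card_image)
    also have "\<dots> \<le> CARD('k) + 1" by (simp add: card_mono)
    finally show "real (card (insert None (Some ` A))) \<le> real CARD('k) + 1" by linarith
  qed (auto intro!: add_nonneg_nonneg sum_nonneg)
  finally show ?thesis by (simp add: mult.commute)
qed

text \<open>The variance of the surrogate of output \<open>j\<close>. The exponential dominates
  every squared coefficient at time \<open>t\<close>, and since its exponent is a sum of logarithms,
  the product over \<open>t\<close> is controlled by the time averages in \<open>chan_good\<close>.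
  The factor K + 1 is that of \<open>cmod_sum_add_squared_le\<close>.\<close>

definition output_scale :: "real \<Rightarrow> ('k::finite \<Rightarrow> 'k set) \<Rightarrow> 'k channel \<Rightarrow> 'k \<Rightarrow> nat \<Rightarrow> real" where
  "output_scale P T h j t = (real CARD('k) + 1) * P * exp (2 * (\<Sum>l\<in>T j. \<bar>ln (cmod (h t $ j $ l))\<bar>))"

lemma output_scale_pos: "0 < P \<Longrightarrow> 0 < output_scale P T h j t"
  by (simp add: output_scale_def)

definition clean_signal :: "('k::finite \<Rightarrow> 'k set) \<Rightarrow> 'k encoders \<Rightarrow> 'k channel \<Rightarrow> 'k \<Rightarrow> ('k \<Rightarrow> nat) \<Rightarrow> nat \<Rightarrow> complex" where
  "clean_signal T f h j w t = (\<Sum>l\<in>T j. h t $ j $ l * f l (w l) t)"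

lemma received_eq: "received T n f h z w j = (\<lambda>t\<in>{..<n}. clean_signal T f h j w t + z t j)"
  by (simp add: received_def clean_signal_def)

text \<open>Relative to \<open>output_scale\<close>, an output symbol has at most the energy of all
  codeword symbols divided by \<open>P\<close> plus that of the noise. Over the block, each of the K
  users contributes 4 K n and the noise 4 n, whence 4 K^2 + 4 per symbol.\<close>

lemma output_energy_le:
  fixes T :: "'k::finite \<Rightarrow> 'k set"
  assumes P: "1 \<le> P" and h: "chan_good T c n h" and z: "noise_good n z" and w: "power_good n P f w"
  shows "(\<Sum>t<n. (cmod (clean_signal T f h j w t + z t j))\<^sup>2 / output_scale P T h j t) \<le> (4 * (real CARD('k))\<^sup>2 + 4) * n"
proof -
  have "(cmod (clean_signal T f h j w t + z t j))\<^sup>2 / output_scale P T h j t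
      \<le> (\<Sum>l\<in>UNIV. (cmod (f l (w l) t))\<^sup>2) / P + (cmod (z t j))\<^sup>2" for t
  proof -
    define H where "H = exp (2 * (\<Sum>l\<in>T j. \<bar>ln (cmod (h t $ j $ l))\<bar>))"
    have H: "1 \<le> H" unfolding H_def by (simp add: sum_nonneg)
    have "(cmod (h t $ j $ l))\<^sup>2 \<le> H" if "l \<in> T j" for l
    proof -
      have "(cmod (h t $ j $ l))\<^sup>2 \<le> exp (2 * \<bar>ln (cmod (h t $ j $ l))\<bar>)"
        using h that by (intro exp_abs_ln_ge) (auto simp: chan_good_def)
      also have "\<dots> \<le> H" unfolding H_def using that by (auto intro!: member_le_sum)
      finally show ?thesis .
    qed
    then have "(\<Sum>l\<in>T j. (cmod (h t $ j $ l * f l (w l) t))\<^sup>2) \<le> (\<Sum>l\<in>T j. H * (cmod (f l (w l) t))\<^sup>2)"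
      by (auto simp: norm_mult power_mult_distrib intro!: sum_mono mult_right_mono)
    also have "\<dots> \<le> (\<Sum>l\<in>UNIV. H * (cmod (f l (w l) t))\<^sup>2)"
      using H by (intro sum_mono2) auto
    also have "\<dots> = H * (\<Sum>l\<in>UNIV. (cmod (f l (w l) t))\<^sup>2)" by (simp add: sum_distrib_left)
    finally have s: "(\<Sum>l\<in>T j. (cmod (h t $ j $ l * f l (w l) t))\<^sup>2) \<le> H * (\<Sum>l\<in>UNIV. (cmod (f l (w l) t))\<^sup>2)" .
    have "1 * (cmod (z t j))\<^sup>2 \<le> (P * H) * (cmod (z t j))\<^sup>2"
      using P H mult_mono[of 1 P 1 H] by (intro mult_right_mono) auto
    then have le: "(\<Sum>l\<in>T j. (cmod (h t $ j $ l * f l (w l) t))\<^sup>2) + (cmod (z t j))\<^sup>2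
        \<le> P * H * ((\<Sum>l\<in>UNIV. (cmod (f l (w l) t))\<^sup>2) / P + (cmod (z t j))\<^sup>2)"
    proof -
      have "P * H * (S / P + y) = H * S + P * H * y" for S y using P by (simp add: field_simps)
      with s \<open>1 * (cmod (z t j))\<^sup>2 \<le> (P * H) * (cmod (z t j))\<^sup>2\<close> show ?thesis by simp
    qed
    have "(cmod (clean_signal T f h j w t + z t j))\<^sup>2 \<le>
        (real CARD('k) + 1) * (P * H * ((\<Sum>l\<in>UNIV. (cmod (f l (w l) t))\<^sup>2) / P + (cmod (z t j))\<^sup>2))"
      unfolding clean_signal_def by (rule order.trans[OF cmod_sum_add_squared_le mult_left_mono[OF le]]) simp
    also have "\<dots> = ((\<Sum>l\<in>UNIV. (cmod (f l (w l) t))\<^sup>2) / P + (cmod (z t j))\<^sup>2) * output_scale P T h j t"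
      by (simp add: output_scale_def H_def mult_ac)
    finally show ?thesis
      using output_scale_pos[of P T h j t] P by (subst pos_divide_le_eq) auto
  qed
  then have "(\<Sum>t<n. (cmod (clean_signal T f h j w t + z t j))\<^sup>2 / output_scale P T h j t)
     \<le> (\<Sum>t<n. (\<Sum>l\<in>UNIV. (cmod (f l (w l) t))\<^sup>2) / P + (cmod (z t j))\<^sup>2)"
    by (intro sum_mono)
  also have "\<dots> = (\<Sum>l\<in>UNIV. \<Sum>t<n. (cmod (f l (w l) t))\<^sup>2) / P + (\<Sum>t<n. (cmod (z t j))\<^sup>2)"
    by (subst sum.swap) (simp add: sum.distrib sum_divide_distrib)
  also have "\<dots> \<le> (\<Sum>l\<in>(UNIV :: 'k set). 4 * real CARD('k) * (real n * P)) / P + 4 * n"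
    using w z P by (intro add_mono divide_right_mono sum_mono) (auto simp: power_good_def noise_good_def)
  also have "\<dots> = (4 * (real CARD('k))\<^sup>2 + 4) * n"
    using P by (simp add: power2_eq_square field_simps)
  finally show ?thesis .
qed

text \<open>Each of at most K links adds \<open>c\<close> per symbol to the logarithms, and
  \<open>output_scale\<close> contains them twice.\<close>

lemma prod_output_scale_le:
  fixes T :: "'k::finite \<Rightarrow> 'k set" and c :: real
  assumes P: "1 \<le> P" and h: "chan_good T c n h" and c: "0 \<le> c"
  shows "(\<Prod>t<n. output_scale P T h j t) \<le> ((real CARD('k) + 1) * P * exp (2 * CARD('k) * c)) ^ n"
proof (cases "n = 0")
  case False
  have "(\<Sum>t<n. \<Sum>l\<in>T j. \<bar>ln (cmod (h t $ j $ l))\<bar>) = (\<Sum>l\<in>T j. \<Sum>t<n. \<bar>ln (cmod (h t $ j $ l))\<bar>)"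
    by (rule sum.swap)
  also have "\<dots> \<le> (\<Sum>l\<in>T j. c * n)"
    using h False by (intro sum_mono) (auto simp: chan_good_def field_simps)
  also have "\<dots> \<le> CARD('k) * (c * n)"
    using c by (simp add: card_mono mult_right_mono)
  finally have *: "(\<Sum>t<n. \<Sum>l\<in>T j. \<bar>ln (cmod (h t $ j $ l))\<bar>) \<le> CARD('k) * (c * n)" .
  have "(\<Prod>t<n. output_scale P T h j t) = ((real CARD('k) + 1) * P) ^ n * exp (2 * (\<Sum>t<n. \<Sum>l\<in>T j. \<bar>ln (cmod (h t $ j $ l))\<bar>))"
    unfolding output_scale_def by (simp add: prod.distrib exp_sum sum_distrib_left)
  also have "\<dots> \<le> ((real CARD('k) + 1) * P) ^ n * exp (2 * (CARD('k) * (c * n)))"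
    using * P by (intro mult_left_mono) auto
  also have "\<dots> = ((real CARD('k) + 1) * P * exp (2 * CARD('k) * c)) ^ n"
    by (simp add: power_mult_distrib exp_of_nat_mult[symmetric] mult_ac)
  finally show ?thesis .
qed simp

section \<open>Counting bounds for a fixed channel\<close>

text \<open>If everything is decoded correctly, the passed messages are the sent ones; the decoders
  can then be studied one by one, with true messages as side information.\<close>

lemma decoded_correctD:
  assumes \<pi>: "decoding_order (\<pi> :: 'k::finite rel)" and "\<forall>k. decoded \<pi> g h y k = w k"
  shows "g k (y k) (restrict w {l. (l, k) \<in> \<pi>}) h = w k"
proof -
  have "decoded \<pi> g h y = w" using assms(2) by auto
  with decoded_unfold[OF \<pi>, of g h y k] show ?thesis by simp
qed

lemma sum_indicator_le_1:
  assumes "finite A" "\<And>a b. a \<in> A \<Longrightarrow> b \<in> A \<Longrightarrow> Q a \<Longrightarrow> Q b \<Longrightarrow> a = b"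
  shows "(\<Sum>a\<in>A. if Q a then 1 else 0) \<le> (1 :: ennreal)"
proof (cases "\<exists>a\<in>A. Q a")
  case True
  then obtain a where a: "a \<in> A" "Q a" by auto
  have "(\<Sum>b\<in>A. if Q b then 1 else 0 :: ennreal) = (\<Sum>b\<in>{a}. 1)"
    using assms a by (intro sum.mono_neutral_cong_right) auto
  then show ?thesis by simp
qed (auto simp: sum.neutral)

lemma measurable_decoder_section:
  assumes "measurable_decoders n g"
  shows "(\<lambda>y. g j y v h) \<in> PiM {..<n} (\<lambda>_. borel) \<rightarrow>\<^sub>M count_space UNIV"
proof -
  have "(\<lambda>(y, h). g j y v h) \<in> (Pi\<^sub>M {..<n} (\<lambda>_. borel) \<Otimes>\<^sub>M channel_space) \<rightarrow>\<^sub>M count_space UNIV"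
    using assms by (simp add: measurable_decoders_def)
  from measurable_compose[OF measurable_Pair2'[of h channel_space] this]
  show ?thesis by (simp add: space_PiM)
qed

text \<open>The surrogate is Gaussian noise of variance \<open>?s\<close>, independent of all
  messages. With the other messages fixed, what receiver \<open>k\<close> decodes from it is a
  function of the noise, hence right for at most one value of message \<open>k\<close>.\<close>

lemma single_user_counting_bound:
  fixes T :: "'k::finite \<Rightarrow> 'k set" and c :: real
  assumes \<pi>: "decoding_order \<pi>" and g: "measurable_decoders n g" and P: "1 \<le> P" and c: "0 \<le> c"
    and M: "\<And>i. M i \<ge> 1" and h: "chan_good T c n h"
  shows "of_nat (M k) * (\<integral>\<^sup>+w. \<integral>\<^sup>+z. indicator {z. noise_good n z \<and> power_good n P f w \<and>
         (\<forall>k. decoded \<pi> g h (received T n f h z w) k = w k)} z \<partial>noise_measure \<partial>message_measure M)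
      \<le> ennreal ((exp (4 * (real CARD('k))\<^sup>2 + 4) * ((real CARD('k) + 1) * P * exp (2 * CARD('k) * c))) ^ n)"
proof -
  let ?N = "noise_measure :: (nat \<Rightarrow> 'k \<Rightarrow> complex) measure"
  let ?\<kappa> = "(4 * (real CARD('k))\<^sup>2 + 4) * n"
  let ?s = "output_scale P T h k" and ?x = "clean_signal T f h k"
  define D where "D w = {y \<in> space (PiM {..<n} (\<lambda>_. borel)). g k y (restrict w {l. (l, k) \<in> \<pi>}) h = w k}" for w
  let ?J = "\<lambda>w z. indicator (D w) (\<lambda>t\<in>{..<n}. complex_of_real (sqrt (?s t)) * z t k) :: ennreal"
  have s: "0 < ?s t" for t using P by (intro output_scale_pos) simp
  have D: "D w \<in> sets (PiM {..<n} (\<lambda>_. borel))" for w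
  proof -
    note [measurable] = measurable_decoder_section[OF g]
    show ?thesis unfolding D_def by measurable
  qed
  have "of_nat (M k) * (\<integral>\<^sup>+w. \<integral>\<^sup>+z. indicator {z. noise_good n z \<and> power_good n P f w \<and>
         (\<forall>k. decoded \<pi> g h (received T n f h z w) k = w k)} z \<partial>noise_measure \<partial>message_measure M)
      \<le> ennreal (exp ?\<kappa> * (\<Prod>t<n. ?s t))"
  proof (rule nn_integral_message_noise_le[where J = ?J, OF M])
    fix w
    let ?E = "{z. (\<lambda>t\<in>{..<n}. ?x w t + z t k) \<in> D w \<and> (\<Sum>t<n. (cmod (?x w t + z t k))\<^sup>2 / ?s t) \<le> ?\<kappa>}"
    have "(\<integral>\<^sup>+z. indicator {z. noise_good n z \<and> power_good n P f w \<and>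
         (\<forall>k. decoded \<pi> g h (received T n f h z w) k = w k)} z \<partial>?N) \<le> (\<integral>\<^sup>+z. indicator ?E z \<partial>?N)"
    proof (intro nn_integral_mono indicator_leI CollectI conjI)
      fix z :: "nat \<Rightarrow> 'k \<Rightarrow> complex"
      assume z: "z \<in> {z. noise_good n z \<and> power_good n P f w \<and> (\<forall>k. decoded \<pi> g h (received T n f h z w) k = w k)}"
      then show "(\<Sum>t<n. (cmod (?x w t + z t k))\<^sup>2 / ?s t) \<le> ?\<kappa>"
        by (intro output_energy_le[OF P h]) auto
      from z have "g k (received T n f h z w k) (restrict w {l. (l, k) \<in> \<pi>}) h = w k"
        by (intro decoded_correctD[OF \<pi>]) auto
      then show "(\<lambda>t\<in>{..<n}. ?x w t + z t k) \<in> D w"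
        by (simp add: D_def received_eq space_PiM)
    qed
    also have "\<dots> \<le> ennreal (exp ?\<kappa> * (\<Prod>t<n. ?s t)) * (\<integral>\<^sup>+z. ?J w z \<partial>?N)"
    proof (rule nn_integral_noise_change_of_measure[where Y = borel and A = "\<lambda>t u. ?x w t + u k"
          and B = "\<lambda>t u. complex_of_real (sqrt (?s t)) * u k" and e = "\<lambda>t u. (cmod (?x w t + u k))\<^sup>2 / ?s t"])
      show "(\<lambda>u. ?x w t + u k) \<in> borel_measurable noise_vector" "(\<lambda>u. complex_of_real (sqrt (?s t)) * u k) \<in> borel_measurable noise_vector"
        "(\<lambda>u. (cmod (?x w t + u k))\<^sup>2 / ?s t) \<in> borel_measurable noise_vector" for t by measurable
      show "0 \<le> ?s t" for t using s[of t] by simp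
      show "(\<integral>\<^sup>+u. G (?x w t + u k) * ennreal (exp (- ((cmod (?x w t + u k))\<^sup>2 / ?s t))) \<partial>noise_vector)
          \<le> ennreal (?s t) * (\<integral>\<^sup>+u. G (complex_of_real (sqrt (?s t)) * u k) \<partial>noise_vector)"
        if "G \<in> borel_measurable borel" for t G
        using nn_integral_noise_vector_shift[OF that s[of t], of "?x w t" k] by simp
    qed (rule D)
    finally show "(\<integral>\<^sup>+z. indicator {z. noise_good n z \<and> power_good n P f w \<and>
         (\<forall>k. decoded \<pi> g h (received T n f h z w) k = w k)} z \<partial>?N)
       \<le> ennreal (exp ?\<kappa> * (\<Prod>t<n. ?s t)) * (\<integral>\<^sup>+z. ?J w z \<partial>?N)" .
  next
    fix w
    have "(\<lambda>z. \<lambda>t\<in>{..<n}. complex_of_real (sqrt (?s t)) * z t k) \<in> ?N \<rightarrow>\<^sub>M PiM {..<n} (\<lambda>_. borel)"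
      by (intro measurable_restrict borel_measurable_times measurable_noise_component) simp_all
    from measurable_compose[OF this borel_measurable_indicator[OF D]]
    show "?J w \<in> borel_measurable ?N" .
  next
    fix w :: "'k \<Rightarrow> nat" and z :: "nat \<Rightarrow> 'k \<Rightarrow> complex"
    \<comment> \<open>Irreflexivity of the order: message \<open>k\<close> is not passed to receiver
      \<open>k\<close>.\<close>
    have "(k, k) \<notin> \<pi>" using \<pi> by (auto simp: decoding_order_def irrefl_def)
    then have "restrict (w(k := a)) {l. (l, k) \<in> \<pi>} = restrict w {l. (l, k) \<in> \<pi>}" for a
      by (auto simp: fun_eq_iff)
    then have "?J (w(k := a)) z \<le> (if a = g k (\<lambda>t\<in>{..<n}. complex_of_real (sqrt (?s t)) * z t k) (restrict w {l. (l, k) \<in> \<pi>}) h then 1 else 0)" for a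
      by (auto simp: D_def indicator_def)
    then have "(\<Sum>a\<in>{1..M k}. ?J (w(k := a)) z) \<le> (\<Sum>a\<in>{1..M k}. if a = g k (\<lambda>t\<in>{..<n}. complex_of_real (sqrt (?s t)) * z t k) (restrict w {l. (l, k) \<in> \<pi>}) h then 1 else 0)"
      by (intro sum_mono)
    also have "\<dots> \<le> 1" by (rule sum_indicator_le_1) auto
    finally show "(\<Sum>a\<in>{1..M k}. ?J (w(k := a)) z) \<le> 1" .
  qed
  also have "ennreal (exp ?\<kappa> * (\<Prod>t<n. ?s t)) \<le> ennreal (exp ?\<kappa> * ((real CARD('k) + 1) * P * exp (2 * CARD('k) * c)) ^ n)"
    by (intro ennreal_leI mult_left_mono prod_output_scale_le P h c) simp
  also have "exp ?\<kappa> = exp (4 * (real CARD('k))\<^sup>2 + 4) ^ n"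
    by (simp add: exp_of_nat_mult[symmetric] mult.commute)
  finally show ?thesis by (simp add: power_mult_distrib)
qed

text \<open>With r = h_ii / h_ji, the combination Y_i - r Y_j does not contain X_i. Hence, given the
  other messages, Y_j predicts Y_i up to Z_i - r Z_j, and the variance \<open>v\<close> of the
  second surrogate has to cover this noise only; it is free of \<open>P\<close>. Message
  \<open>j\<close> may be passed to receiver \<open>i\<close>, while
  \<open>(i, j) \<notin> \<pi>\<close> keeps message \<open>i\<close> from receiver
  \<open>j\<close>. Compared with the single user, the extra factors are \<open>exp 8\<close> for
  the energies of the two noises and \<open>2 * exp (4 * c)\<close> for the product of the
  \<open>v t\<close>.\<close>

lemma two_user_counting_bound:
  fixes T :: "'k::finite \<Rightarrow> 'k set" and c :: real
  assumes \<pi>: "decoding_order \<pi>" and g: "measurable_decoders n g" and P: "1 \<le> P" and c: "0 \<le> c"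
    and M: "\<And>i. M i \<ge> 1" and h: "chan_good T c n h"
    and ij: "i \<noteq> j" "i \<in> T j" "i \<in> T i" "j \<in> T j" "(i, j) \<notin> \<pi>"
  shows "of_nat (M j) * (of_nat (M i) * (\<integral>\<^sup>+w. \<integral>\<^sup>+z. indicator {z. noise_good n z \<and> power_good n P f w \<and>
         (\<forall>k. decoded \<pi> g h (received T n f h z w) k = w k)} z \<partial>noise_measure \<partial>message_measure M))
      \<le> ennreal ((exp (4 * (real CARD('k))\<^sup>2 + 4) * ((real CARD('k) + 1) * P * exp (2 * CARD('k) * c)) * (exp 8 * (2 * exp (4 * c)))) ^ n)"
proof -
  let ?N = "noise_measure :: (nat \<Rightarrow> 'k \<Rightarrow> complex) measure"
  let ?\<kappa> = "(4 * (real CARD('k))\<^sup>2 + 4) * n + 8 * n"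
  let ?s = "output_scale P T h j" and ?x = "clean_signal T f h j" and ?x' = "clean_signal T f h i"
  let ?ld = "\<lambda>t. \<bar>ln (cmod (h t $ i $ i))\<bar>" and ?lc = "\<lambda>t. \<bar>ln (cmod (h t $ j $ i))\<bar>"
  \<comment> \<open>The 2 comes from (x + y)^2 \<le> 2 (x^2 + y^2), and the exponential bounds both
    1 and |r|^2; so |a - r b|^2 / v \<le> |a|^2 + |b|^2.\<close>
  define v where "v t = 2 * exp (2 * ?ld t + 2 * ?lc t)" for t
  define r where "r t = h t $ i $ i / h t $ j $ i" for t
  \<comment> \<open>The guess of receiver \<open>j\<close>, who knows all messages but \<open>i\<close>, for the output of receiver \<open>i\<close>.\<close>
  define m where "m w t y = (\<Sum>l\<in>T i - {i}. h t $ i $ l * f l (w l) t) +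
      r t * (y - (\<Sum>l\<in>T j - {i}. h t $ j $ l * f l (w l) t))" for w t y
  define B where "B w t u = (complex_of_real (sqrt (?s t)) * u j,
      m w t (complex_of_real (sqrt (?s t)) * u j) + complex_of_real (sqrt (v t)) * u i)" for w t and u :: "'k \<Rightarrow> complex"
  define D where "D w = {y \<in> space (PiM {..<n} (\<lambda>_. borel)).
      g j (\<lambda>t\<in>{..<n}. fst (y t)) (restrict w {l. (l, j) \<in> \<pi>}) h = w j \<and>
      g i (\<lambda>t\<in>{..<n}. snd (y t)) (restrict w {l. (l, i) \<in> \<pi>}) h = w i}" for w
  let ?J = "\<lambda>w z. indicator (D w) (\<lambda>t\<in>{..<n}. B w t (z t)) :: ennreal"
  have s: "0 < ?s t" for t using P by (intro output_scale_pos) simp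
  have v: "0 < v t" for t by (simp add: v_def)
  have h0: "h t $ j $ i \<noteq> 0" "h t $ i $ i \<noteq> 0" for t using h ij by (auto simp: chan_good_def)
  have D: "D w \<in> sets (PiM {..<n} (\<lambda>_. borel))" for w
  proof -
    have 1: "(\<lambda>y. g k (\<lambda>t\<in>{..<n}. p (y t)) u h) \<in> PiM {..<n} (\<lambda>_. borel) \<rightarrow>\<^sub>M count_space UNIV"
      if p: "p \<in> borel_measurable borel" for k u and p :: "complex \<times> complex \<Rightarrow> complex"
    proof -
      have "(\<lambda>y. \<lambda>t\<in>{..<n}. p (y t)) \<in> PiM {..<n} (\<lambda>_. borel) \<rightarrow>\<^sub>M PiM {..<n} (\<lambda>_. borel)"
        by (intro measurable_restrict measurable_compose[OF _ p] measurable_component_singleton)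
      from measurable_compose[OF this measurable_decoder_section[OF g]] show ?thesis .
    qed
    have p: "fst \<in> borel_measurable (borel :: (complex \<times> complex) measure)" "snd \<in> borel_measurable (borel :: (complex \<times> complex) measure)"
      by (intro borel_measurable_continuous_onI continuous_intros)+
    note [measurable] = 1[OF p(1)] 1[OF p(2)]
    show ?thesis unfolding D_def by measurable
  qed
  have m_meas [measurable]: "m w t \<in> borel_measurable borel" for w t
    unfolding m_def by measurable
  have B_meas: "B w t \<in> borel_measurable noise_vector" for w t
    unfolding B_def by measurable
  \<comment> \<open>The point of this guess: the signal of user \<open>i\<close> enters it only
    through the output of receiver \<open>j\<close>, which the surrogate replaces by pure
    noise.\<close>
  have m_i: "m (w(i := b)) = m w" for w b
    by (intro ext) (simp add: m_def)
  \<comment> \<open>By the choice of \<open>r\<close> all signals cancel, that of user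
    \<open>i\<close> included.\<close>
  have diff: "?x' w t + z i - m w t (?x w t + z j) = z i - r t * z j" for w t and z :: "'k \<Rightarrow> complex"
  proof -
    have "r t * h t $ j $ i = h t $ i $ i" using h0[of t] by (simp add: r_def)
    then have x': "?x' w t = r t * (h t $ j $ i * f i (w i) t) + (\<Sum>l\<in>T i - {i}. h t $ i $ l * f l (w l) t)"
      unfolding clean_signal_def by (subst sum.remove[of _ i]) (use ij in \<open>auto simp: mult.assoc[symmetric]\<close>)
    have x: "?x w t = h t $ j $ i * f i (w i) t + (\<Sum>l\<in>T j - {i}. h t $ j $ l * f l (w l) t)"
      unfolding clean_signal_def by (rule sum.remove) (use ij in auto)
    show ?thesis unfolding m_def x x' by (simp add: algebra_simps)
  qed
  have diff_le: "(cmod (a - r t * b))\<^sup>2 / v t \<le> (cmod a)\<^sup>2 + (cmod b)\<^sup>2" for a b t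
  proof -
    have r2: "(cmod (r t))\<^sup>2 \<le> exp (2 * ?ld t + 2 * ?lc t)"
    proof -
      have "(cmod (h t $ i $ i))\<^sup>2 \<le> exp (2 * ?ld t)" using h0 by (intro exp_abs_ln_ge) simp
      moreover have "(inverse (cmod (h t $ j $ i)))\<^sup>2 \<le> exp (2 * ?lc t)"
        using exp_abs_ln_ge[of "inverse (cmod (h t $ j $ i))"] h0 by (simp add: ln_inverse)
      ultimately have "(cmod (h t $ i $ i))\<^sup>2 * (inverse (cmod (h t $ j $ i)))\<^sup>2 \<le> exp (2 * ?ld t) * exp (2 * ?lc t)"
        by (intro mult_mono) auto
      moreover have "(cmod (r t))\<^sup>2 = (cmod (h t $ i $ i))\<^sup>2 * (inverse (cmod (h t $ j $ i)))\<^sup>2"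
        by (simp add: r_def norm_divide power_divide inverse_eq_divide)
      ultimately show ?thesis by (simp only: exp_add)
    qed
    have "(cmod (a - r t * b))\<^sup>2 \<le> (cmod a + cmod (r t) * cmod b)\<^sup>2"
      by (intro power_mono order.trans[OF norm_triangle_ineq4]) (auto simp: norm_mult)
    also have "\<dots> \<le> 2 * ((cmod a)\<^sup>2 + (cmod (r t))\<^sup>2 * (cmod b)\<^sup>2)"
    proof -
      have "(x + y)\<^sup>2 \<le> 2 * (x\<^sup>2 + y\<^sup>2)" for x y :: real
        using sum_squares_bound[of x y] by (simp add: power2_sum)
      from this[of "cmod a" "cmod (r t) * cmod b"] show ?thesis by (simp only: power_mult_distrib)
    qed
    also have "\<dots> \<le> 2 * (exp (2 * ?ld t + 2 * ?lc t) * (cmod a)\<^sup>2 + exp (2 * ?ld t + 2 * ?lc t) * (cmod b)\<^sup>2)"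
    proof -
      have "1 * (cmod a)\<^sup>2 \<le> exp (2 * ?ld t + 2 * ?lc t) * (cmod a)\<^sup>2" by (intro mult_right_mono) auto
      with mult_right_mono[OF r2, of "(cmod b)\<^sup>2"] show ?thesis by simp
    qed
    also have "\<dots> = ((cmod a)\<^sup>2 + (cmod b)\<^sup>2) * v t" by (simp add: v_def algebra_simps)
    finally show ?thesis using v[of t] by (simp add: pos_divide_le_eq)
  qed
  have "of_nat (M j) * (of_nat (M i) * (\<integral>\<^sup>+w. \<integral>\<^sup>+z. indicator {z. noise_good n z \<and> power_good n P f w \<and>
         (\<forall>k. decoded \<pi> g h (received T n f h z w) k = w k)} z \<partial>noise_measure \<partial>message_measure M))
      \<le> ennreal (exp ?\<kappa> * (\<Prod>t<n. ?s t * v t))"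
  proof (rule nn_integral_message_noise_le2[where J = ?J, OF M])
    fix w
    let ?A = "\<lambda>t u. (?x w t + u j, ?x' w t + u i)"
    let ?e = "\<lambda>t u. (cmod (?x w t + u j))\<^sup>2 / ?s t + (cmod (?x' w t + u i - m w t (?x w t + u j)))\<^sup>2 / v t"
    let ?E = "{z. (\<lambda>t\<in>{..<n}. ?A t (z t)) \<in> D w \<and> (\<Sum>t<n. ?e t (z t)) \<le> ?\<kappa>}"
    have "(\<integral>\<^sup>+z. indicator {z. noise_good n z \<and> power_good n P f w \<and>
         (\<forall>k. decoded \<pi> g h (received T n f h z w) k = w k)} z \<partial>?N) \<le> (\<integral>\<^sup>+z. indicator ?E z \<partial>?N)"
    proof (intro nn_integral_mono indicator_leI CollectI conjI)
      fix z :: "nat \<Rightarrow> 'k \<Rightarrow> complex"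
      assume z: "z \<in> {z. noise_good n z \<and> power_good n P f w \<and> (\<forall>k. decoded \<pi> g h (received T n f h z w) k = w k)}"
      have "(\<Sum>t<n. (cmod (?x w t + z t j))\<^sup>2 / ?s t) \<le> (4 * (real CARD('k))\<^sup>2 + 4) * n"
        using z by (intro output_energy_le[OF P h]) auto
      moreover have "(\<Sum>t<n. (cmod (?x' w t + z t i - m w t (?x w t + z t j)))\<^sup>2 / v t) \<le> 8 * n"
      proof -
        have "(\<Sum>t<n. (cmod (?x' w t + z t i - m w t (?x w t + z t j)))\<^sup>2 / v t) \<le> (\<Sum>t<n. (cmod (z t i))\<^sup>2 + (cmod (z t j))\<^sup>2)"
          unfolding diff by (intro sum_mono diff_le)
        also have "\<dots> \<le> 4 * real n + 4 * real n"
          unfolding sum.distrib using z by (intro add_mono) (auto simp: noise_good_def)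
        finally show ?thesis by simp
      qed
      ultimately show "(\<Sum>t<n. ?e t (z t)) \<le> ?\<kappa>" by (simp add: sum.distrib)
      have "g k (received T n f h z w k) (restrict w {l. (l, k) \<in> \<pi>}) h = w k" for k
        using z by (intro decoded_correctD[OF \<pi>]) auto
      from this[of i] this[of j] show "(\<lambda>t\<in>{..<n}. ?A t (z t)) \<in> D w"
        by (simp add: D_def received_eq space_PiM PiE_iff extensional_def restrict_def cong: if_cong)
    qed
    also have "\<dots> \<le> ennreal (exp ?\<kappa> * (\<Prod>t<n. ?s t * v t)) * (\<integral>\<^sup>+z. ?J w z \<partial>?N)"
    proof (rule nn_integral_noise_change_of_measure[where Y = borel and A = ?A and B = "B w" and e = ?e])
      show "?A t \<in> borel_measurable noise_vector" "?e t \<in> borel_measurable noise_vector" for t by measurable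
      show "B w t \<in> borel_measurable noise_vector" for t by (rule B_meas)
      show "0 \<le> ?s t * v t" for t using s[of t] v[of t] by simp
      show "(\<integral>\<^sup>+u. G (?A t u) * ennreal (exp (- ?e t u)) \<partial>noise_vector)
          \<le> ennreal (?s t * v t) * (\<integral>\<^sup>+u. G (B w t u) \<partial>noise_vector)"
        if G: "G \<in> borel_measurable borel" for t G
      proof -
        have e: "ennreal (exp (- ?e t u)) = ennreal (exp (- (cmod (?x w t + u j))\<^sup>2 / ?s t)) *
            ennreal (exp (- (cmod (?x' w t + u i - m w t (?x w t + u j)))\<^sup>2 / v t))" for u
          by (subst ennreal_mult[symmetric]) (auto simp: exp_add[symmetric])
        show ?thesis unfolding B_def e
          by (rule nn_integral_noise_vector_shift2[OF G m_meas s v]) (use ij in simp)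
      qed
    qed (rule D)
    finally show "(\<integral>\<^sup>+z. indicator {z. noise_good n z \<and> power_good n P f w \<and>
         (\<forall>k. decoded \<pi> g h (received T n f h z w) k = w k)} z \<partial>?N)
       \<le> ennreal (exp ?\<kappa> * (\<Prod>t<n. ?s t * v t)) * (\<integral>\<^sup>+z. ?J w z \<partial>?N)" .
  next
    fix w
    have z: "(\<lambda>z. z t) \<in> ?N \<rightarrow>\<^sub>M noise_vector" for t
      unfolding noise_measure_def by (rule measurable_component_singleton) simp
    have "(\<lambda>z. \<lambda>t\<in>{..<n}. B w t (z t)) \<in> ?N \<rightarrow>\<^sub>M PiM {..<n} (\<lambda>_. borel)"
      by (intro measurable_restrict measurable_compose[OF z B_meas])
    from measurable_compose[OF this borel_measurable_indicator[OF D]]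
    show "?J w \<in> borel_measurable ?N" .
  next
    fix w :: "'k \<Rightarrow> nat" and z :: "nat \<Rightarrow> 'k \<Rightarrow> complex"
    have irr: "(k, k) \<notin> \<pi>" for k using \<pi> by (auto simp: decoding_order_def irrefl_def)
    \<comment> \<open>Here \<open>(i, j) \<notin> \<pi>\<close> enters: receiver \<open>j\<close> is
      passed neither message \<open>j\<close> nor message \<open>i\<close>.\<close>
    have rj: "restrict (w(j := a, i := b)) {l. (l, j) \<in> \<pi>} = restrict w {l. (l, j) \<in> \<pi>}" for a b
      using irr ij by (auto simp: fun_eq_iff)
    have ri: "restrict (w(j := a, i := b)) {l. (l, i) \<in> \<pi>} = restrict (w(j := a)) {l. (l, i) \<in> \<pi>}" for a b
      using irr by (auto simp: fun_eq_iff)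
    define a0 where "a0 = g j (\<lambda>t\<in>{..<n}. fst (B w t (z t))) (restrict w {l. (l, j) \<in> \<pi>}) h"
    \<comment> \<open>This value depends on \<open>a\<close>, as message \<open>j\<close> may enter
      the centre of the second surrogate and may be passed to receiver \<open>i\<close>.\<close>
    define b0 where "b0 a = g i (\<lambda>t\<in>{..<n}. snd (B (w(j := a)) t (z t))) (restrict (w(j := a)) {l. (l, i) \<in> \<pi>}) h" for a
    have B_i: "B (w(i := b)) = B w" for w b by (intro ext) (simp add: B_def m_i)
    have fst_B: "fst (B (w(j := a)) t u) = fst (B w t u)" for a t u by (simp add: B_def)
    have rr: "(\<lambda>t\<in>{..<n}. p ((\<lambda>t\<in>{..<n}. q t) t)) = (\<lambda>t\<in>{..<n}. p (q t))"
      for p :: "complex \<times> complex \<Rightarrow> complex" and q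
      by (auto simp: fun_eq_iff)
    have "?J (w(j := a, i := b)) z \<le> (if a = a0 then 1 else 0) * (if b = b0 a then 1 else 0)" for a b
    proof -
      have *: "a = a0 \<and> b = b0 a" if "(\<lambda>t\<in>{..<n}. B (w(j := a)) t (z t)) \<in> D (w(j := a, i := b))"
      proof -
        have "a0 = (w(j := a, i := b)) j" "b0 a = (w(j := a, i := b)) i"
          using that unfolding D_def a0_def b0_def by (simp_all only: mem_Collect_eq rr rj ri fst_B)
        with ij show ?thesis by simp
      qed
      show ?thesis unfolding B_i
      proof (cases "(\<lambda>t\<in>{..<n}. B (w(j := a)) t (z t)) \<in> D (w(j := a, i := b))")
        case True
        with * have "(if a = a0 then 1 else 0) * (if b = b0 a then 1 else 0) = (1 :: ennreal)" by simp
        then show "indicator (D (w(j := a, i := b))) (\<lambda>t\<in>{..<n}. B (w(j := a)) t (z t))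
            \<le> (if a = a0 then 1 else 0) * (if b = b0 a then 1 else 0 :: ennreal)"
          by (auto simp: indicator_def)
      next
        case False
        then show "indicator (D (w(j := a, i := b))) (\<lambda>t\<in>{..<n}. B (w(j := a)) t (z t))
            \<le> (if a = a0 then 1 else 0) * (if b = b0 a then 1 else 0 :: ennreal)"
          by (simp only: indicator_simps zero_le not_False_eq_True)
      qed
    qed
    then have "(\<Sum>a\<in>{1..M j}. \<Sum>b\<in>{1..M i}. ?J (w(j := a, i := b)) z) \<le>
        (\<Sum>a\<in>{1..M j}. \<Sum>b\<in>{1..M i}. (if a = a0 then 1 else 0) * (if b = b0 a then 1 else 0))"
      by (intro sum_mono)
    also have "\<dots> = (\<Sum>a\<in>{1..M j}. (if a = a0 then 1 else 0) * (\<Sum>b\<in>{1..M i}. (if b = b0 a then 1 else 0)))"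
      by (simp only: sum_distrib_left)
    also have "\<dots> \<le> (\<Sum>a\<in>{1..M j}. (if a = a0 then 1 else 0) * 1)"
      by (intro sum_mono mult_left_mono sum_indicator_le_1) auto
    also have "\<dots> \<le> 1" unfolding mult_1_right by (rule sum_indicator_le_1) auto
    finally show "(\<Sum>a\<in>{1..M j}. \<Sum>b\<in>{1..M i}. ?J (w(j := a, i := b)) z) \<le> 1" .
  qed
  also have "ennreal (exp ?\<kappa> * (\<Prod>t<n. ?s t * v t)) \<le>
     ennreal (exp ?\<kappa> * (((real CARD('k) + 1) * P * exp (2 * CARD('k) * c)) ^ n * (2 * exp (4 * c)) ^ n))"
  proof (intro ennreal_leI mult_left_mono)
    have "(\<Prod>t<n. v t) \<le> (2 * exp (4 * c)) ^ n"
    proof (cases "n = 0")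
      case False
      have "(\<Sum>t<n. ?ld t) \<le> c * n" "(\<Sum>t<n. ?lc t) \<le> c * n"
        using h ij False by (auto simp: chan_good_def field_simps)
      then have "(\<Sum>t<n. 2 * ?ld t + 2 * ?lc t) \<le> 4 * c * n"
        by (simp add: sum.distrib sum_distrib_left[symmetric])
      then have "exp (\<Sum>t<n. 2 * ?ld t + 2 * ?lc t) \<le> exp (4 * c * n)" by simp
      also have "\<dots> = exp (4 * c) ^ n" by (simp add: exp_of_nat_mult[symmetric] mult.commute)
      finally show ?thesis
        unfolding v_def by (simp add: prod.distrib exp_sum power_mult_distrib)
    qed simp
    moreover have "(\<Prod>t<n. ?s t) \<le> ((real CARD('k) + 1) * P * exp (2 * CARD('k) * c)) ^ n"
      by (rule prod_output_scale_le[OF P h c])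
    ultimately show "(\<Prod>t<n. ?s t * v t) \<le> ((real CARD('k) + 1) * P * exp (2 * CARD('k) * c)) ^ n * (2 * exp (4 * c)) ^ n"
      unfolding prod.distrib using P
      by (intro mult_mono) (auto intro!: prod_nonneg simp: less_imp_le[OF v])
  qed simp
  also have "exp ?\<kappa> = exp (4 * (real CARD('k))\<^sup>2 + 4) ^ n * exp 8 ^ n"
    by (simp add: exp_of_nat_mult[symmetric] exp_add[symmetric] mult.commute)
  finally show ?thesis by (simp add: power_mult_distrib mult_ac)
qed

text \<open>One law from \<open>L\<close> is enough. \<open>C\<close> serves all powers, orders and
  rates at once, so that the bounds survive the convex hull and the limit in
  \<open>P\<close>.\<close>

lemma achievable_bounds:
  fixes T :: "'k::finite \<Rightarrow> 'k set"
  assumes "\<And>j. j \<in> T j" and reg: "regular_channel_laws T L"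
  obtains C where "\<And>P \<pi> R k. 1 \<le> P \<Longrightarrow> decoding_order \<pi> \<Longrightarrow> achievable T L P \<pi> R \<Longrightarrow> R $ k \<le> log 2 P + C"
    "\<And>P \<pi> R i j. 1 \<le> P \<Longrightarrow> decoding_order \<pi> \<Longrightarrow> achievable T L P \<pi> R \<Longrightarrow>
       i \<noteq> j \<Longrightarrow> i \<in> T j \<Longrightarrow> (i, j) \<notin> \<pi> \<Longrightarrow> R $ i + R $ j \<le> log 2 P + C"
proof -
  obtain c where c: "1 \<le> c" "\<And>\<mu>. \<mu> \<in> L \<Longrightarrow> (\<lambda>n. measure \<mu> {h \<in> space \<mu>. chan_good T c n h}) \<longlonglongrightarrow> 1"
    using prob_chan_good[OF reg] by blast
  obtain \<mu> where \<mu>: "\<mu> \<in> L" "prob_space \<mu>" "sets \<mu> = sets channel_space"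
    using reg by (auto simp: regular_channel_laws_def)
  \<comment> \<open>The base of the two-user bound without its factor \<open>P\<close>. As the extra
    factors are at least 1 together, it serves a single user too.\<close>
  define A where "A = exp (4 * (real CARD('k))\<^sup>2 + 4) * ((real CARD('k) + 1) * exp (2 * CARD('k) * c)) * (exp 8 * (2 * exp (4 * c)))"
  have A: "0 < A" unfolding A_def by (intro mult_pos_pos) auto
  have *: "(\<Sum>u\<in>U. R $ u) \<le> log 2 P + log 2 A"
    if P: "1 \<le> P" and \<pi>: "decoding_order \<pi>" and R: "achievable T L P \<pi> R"
      and U: "(\<exists>k. U = {k}) \<or> (\<exists>i j. U = {i, j} \<and> i \<noteq> j \<and> i \<in> T j \<and> (i, j) \<notin> \<pi>)" for P \<pi> R U
  proof -
    from R obtain f g where *: "\<forall>n. (\<forall>i. avg_power n (num_messages n R) (f n) i \<le> P) \<and> measurable_decoders n (g n)"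
      "\<forall>\<mu>\<in>L. (\<lambda>n. Max (range (error_prob T \<mu> \<pi> n (num_messages n R) (f n) (g n)))) \<longlonglongrightarrow> 0"
      unfolding achievable_def by blast
    have fg: "avg_power n (num_messages n R) (f n) i \<le> P" "measurable_decoders n (g n)"
      "(\<lambda>n. Max (range (error_prob T \<mu> \<pi> n (num_messages n R) (f n) (g n)))) \<longlonglongrightarrow> 0" for n i
      using * \<mu>(1) by blast+
    have "(\<Sum>u\<in>U. R $ u) \<le> log 2 (A * P)"
    proof (rule rate_bound[OF \<mu>(2,3) \<pi> fg(2) _ fg(1) fg(3) c(2)[OF \<mu>(1)]])
      show "0 < P" "0 < A * P" using P A by auto
      fix n h assume h: "chan_good T c n h"
      let ?I = "\<integral>\<^sup>+w. \<integral>\<^sup>+z. indicator {z. noise_good n z \<and> power_good n P (f n) w \<and>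
         (\<forall>k. decoded \<pi> (g n) h (received T n (f n) h z w) k = w k)} z \<partial>noise_measure \<partial>message_measure (num_messages n R)"
      have c0: "0 \<le> c" using c by simp
      from U show "(\<Prod>u\<in>U. of_nat (num_messages n R u)) * ?I \<le> ennreal ((A * P) ^ n)"
      proof (elim disjE exE conjE)
        fix k assume "U = {k}"
        then have "(\<Prod>u\<in>U. of_nat (num_messages n R u)) * ?I \<le>
           ennreal ((exp (4 * (real CARD('k))\<^sup>2 + 4) * ((real CARD('k) + 1) * P * exp (2 * CARD('k) * c))) ^ n)"
          using single_user_counting_bound[where k = k, OF \<pi> fg(2) P c0 num_messages_ge_1 h] by simp
        also have "\<dots> \<le> ennreal ((A * P) ^ n)"
        proof (intro ennreal_leI power_mono)
          have "1 \<le> exp 8 * (2 * exp (4 * c))"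
          proof -
            have "1 \<le> exp (8 + 4 * c)" using c0 by simp
            then show ?thesis unfolding exp_add by linarith
          qed
          from mult_left_mono[OF this, of "exp (4 * (real CARD('k))\<^sup>2 + 4) * ((real CARD('k) + 1) * P * exp (2 * CARD('k) * c))"]
          show "exp (4 * (real CARD('k))\<^sup>2 + 4) * ((real CARD('k) + 1) * P * exp (2 * CARD('k) * c)) \<le> A * P"
            using P by (simp add: A_def mult_ac)
        qed (use P in auto)
        finally show ?thesis .
      next
        fix i j assume ij: "U = {i, j}" "i \<noteq> j" "i \<in> T j" "(i, j) \<notin> \<pi>"
        have "(\<Prod>u\<in>U. of_nat (num_messages n R u)) * ?I = of_nat (num_messages n R j) * (of_nat (num_messages n R i) * ?I)"
          using ij by (simp add: mult_ac)
        also have "\<dots> \<le> ennreal ((exp (4 * (real CARD('k))\<^sup>2 + 4) * ((real CARD('k) + 1) * P * exp (2 * CARD('k) * c)) * (exp 8 * (2 * exp (4 * c)))) ^ n)"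
          by (rule two_user_counting_bound[OF \<pi> fg(2) P c0 num_messages_ge_1 h]) (use ij assms in auto)
        also have "\<dots> = ennreal ((A * P) ^ n)" by (simp add: A_def mult_ac)
        finally show ?thesis .
      qed
    qed
    also have "log 2 (A * P) = log 2 P + log 2 A"
      using A P by (simp add: log_mult)
    finally show ?thesis .
  qed
  show thesis
  proof (rule that[of "log 2 A"])
    show "R $ k \<le> log 2 P + log 2 A" if "1 \<le> P" "decoding_order \<pi>" "achievable T L P \<pi> R" for P \<pi> R k
      using *[OF that, of "{k}"] by simp
    show "R $ i + R $ j \<le> log 2 P + log 2 A" if "1 \<le> P" "decoding_order \<pi>" "achievable T L P \<pi> R" "i \<noteq> j" "i \<in> T j" "(i, j) \<notin> \<pi>" for P \<pi> R i j
      using *[OF that(1-3), of "{i, j}"] that(4-) by auto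
  qed
qed

section \<open>Dicycles and the covering polytope\<close>

text \<open>\<open>pre_digraph.cas\<close> freed from the digraph, so that one walk can be read in
  all induced subgraphs.\<close>

fun walk :: "'v \<Rightarrow> ('v \<times> 'v) list \<Rightarrow> 'v \<Rightarrow> bool" where
  "walk u [] v \<longleftrightarrow> u = v"
| "walk u (e # es) v \<longleftrightarrow> fst e = u \<and> walk (snd e) es v"

lemma walk_append: "walk u (p @ q) v \<longleftrightarrow> (\<exists>m. walk u p m \<and> walk m q v)"
  by (induction p arbitrary: u) auto

lemma walk_last: "walk u p v \<Longrightarrow> p \<noteq> [] \<Longrightarrow> snd (last p) = v"
  by (induction p arbitrary: u) (auto split: if_splits)

text \<open>Each head is the next tail, except the last, which is \<open>v\<close>. So the tails of
  a nonempty closed walk are all its vertices.\<close>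

lemma walk_heads_subset: "walk u p v \<Longrightarrow> snd ` set p \<subseteq> insert v (fst ` set p)"
proof (induction p arbitrary: u)
  case (Cons e p)
  then show ?case by (cases p) auto
qed simp

lemma walk_trans: "walk u p v \<Longrightarrow> p \<noteq> [] \<Longrightarrow> set p \<subseteq> r \<Longrightarrow> trans r \<Longrightarrow> (u, v) \<in> r"
proof (induction p arbitrary: u)
  case (Cons e p)
  show ?case
  proof (cases "p = []")
    case True
    then show ?thesis using Cons.prems by auto
  next
    case False
    then have "(snd e, v) \<in> r" using Cons by auto
    moreover have "(u, snd e) \<in> r" using Cons.prems by auto
    ultimately show ?thesis using transD[OF \<open>trans r\<close>] by blast
  qed
qed simp

lemma trancl_imp_walk: "(u, v) \<in> r\<^sup>+ \<Longrightarrow> \<exists>p. walk u p v \<and> p \<noteq> [] \<and> set p \<subseteq> r"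
proof (induction rule: trancl_induct)
  case (base y)
  then show ?case by (intro exI[of _ "[(u, y)]"]) auto
next
  case (step y z)
  then obtain p where "walk u p y" "p \<noteq> []" "set p \<subseteq> r" by auto
  with step(2) show ?case by (intro exI[of _ "p @ [(y, z)]"]) (auto simp: walk_append)
qed

lemma cas_eq_walk:
  assumes "tail G = fst" "head G = snd" shows "pre_digraph.cas G u p v \<longleftrightarrow> walk u p v"
  using assms by (induction p arbitrary: u) (auto simp: pre_digraph.cas.simps)

section \<open>Dicycles of the conflict digraph\<close>

definition conflict_arcs :: "('k \<Rightarrow> 'k set) \<Rightarrow> 'k set \<Rightarrow> ('k \<times> 'k) set" where
  "conflict_arcs T S = {(i, j). i \<noteq> j \<and> i \<in> T j \<and> i \<in> S \<and> j \<in> S}"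

lemma arcs_induced: "arcs (conflict_digraph T \<restriction> S) = conflict_arcs T S"
  by (auto simp: conflict_digraph_def conflict_arcs_def)

lemma induced_tail_head:
  "tail (conflict_digraph T \<restriction> S) = fst" "head (conflict_digraph T \<restriction> S) = snd" "verts (conflict_digraph T \<restriction> S) = S"
  by (simp_all add: conflict_digraph_def)

lemma conflict_digraph_UNIV: "conflict_digraph T \<restriction> UNIV = conflict_digraph T"
  by (simp add: induce_subgraph_def conflict_digraph_def)

text \<open>After its first vertex, a walk visits the heads of its arcs. This turns the distinctness
  required of a cycle into that of the list of heads, which is invariant under rotation.\<close>

lemma cycle_induced_iff:
  "pre_digraph.cycle (conflict_digraph T \<restriction> S) p \<longleftrightarrow>
    (\<exists>u. walk u p u) \<and> distinct (map snd p) \<and> p \<noteq> [] \<and> set p \<subseteq> conflict_arcs T S"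
proof -
  let ?G = "conflict_digraph T \<restriction> S"
  note eq = cas_eq_walk[of ?G, OF induced_tail_head(1,2)]
  have "distinct (tl (pre_digraph.awalk_verts ?G u p)) \<longleftrightarrow> distinct (map snd p)" if "walk u p u" "p \<noteq> []" for u
    using that pre_digraph.awalk_verts_conv'[of ?G u p u] by (simp add: eq) (simp add: conflict_digraph_def)
  moreover have "u \<in> S" if "walk u p u" "p \<noteq> []" "set p \<subseteq> conflict_arcs T S" for u
    using that by (cases p) (auto simp: conflict_arcs_def)
  moreover have "pre_digraph.cycle ?G p \<longleftrightarrow>
      (\<exists>u. (u \<in> S \<and> set p \<subseteq> conflict_arcs T S \<and> walk u p u) \<and> distinct (tl (pre_digraph.awalk_verts ?G u p)) \<and> p \<noteq> [])"
    unfolding pre_digraph.cycle_def pre_digraph.awalk_def eq arcs_induced induced_tail_head ..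
  ultimately show ?thesis by metis
qed

text \<open>Each user of \<open>S\<close> is to be decoded before the users of \<open>S\<close> that
  it disturbs. A loop in the closure would be a closed walk, and a closed walk contains a
  cycle.\<close>

lemma acyclic_imp_decoding_order:
  assumes "acyclic_set (conflict_digraph T) S"
  shows "decoding_order ((conflict_arcs T S)\<^sup>+)"
proof -
  let ?G = "conflict_digraph T \<restriction> S"
  have "wf_digraph (conflict_digraph T)" by (auto simp: wf_digraph_def conflict_digraph_def)
  then have wf: "wf_digraph ?G" by (rule wf_digraph.wellformed_induce_subgraph)
  have "(v, v) \<notin> (conflict_arcs T S)\<^sup>+" for v
  proof (rule notI)
    assume "(v, v) \<in> (conflict_arcs T S)\<^sup>+"
    from trancl_imp_walk[OF this] obtain p where p: "walk v p v" "p \<noteq> []" "set p \<subseteq> conflict_arcs T S"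
      by blast
    moreover from p have "v \<in> S" by (cases p) (auto simp: conflict_arcs_def)
    ultimately have "pre_digraph.awalk ?G v p v"
      by (simp only: pre_digraph.awalk_def cas_eq_walk[OF induced_tail_head(1,2)] arcs_induced induced_tail_head)
    with p(2) have "wf_digraph.closed_w ?G p" unfolding wf_digraph.closed_w_def[OF wf] by auto
    from wf_digraph.closed_w_imp_cycle[OF wf this] assms show False unfolding acyclic_set_def by blast
  qed
  then show ?thesis by (auto simp: decoding_order_def irrefl_def)
qed

text \<open>If all arcs of the cycle were in the order, transitivity would put a vertex before
  itself.\<close>

lemma cycle_has_arc_not_in_order:
  assumes "C \<in> chordless_dicycles (conflict_digraph T)" "decoding_order \<pi>"
  obtains i j where "i \<in> C" "j \<in> C" "i \<noteq> j" "i \<in> T j" "(i, j) \<notin> \<pi>"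
proof -
  from assms(1) obtain p where "pre_digraph.cycle (conflict_digraph T \<restriction> UNIV) p" and C: "C = fst ` set p"
    by (auto simp: chordless_dicycles_def conflict_digraph_UNIV)
  then obtain u where p: "walk u p u" "p \<noteq> []" "set p \<subseteq> conflict_arcs T UNIV"
    by (auto simp: cycle_induced_iff)
  have "\<not> set p \<subseteq> \<pi>"
    using walk_trans[OF p(1,2)] assms(2) by (auto simp: decoding_order_def irrefl_def)
  then obtain i j where ij: "(i, j) \<in> set p" "(i, j) \<notin> \<pi>" by auto
  have "u \<in> fst ` set p" using p by (cases p) auto
  then have "snd ` set p \<subseteq> C" using walk_heads_subset[OF p(1)] C by auto
  with imageI[OF ij(1), of fst] imageI[OF ij(1), of snd] have "i \<in> C" "j \<in> C" by (auto simp: C)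
  moreover have "(i, j) \<in> conflict_arcs T UNIV" using ij(1) p(3) by blast
  ultimately show ?thesis using that[of i j] ij(2) by (simp add: conflict_arcs_def)
qed

text \<open>In a shortest cycle within \<open>S\<close>, an arc (a, b) between two of its vertices
  closes the path from b to a along the cycle. Minimality allows this only if that path misses a
  single arc of the cycle, and then this arc is (a, b) itself.\<close>

lemma cycle_imp_chordless_dicycle:
  assumes "pre_digraph.cycle (conflict_digraph T \<restriction> S) p0"
  obtains C where "C \<in> chordless_dicycles (conflict_digraph T)" "C \<subseteq> S"
proof -
  obtain p where cyc: "pre_digraph.cycle (conflict_digraph T \<restriction> S) p"
    and min: "\<And>q. pre_digraph.cycle (conflict_digraph T \<restriction> S) q \<Longrightarrow> length p \<le> length q"
    using ex_has_least_nat[of "pre_digraph.cycle (conflict_digraph T \<restriction> S)" p0 length] assms by blast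
  from cyc obtain u where p: "walk u p u" "distinct (map snd p)" "p \<noteq> []" "set p \<subseteq> conflict_arcs T S"
    by (auto simp: cycle_induced_iff)
  define C where "C = fst ` set p"
  have "u \<in> C" using p(1,3) by (cases p) (auto simp: C_def)
  then have heads: "snd ` set p \<subseteq> C" using walk_heads_subset[OF p(1)] C_def by auto
  have CS: "C \<subseteq> S" using p(4) by (auto simp: C_def conflict_arcs_def)
  have len: "2 \<le> length p"
  proof (rule ccontr)
    assume "\<not> 2 \<le> length p"
    with p(3) obtain e where "p = [e]" by (cases p; cases "tl p") auto
    with p(1,4) show False by (auto simp: conflict_arcs_def)
  qed
  have "e \<in> set p" if e: "e \<in> conflict_arcs T C" for e
  proof -
    obtain a b where ab: "e = (a, b)" "a \<noteq> b" "a \<in> C" "b \<in> C" "a \<in> T b"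
      using e by (cases e) (auto simp: conflict_arcs_def)
    from ab(4) obtain b' p1 p2 where p12: "p = p1 @ (b, b') # p2"
      by (auto simp: C_def in_set_conv_decomp)
    \<comment> \<open>The cycle is rotated to start at \<open>b\<close> and will then be cut at
      \<open>a\<close>.\<close>
    define p' where "p' = ((b, b') # p2) @ p1"
    have p': "walk b p' b" "distinct (map snd p')" "set p' = set p" "length p' = length p"
      using p(1,2) unfolding p12 p'_def walk_append by auto
    from ab(3) obtain a' q r where q: "p' = q @ (a, a') # r"
      by (auto simp: C_def p'(3)[symmetric] in_set_conv_decomp)
    have wq: "walk b q a" "walk a' r b"
      using p'(1) unfolding q walk_append by auto
    show ?thesis
    proof (cases "r = []")
      case True
      then show ?thesis using wq(2) ab(1) q p'(3) by auto
    next
      case False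
      \<comment> \<open>\<open>b\<close> is the head of the last arc, which lies in
        \<open>r\<close>; so appending an arc with head \<open>b\<close> to \<open>q\<close> keeps
        the heads distinct.\<close>
      have "b = snd (last r)" using walk_last[OF wq(2) False] by simp
      then have "b \<notin> snd ` set q"
        using p'(2) False unfolding q by (auto dest!: last_in_set)
      then have "pre_digraph.cycle (conflict_digraph T \<restriction> S) (q @ [(a, b)])"
        using wq(1) p'(2,3) p(4) ab CS unfolding cycle_induced_iff q
        by (auto simp: walk_append conflict_arcs_def)
      from min[OF this] p'(4) False show ?thesis unfolding q by (cases r) simp_all
    qed
  qed
  moreover have "e \<in> conflict_arcs T C" if e: "e \<in> set p" for e
  proof -
    have "fst e \<in> C" "snd e \<in> C" using e heads by (auto simp: C_def)
    with e p(4) show ?thesis by (auto simp: conflict_arcs_def)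
  qed
  ultimately have arcs: "arcs (conflict_digraph T \<restriction> C) = set p"
    unfolding arcs_induced by blast
  have "pre_digraph.cycle (conflict_digraph T) p"
    using p cycle_induced_iff[of T UNIV p] by (auto simp: conflict_digraph_UNIV conflict_arcs_def)
  then have "C \<in> chordless_dicycles (conflict_digraph T)"
    unfolding chordless_dicycles_def using len arcs C_def by auto
  then show ?thesis using CS that by blast
qed

section \<open>The dicycle polytope and its complement\<close>

lemma sum_incidence_mult: "(\<Sum>k\<in>UNIV. incidence C $ k * y $ k) = (\<Sum>k\<in>C. y $ k)" for y :: "real ^ 'k::finite"
  by (simp add: incidence_def indicator_def if_distrib sum.If_cases cong: if_cong)

definition dicycle_polytope :: "('k::finite \<Rightarrow> 'k set) \<Rightarrow> (real ^ 'k) set" where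
  "dicycle_polytope T = {d. (\<forall>k. 0 \<le> d $ k \<and> d $ k \<le> 1) \<and>
     (\<forall>C\<in>chordless_dicycles (conflict_digraph T). (\<Sum>k\<in>C. d $ k) \<le> real (card C) - 1)}"

lemma mem_dicycle_polytope_iff:
  "d \<in> dicycle_polytope T \<longleftrightarrow> (\<chi> k. 1 - d $ k) \<in> covering_polytope (chordless_dicycles (conflict_digraph T)) incidence"
  unfolding dicycle_polytope_def covering_polytope_def mem_Collect_eq sum_incidence_mult
  by (auto simp: sum_subtractf)

lemma complement_dicycle_polytope:
  "(\<lambda>d. \<chi> k. 1 - d $ k) ` dicycle_polytope T = covering_polytope (chordless_dicycles (conflict_digraph T)) incidence"
proof (intro set_eqI iffI)
  fix y assume "y \<in> covering_polytope (chordless_dicycles (conflict_digraph T)) incidence"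
  then show "y \<in> (\<lambda>d. \<chi> k. 1 - d $ k) ` dicycle_polytope T"
    by (intro image_eqI[of _ _ "\<chi> k. 1 - y $ k"]) (auto simp: mem_dicycle_polytope_iff vec_eq_iff)
qed (auto simp: mem_dicycle_polytope_iff)

lemma compact_covering_polytope: "compact (covering_polytope I M)" for M :: "'r \<Rightarrow> real ^ 'k::finite"
proof -
  have eq: "covering_polytope I M = cbox 0 1 \<inter> (\<Inter>r\<in>I. {y. 1 \<le> (\<Sum>k\<in>UNIV. M r $ k * y $ k)})"
    by (auto simp: covering_polytope_def mem_box_cart)
  show ?thesis unfolding eq
    by (intro compact_Int_closed compact_cbox closed_INT ballI closed_Collect_le continuous_intros)
qed

lemma convex_covering_polytope: "convex (covering_polytope I M)" for M :: "'r \<Rightarrow> real ^ 'k::finite"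
proof -
  have eq: "covering_polytope I M = cbox 0 1 \<inter> (\<Inter>r\<in>I. {y. M r \<bullet> y \<ge> 1})"
    by (auto simp: covering_polytope_def mem_box_cart inner_vec_def)
  show ?thesis unfolding eq by (intro convex_Int convex_box convex_INT convex_halfspace_ge)
qed

text \<open>Minkowski's theorem writes the complement of \<open>d\<close> as a convex combination of
  extreme points, and taking complements commutes with convex hulls. An extreme point is 0/1 by
  idealness and the bounds; a chordless dicycle inside its zero set would violate a row.\<close>

lemma dicycle_polytope_subset_orthogonal_access:
  fixes T :: "'k::finite \<Rightarrow> 'k set"
  assumes ideal: "ideal_matrix (chordless_dicycles (conflict_digraph T)) (incidence :: 'k set \<Rightarrow> real ^ 'k)"
  shows "dicycle_polytope T \<subseteq> orthogonal_access_region T"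
proof
  let ?Q = "covering_polytope (chordless_dicycles (conflict_digraph T)) (incidence :: 'k set \<Rightarrow> real ^ 'k)"
  \<comment> \<open>The complement in the form of an affine map, as
    \<open>convex_hull_affinity\<close> wants it; it is its own inverse.\<close>
  let ?f = "\<lambda>y :: real ^ 'k. 1 + (- 1) *\<^sub>R y"
  fix d assume "d \<in> dicycle_polytope T"
  moreover have "?f d = (\<chi> k. 1 - d $ k)" by (simp add: vec_eq_iff)
  ultimately have "?f d \<in> ?Q" by (simp only: mem_dicycle_polytope_iff)
  then have "?f d \<in> convex hull {y. y extreme_point_of ?Q}"
    using Krein_Milman_Minkowski[OF compact_covering_polytope convex_covering_polytope] by blast
  then have "?f (?f d) \<in> ?f ` (convex hull {y. y extreme_point_of ?Q})" by blast
  then have "d \<in> convex hull (?f ` {y. y extreme_point_of ?Q})"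
    unfolding convex_hull_affinity by simp
  also have "\<dots> \<subseteq> orthogonal_access_region T"
    unfolding orthogonal_access_region_def
  proof (intro hull_mono subsetI)
    fix x assume "x \<in> ?f ` {y. y extreme_point_of ?Q}"
    then obtain y where y: "y extreme_point_of ?Q" "x = ?f y" by auto
    then have yQ: "y \<in> ?Q" by (simp add: extreme_point_of_def)
    have y01: "y $ k = 0 \<or> y $ k = 1" for k
    proof -
      have "y $ k \<in> \<int>" using ideal y by (auto simp: ideal_matrix_def)
      then obtain m where m: "y $ k = of_int m" by (auto elim: Ints_cases)
      moreover have "0 \<le> y $ k" "y $ k \<le> 1" using yQ by (auto simp: covering_polytope_def)
      ultimately have "m = 0 \<or> m = 1" by simp linarith
      with m show ?thesis by auto
    qed
    define S where "S = {k. y $ k = 0}"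
    have "x = incidence S"
      using y01 y(2) by (auto simp: vec_eq_iff incidence_def S_def indicator_def)
    moreover have "acyclic_set (conflict_digraph T) S"
      unfolding acyclic_set_def
    proof (intro conjI notI)
      assume "\<exists>p. pre_digraph.cycle (conflict_digraph T \<restriction> S) p"
      then obtain C where C: "C \<in> chordless_dicycles (conflict_digraph T)" "C \<subseteq> S"
        by (elim exE) (rule cycle_imp_chordless_dicycle)
      then have "1 \<le> (\<Sum>k\<in>C. y $ k)"
        using yQ unfolding covering_polytope_def mem_Collect_eq sum_incidence_mult by blast
      moreover have "(\<Sum>k\<in>C. y $ k) = 0" using C(2) by (intro sum.neutral) (auto simp: S_def)
      ultimately show False by simp
    qed (simp add: conflict_digraph_def)
    ultimately show "x \<in> incidence ` {S. acyclic_set (conflict_digraph T) S}" by blast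
  qed
  finally show "d \<in> orthogonal_access_region T" .
qed

section \<open>Achievability\<close>

text \<open>Choose the positions where \<open>y\<close> may differ, at most \<open>2 ^ n\<close>
  possibilities, and then the symbols there. The crude \<open>2 ^ n\<close> costs one bit per
  symbol, which is nothing against log P.\<close>

lemma card_hamming_ball_le:
  fixes A :: "'a set"
  assumes A: "finite A" "A \<noteq> {}" and x: "x \<in> (\<Pi>\<^sub>E t\<in>{..<n}. A)"
  shows "card {y \<in> (\<Pi>\<^sub>E t\<in>{..<n}. A). card {t. t < n \<and> y t \<noteq> x t} \<le> d} \<le> 2 ^ n * card A ^ d"
proof -
  let ?X = "\<Pi>\<^sub>E t\<in>{..<n}. A"
  let ?I = "{D. D \<subseteq> {..<n} \<and> card D \<le> d}"
  let ?F = "\<lambda>D. {y \<in> ?X. {t. t < n \<and> y t \<noteq> x t} \<subseteq> D}"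
  have finX: "finite ?X" using A by (intro finite_PiE) auto
  have q: "1 \<le> card A" using A by (simp add: Suc_le_eq card_gt_0_iff)
  have F: "card (?F D) \<le> card A ^ d" if D: "D \<in> ?I" for D
  proof -
    have "card (?F D) \<le> card (\<Pi>\<^sub>E t\<in>D. A)"
    proof (rule card_inj_on_le[of "\<lambda>y. restrict y D"])
      show "inj_on (\<lambda>y. restrict y D) (?F D)"
      proof (rule inj_onI)
        fix y z assume yz: "y \<in> ?F D" "z \<in> ?F D" "restrict y D = restrict z D"
        have "y t = z t" for t
        proof (cases "t \<in> D")
          case True then show ?thesis using fun_cong[OF yz(3), of t] by simp
        next
          case False
          show ?thesis
          proof (cases "t < n")
            case True
            with False yz(1,2) have "y t = x t" "z t = x t" by blast+
            then show ?thesis by simp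
          next
            case 2: False
            then show ?thesis using yz(1,2) by (auto simp: PiE_iff extensional_def)
          qed
        qed
        then show "y = z" by auto
      qed
      show "(\<lambda>y. restrict y D) ` ?F D \<subseteq> (\<Pi>\<^sub>E t\<in>D. A)" using D by (auto simp: PiE_iff)
      show "finite (\<Pi>\<^sub>E t\<in>D. A)" using D A by (intro finite_PiE) (auto intro: finite_subset)
    qed
    also have "\<dots> = card A ^ card D" using D by (subst card_PiE) (auto intro: finite_subset)
    also have "\<dots> \<le> card A ^ d" using D q by (intro power_increasing) auto
    finally show ?thesis .
  qed
  have finI: "finite ?I" by (rule finite_subset[of _ "Pow {..<n}"]) auto
  have "{y \<in> ?X. card {t. t < n \<and> y t \<noteq> x t} \<le> d} \<subseteq> (\<Union>D\<in>?I. ?F D)"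
  proof
    fix y assume "y \<in> {y \<in> ?X. card {t. t < n \<and> y t \<noteq> x t} \<le> d}"
    then show "y \<in> (\<Union>D\<in>?I. ?F D)" by (intro UN_I[of "{t. t < n \<and> y t \<noteq> x t}"]) auto
  qed
  then have "card {y \<in> ?X. card {t. t < n \<and> y t \<noteq> x t} \<le> d} \<le> card (\<Union>D\<in>?I. ?F D)"
    by (intro card_mono finite_UN_I finI) (use finX in auto)
  also have "\<dots> \<le> (\<Sum>D\<in>?I. card (?F D))" by (rule card_UN_le[OF finI])
  also have "\<dots> \<le> (\<Sum>D\<in>?I. card A ^ d)" by (intro sum_mono F)
  also have "\<dots> = card ?I * card A ^ d" by simp
  also have "card ?I \<le> card (Pow {..<n})" by (intro card_mono) auto
  then have "card ?I * card A ^ d \<le> 2 ^ n * card A ^ d" by (intro mult_right_mono) (auto simp: card_Pow)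
  finally show ?thesis .
qed

text \<open>Greedy choice: as long as the balls around the codewords found so far do not fill the
  space, another codeword can be added. Avoiding \<open>m\<close> balls yields \<open>Suc m\<close>
  codewords.\<close>

lemma gilbert_varshamov:
  fixes A :: "'a set"
  assumes A: "finite A" "A \<noteq> {}" and m: "m * (2 ^ n * card A ^ d) < card A ^ n"
  shows "\<exists>C. C \<subseteq> (\<Pi>\<^sub>E t\<in>{..<n}. A) \<and> card C = Suc m \<and> (\<forall>x\<in>C. \<forall>y\<in>C. x \<noteq> y \<longrightarrow> d < card {t. t < n \<and> x t \<noteq> y t})"
  using m
proof (induction m)
  let ?X = "\<Pi>\<^sub>E t\<in>{..<n}. A"
  case 0
  have "?X \<noteq> {}" using A by (auto simp: PiE_eq_empty_iff)
  then obtain x where "x \<in> ?X" by blast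
  then show ?case by (intro exI[of _ "{x}"]) auto
next
  let ?X = "\<Pi>\<^sub>E t\<in>{..<n}. A"
  let ?B = "\<lambda>x. {y \<in> ?X. card {t. t < n \<and> y t \<noteq> x t} \<le> d}"
  case (Suc m)
  have finX: "finite ?X" using A by (intro finite_PiE) auto
  have "m * (2 ^ n * card A ^ d) < card A ^ n" using Suc.prems by (simp add: add_lessD1)
  from Suc.IH[OF this] obtain C where C: "C \<subseteq> ?X" "card C = Suc m"
    "\<And>x y. x \<in> C \<Longrightarrow> y \<in> C \<Longrightarrow> x \<noteq> y \<Longrightarrow> d < card {t. t < n \<and> x t \<noteq> y t}" by blast
  have finC: "finite C" using C(1) finX by (rule finite_subset)
  have "card (\<Union>x\<in>C. ?B x) \<le> (\<Sum>x\<in>C. card (?B x))" by (rule card_UN_le[OF finC])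
  also have "\<dots> \<le> (\<Sum>x\<in>C. 2 ^ n * card A ^ d)"
    using C(1) by (intro sum_mono card_hamming_ball_le A) auto
  also have "\<dots> = Suc m * (2 ^ n * card A ^ d)" using C(2) by simp
  also have "\<dots> < card A ^ n" by (rule Suc.prems)
  also have "\<dots> = card ?X" by (subst card_PiE) auto
  finally have "\<not> ?X \<subseteq> (\<Union>x\<in>C. ?B x)"
    using card_mono[of "\<Union>x\<in>C. ?B x" ?X] finC finX by fastforce
  then obtain y where y: "y \<in> ?X" "\<And>x. x \<in> C \<Longrightarrow> d < card {t. t < n \<and> y t \<noteq> x t}" by force
  have y': "d < card {t. t < n \<and> x t \<noteq> y t}" if "x \<in> C" for x
    using y(2)[OF that] by (simp only: eq_commute[of "x _"])
  have "y \<notin> C" using y(2)[of y] by auto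
  then have "card (insert y C) = Suc (Suc m)" using C(2) finC by simp
  moreover have "\<forall>x\<in>insert y C. \<forall>z\<in>insert y C. x \<noteq> z \<longrightarrow> d < card {t. t < n \<and> x t \<noteq> z t}"
    using C(3) y(2) y' by auto
  ultimately show ?case using C(1) y(1) by (intro exI[of _ "insert y C"]) auto
qed

text \<open>The alphabet is an N by N grid of spacing \<open>\<Delta>\<close>, so that Hamming
  distance counts positions with a definite Euclidean gap. The grid has a corner at 0; centring it
  would only improve the constant 2.\<close>

lemma complex_code_exists:
  assumes N: "1 \<le> N" and \<Delta>: "0 < \<Delta>" and m: "m * (2 ^ n * (N\<^sup>2) ^ d) < (N\<^sup>2) ^ n"
  obtains e :: "nat \<Rightarrow> nat \<Rightarrow> complex" where
    "\<And>w t. w \<in> {1..Suc m} \<Longrightarrow> t < n \<Longrightarrow> (cmod (e w t))\<^sup>2 \<le> 2 * (real N)\<^sup>2 * \<Delta>\<^sup>2"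
    "\<And>w w'. w \<in> {1..Suc m} \<Longrightarrow> w' \<in> {1..Suc m} \<Longrightarrow> w \<noteq> w' \<Longrightarrow> d < card {t. t < n \<and> \<Delta> \<le> cmod (e w t - e w' t)}"
proof -
  define p where "p ab = Complex (\<Delta> * real (fst ab)) (\<Delta> * real (snd ab))" for ab
  define A where "A = p ` ({..<N} \<times> {..<N})"
  have "inj_on p ({..<N} \<times> {..<N})" using \<Delta> by (auto simp: inj_on_def p_def)
  then have cardA: "card A = N\<^sup>2" by (simp add: A_def card_image power2_eq_square)
  have A: "finite A" "A \<noteq> {}" using N by (auto simp: A_def lessThan_empty_iff)
  have energy: "(cmod a)\<^sup>2 \<le> 2 * (real N)\<^sup>2 * \<Delta>\<^sup>2" if "a \<in> A" for a
  proof -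
    from that obtain i j where ij: "i < N" "j < N" "a = p (i, j)" by (auto simp: A_def)
    then have "(real i)\<^sup>2 \<le> (real N)\<^sup>2" "(real j)\<^sup>2 \<le> (real N)\<^sup>2" by (intro power_mono; simp)+
    then have "(real i)\<^sup>2 + (real j)\<^sup>2 \<le> 2 * (real N)\<^sup>2" by linarith
    then have "\<Delta>\<^sup>2 * ((real i)\<^sup>2 + (real j)\<^sup>2) \<le> \<Delta>\<^sup>2 * (2 * (real N)\<^sup>2)" by (rule mult_left_mono) simp
    then show ?thesis by (simp add: ij p_def cmod_def power_mult_distrib algebra_simps)
  qed
  have far: "\<Delta> \<le> cmod (a - b)" if "a \<in> A" "b \<in> A" "a \<noteq> b" for a b
  proof -
    from that obtain i j i' j' where ij: "a = p (i, j)" "b = p (i', j')" by (auto simp: A_def)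
    have gap: "\<Delta> \<le> \<bar>\<Delta> * real k - \<Delta> * real l\<bar>" if "k \<noteq> l" for k l
    proof -
      have "1 \<le> \<bar>real k - real l\<bar>" using that by linarith
      then have "\<Delta> * 1 \<le> \<Delta> * \<bar>real k - real l\<bar>" using \<Delta> by (intro mult_left_mono) auto
      also have "\<dots> = \<bar>\<Delta> * real k - \<Delta> * real l\<bar>" using \<Delta> by (simp add: abs_mult right_diff_distrib[symmetric])
      finally show ?thesis by simp
    qed
    have "i \<noteq> i' \<or> j \<noteq> j'" using that(3) ij by auto
    then have "\<Delta> \<le> \<bar>Re (a - b)\<bar> \<or> \<Delta> \<le> \<bar>Im (a - b)\<bar>"
      using gap by (auto simp: ij p_def)
    then show ?thesis using abs_Re_le_cmod[of "a - b"] abs_Im_le_cmod[of "a - b"] by linarith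
  qed
  from gilbert_varshamov[OF A, of m n d] m cardA obtain C where C: "C \<subseteq> (\<Pi>\<^sub>E t\<in>{..<n}. A)" "card C = Suc m"
    "\<And>x y. x \<in> C \<Longrightarrow> y \<in> C \<Longrightarrow> x \<noteq> y \<Longrightarrow> d < card {t. t < n \<and> x t \<noteq> y t}" by auto
  have "finite C" using C(2) by (intro card_ge_0_finite) simp
  from ex_bij_betw_nat_finite_1[OF this] obtain e where e: "bij_betw e {1..Suc m} C" using C(2) by auto
  have eC: "e w \<in> C" if "w \<in> {1..Suc m}" for w using e that by (auto simp: bij_betw_def)
  have eA: "e w t \<in> A" if "w \<in> {1..Suc m}" "t < n" for w t using eC[OF that(1)] C(1) that(2) by (auto simp: PiE_iff)
  show thesis
  proof (rule that[of e])
    show "(cmod (e w t))\<^sup>2 \<le> 2 * (real N)\<^sup>2 * \<Delta>\<^sup>2" if "w \<in> {1..Suc m}" "t < n" for w t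
      by (rule energy[OF eA[OF that]])
    show "d < card {t. t < n \<and> \<Delta> \<le> cmod (e w t - e w' t)}" if w: "w \<in> {1..Suc m}" "w' \<in> {1..Suc m}" "w \<noteq> w'" for w w'
    proof -
      have "e w \<noteq> e w'" using e w by (auto simp: bij_betw_def inj_on_def)
      with C(3)[OF eC[OF w(1)] eC[OF w(2)]] have "d < card {t. t < n \<and> e w t \<noteq> e w' t}" by simp
      also have "\<dots> \<le> card {t. t < n \<and> \<Delta> \<le> cmod (e w t - e w' t)}"
        using far eA w by (intro card_mono) auto
      finally show ?thesis .
    qed
  qed
qed

section \<open>Minimum distance decoding under fading\<close>

text \<open>A coefficient below \<open>exp (- c / \<epsilon>)\<close> contributes at least
  \<open>c / \<epsilon>\<close> to the sum of logarithms, so there are at most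
  \<open>\<epsilon> * n\<close> of them. Of more than \<open>2 * \<epsilon> * n\<close> positions
  with a gap, more than \<open>\<epsilon> * n\<close> survive, each with squared distance at least
  \<open>(exp (- c / \<epsilon>))\<^sup>2 * \<Delta>\<^sup>2\<close>.\<close>

lemma faded_distance_gt:
  fixes h \<delta> :: "nat \<Rightarrow> complex" and c \<epsilon> \<Delta> :: real
  assumes h0: "\<And>t. h t \<noteq> 0" and h: "(\<Sum>t<n. \<bar>ln (cmod (h t))\<bar>) \<le> c * n" and c: "0 < c" and \<epsilon>: "0 < \<epsilon>" and \<Delta>: "0 < \<Delta>"
    and \<Delta>': "16 \<le> \<epsilon> * (exp (- c / \<epsilon>))\<^sup>2 * \<Delta>\<^sup>2" and card: "2 * \<epsilon> * n < card {t. t < n \<and> \<Delta> \<le> cmod (\<delta> t)}"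
  shows "16 * real n < (\<Sum>t<n. (cmod (h t * \<delta> t))\<^sup>2)"
proof -
  let ?\<kappa> = "exp (- c / \<epsilon>)"
  define G where "G = {t. t < n \<and> \<Delta> \<le> cmod (\<delta> t)}"
  define F where "F = {t. t < n \<and> cmod (h t) < ?\<kappa>}"
  have fin: "finite G" "finite F" by (simp_all add: G_def F_def)
  have "card F * (c / \<epsilon>) = (\<Sum>t\<in>F. c / \<epsilon>)" by simp
  also have "\<dots> \<le> (\<Sum>t\<in>F. \<bar>ln (cmod (h t))\<bar>)"
  proof (rule sum_mono)
    fix t assume "t \<in> F"
    then have "ln (cmod (h t)) < ln ?\<kappa>" using h0[of t] by (subst ln_less_cancel_iff) (auto simp: F_def)
    then show "c / \<epsilon> \<le> \<bar>ln (cmod (h t))\<bar>" by simp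
  qed
  also have "\<dots> \<le> (\<Sum>t<n. \<bar>ln (cmod (h t))\<bar>)" by (rule sum_mono2) (auto simp: F_def)
  also note h
  finally have "card F * (c / \<epsilon>) \<le> c * n" .
  then have F: "card F \<le> \<epsilon> * n" using c \<epsilon> by (simp add: field_simps)
  have "card G \<le> card (G - F) + card F"
    using card_Un_le[of "G - F" F] card_mono[of "G - F \<union> F" G] fin by fastforce
  with F card have GF: "\<epsilon> * n < card (G - F)" unfolding G_def[symmetric] by linarith
  have pos: "0 < ?\<kappa>\<^sup>2 * \<Delta>\<^sup>2" using \<Delta> by simp
  have "16 * real n \<le> \<epsilon> * ?\<kappa>\<^sup>2 * \<Delta>\<^sup>2 * n" by (rule mult_right_mono[OF \<Delta>']) simp
  also have "\<dots> = \<epsilon> * n * (?\<kappa>\<^sup>2 * \<Delta>\<^sup>2)" by simp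
  also have "\<dots> < card (G - F) * (?\<kappa>\<^sup>2 * \<Delta>\<^sup>2)" by (rule mult_strict_right_mono[OF GF pos])
  also have "\<dots> = (\<Sum>t\<in>G - F. ?\<kappa>\<^sup>2 * \<Delta>\<^sup>2)" by simp
  also have "\<dots> \<le> (\<Sum>t\<in>G - F. (cmod (h t * \<delta> t))\<^sup>2)"
    unfolding norm_mult power_mult_distrib using \<Delta>
    by (intro sum_mono mult_mono power_mono) (auto simp: G_def F_def not_less)
  also have "\<dots> \<le> (\<Sum>t<n. (cmod (h t * \<delta> t))\<^sup>2)" by (rule sum_mono2) (auto simp: G_def)
  finally show ?thesis .
qed

text \<open>A threshold rule: the first message whose residual is at noise level. The disjunct
  \<open>M j \<le> a\<close> guarantees that the minimum exists and makes \<open>M j\<close> the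
  default; with a single message the result is 1 whatever is received.\<close>

definition min_distance_decoder ::
  "('k::finite \<Rightarrow> 'k set) \<Rightarrow> nat \<Rightarrow> ('k \<Rightarrow> nat) \<Rightarrow> 'k encoders \<Rightarrow> 'k decoders" where
  "min_distance_decoder T n M f j y v h = (LEAST a. 1 \<le> a \<and> (M j \<le> a \<or>
     (\<Sum>t<n. (cmod (y t - (\<Sum>i\<in>T j - {j}. h t $ j $ i * f i (v i) t) - h t $ j $ j * f j a t))\<^sup>2) \<le> 4 * n))"

lemma measurable_min_distance_decoder: "measurable_decoders n (min_distance_decoder T n M f)"
  unfolding measurable_decoders_def
proof (intro allI)
  fix j :: 'a and v
  let ?\<Omega> = "Pi\<^sub>M {..<n} (\<lambda>_. borel) \<Otimes>\<^sub>M channel_space :: ((nat \<Rightarrow> complex) \<times> 'a channel) measure"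
  have [measurable]: "(\<lambda>x. fst x t) \<in> borel_measurable ?\<Omega>" if "t \<in> {..<n}" for t
    using that by measurable
  have "(\<lambda>x. min_distance_decoder T n M f j (fst x) v (snd x)) \<in> ?\<Omega> \<rightarrow>\<^sub>M count_space UNIV"
    unfolding min_distance_decoder_def by measurable
  then show "(\<lambda>(y, h). min_distance_decoder T n M f j y v h) \<in> ?\<Omega> \<rightarrow>\<^sub>M count_space UNIV"
    by (simp add: split_beta')
qed

text \<open>The sent message passes the test, so the result \<open>a\<close> does not exceed it. If
  \<open>a\<close> were smaller, it would be below the default and its residual at noise level; two
  residuals of energy at most \<open>4 * n\<close> bound the squared distance of the codewords by 2
  (4 n + 4 n) = 16 n.\<close>

lemma min_distance_decoder_correct:
  fixes T :: "'k::finite \<Rightarrow> 'k set"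
  assumes w: "w j \<in> {1..M j}" and noise: "(\<Sum>t<n. (cmod (z t))\<^sup>2) \<le> 4 * n"
    and y: "\<And>t. t < n \<Longrightarrow> y t = (\<Sum>i\<in>T j - {j}. h t $ j $ i * f i (v i) t) + h t $ j $ j * f j (w j) t + z t"
    and dist: "\<And>a. a \<in> {1..M j} \<Longrightarrow> a \<noteq> w j \<Longrightarrow> 16 * real n < (\<Sum>t<n. (cmod (h t $ j $ j * (f j (w j) t - f j a t)))\<^sup>2)"
  shows "min_distance_decoder T n M f j y v h = w j"
proof -
  let ?e = "\<lambda>a t. y t - (\<Sum>i\<in>T j - {j}. h t $ j $ i * f i (v i) t) - h t $ j $ j * f j a t"
  let ?Q = "\<lambda>a. 1 \<le> a \<and> (M j \<le> a \<or> (\<Sum>t<n. (cmod (?e a t))\<^sup>2) \<le> 4 * n)"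
  define a where "a = min_distance_decoder T n M f j y v h"
  have Qw: "?Q (w j)"
  proof -
    have "(\<Sum>t<n. (cmod (?e (w j) t))\<^sup>2) = (\<Sum>t<n. (cmod (z t))\<^sup>2)" by (rule sum.cong) (auto simp: y)
    then show ?thesis using noise w by simp
  qed
  have a: "a = (LEAST a. ?Q a)" by (simp only: a_def min_distance_decoder_def)
  have Qa: "?Q a" unfolding a by (rule LeastI[of ?Q, OF Qw])
  have le: "a \<le> w j" unfolding a by (rule Least_le[of ?Q, OF Qw])
  have "a = w j"
  proof (rule ccontr)
    assume ne: "a \<noteq> w j"
    with le w have "a < M j" by auto
    with Qa have ea: "(\<Sum>t<n. (cmod (?e a t))\<^sup>2) \<le> 4 * n" and a1: "a \<in> {1..M j}" by auto
    have "(\<Sum>t<n. (cmod (h t $ j $ j * (f j (w j) t - f j a t)))\<^sup>2) \<le> (\<Sum>t<n. 2 * ((cmod (?e a t))\<^sup>2 + (cmod (z t))\<^sup>2))"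
    proof (rule sum_mono)
      fix t assume "t \<in> {..<n}"
      then have "h t $ j $ j * (f j (w j) t - f j a t) = ?e a t - z t" by (simp add: y algebra_simps)
      then have "(cmod (h t $ j $ j * (f j (w j) t - f j a t)))\<^sup>2 \<le> (cmod (?e a t) + cmod (z t))\<^sup>2"
        by (intro power_mono) (auto intro: order.trans[OF norm_triangle_ineq4])
      also have "\<dots> \<le> 2 * ((cmod (?e a t))\<^sup>2 + (cmod (z t))\<^sup>2)"
      proof -
        have "(x + y)\<^sup>2 \<le> 2 * (x\<^sup>2 + y\<^sup>2)" for x y :: real
          using sum_squares_bound[of x y] by (simp add: power2_sum)
        then show ?thesis .
      qed
      finally show "(cmod (h t $ j $ j * (f j (w j) t - f j a t)))\<^sup>2 \<le> 2 * ((cmod (?e a t))\<^sup>2 + (cmod (z t))\<^sup>2)" .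
    qed
    also have "\<dots> = 2 * ((\<Sum>t<n. (cmod (?e a t))\<^sup>2) + (\<Sum>t<n. (cmod (z t))\<^sup>2))"
      by (simp add: sum_distrib_left sum.distrib)
    also have "\<dots> \<le> 16 * real n"
    proof -
      have "2 * (A + B) \<le> 16 * real n" if "A \<le> real (4 * n)" "B \<le> 4 * real n" for A B
        using that by simp
      from this[OF ea noise] show ?thesis .
    qed
    finally show False using dist[OF a1 ne] by linarith
  qed
  then show ?thesis by (simp add: a_def)
qed

lemma avg_power_le:
  assumes "0 < P" "1 \<le> M i" "\<And>w t. w \<in> {1..M i} \<Longrightarrow> t < n \<Longrightarrow> (cmod (f i w t))\<^sup>2 \<le> P"
  shows "avg_power n M f i \<le> P"
proof -
  have "(\<Sum>t<n. (cmod (f i w t))\<^sup>2) / n \<le> P" if "w \<in> {1..M i}" for w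
  proof (cases "n = 0")
    case False
    have "(\<Sum>t<n. (cmod (f i w t))\<^sup>2) \<le> (\<Sum>t<n. P)" by (intro sum_mono assms(3) that) simp
    then show ?thesis using False by (simp add: field_simps)
  qed (use assms in simp)
  then have "(\<Sum>w\<in>{1..M i}. (\<Sum>t<n. (cmod (f i w t))\<^sup>2) / n) \<le> (\<Sum>w\<in>{1..M i}. P)" by (intro sum_mono)
  then have "(\<Sum>w\<in>{1..M i}. (\<Sum>t<n. (cmod (f i w t))\<^sup>2) / n) / M i \<le> P"
    using assms(2) by (simp add: field_simps)
  moreover have "avg_power n M f i = (\<Sum>w\<in>{1..M i}. (\<Sum>t<n. (cmod (f i w t))\<^sup>2) / n) / card {1..M i}"
    unfolding avg_power_def by (rule integral_uniform_count_measure) simp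
  ultimately show ?thesis by (simp only: card_atLeastAtMost diff_Suc_1)
qed

text \<open>The fraction \<open>2 * \<epsilon>\<close> is twice the fraction of positions that
  fading may spoil. With a single message the second condition is void.\<close>

definition separated_code :: "nat \<Rightarrow> real \<Rightarrow> real \<Rightarrow> real \<Rightarrow> nat \<Rightarrow> (nat \<Rightarrow> nat \<Rightarrow> complex) \<Rightarrow> bool" where
  "separated_code n P \<epsilon> \<Delta> M e \<longleftrightarrow>
     (\<forall>w\<in>{1..M}. \<forall>t<n. (cmod (e w t))\<^sup>2 \<le> P) \<and>
     (\<forall>w\<in>{1..M}. \<forall>w'\<in>{1..M}. w \<noteq> w' \<longrightarrow> 2 * \<epsilon> * n < card {t. t < n \<and> \<Delta> \<le> cmod (e w t - e w' t)})"

text \<open>All users of \<open>S\<close> share one code; the others have rate 0, hence one message,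
  and send 0. On typical channels and noises decoding never fails, so under each law in
  \<open>L\<close> the error is at most the probability of an atypical channel or noise.\<close>

lemma achievable_acyclic:
  fixes T :: "'k::finite \<Rightarrow> 'k set" and c P r \<epsilon> \<Delta> :: real
  assumes T: "\<And>j. j \<in> T j" and reg: "regular_channel_laws T L"
    and chan: "\<And>\<mu>. \<mu> \<in> L \<Longrightarrow> (\<lambda>n. measure \<mu> {h \<in> space \<mu>. chan_good T c n h}) \<longlonglongrightarrow> 1" and c: "0 < c"
    and S: "acyclic_set (conflict_digraph T) S"
    and P: "0 < P" and r: "0 \<le> r" and \<epsilon>: "0 < \<epsilon>" and \<Delta>: "0 < \<Delta>" "16 \<le> \<epsilon> * (exp (- c / \<epsilon>))\<^sup>2 * \<Delta>\<^sup>2"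
    and code: "\<And>n. \<exists>e. separated_code n P \<epsilon> \<Delta> (nat \<lceil>2 powr (real n * r)\<rceil>) e"
  shows "achievable T L P ((conflict_arcs T S)\<^sup>+) (r *\<^sub>R incidence S)"
proof -
  define R :: "real ^ 'k" where "R = r *\<^sub>R incidence S"
  define \<pi> where "\<pi> = (conflict_arcs T S)\<^sup>+"
  have \<pi>: "decoding_order \<pi>" unfolding \<pi>_def by (rule acyclic_imp_decoding_order[OF S])
  have "wf \<pi>"
    using \<pi> by (auto simp: decoding_order_def acyclic_irrefl wf_iff_acyclic_if_finite)
  let ?M = "\<lambda>n. num_messages n R"
  have M_in: "?M n i = nat \<lceil>2 powr (real n * r)\<rceil>" if "i \<in> S" for n i
    using that by (simp add: num_messages_def R_def incidence_def)
  have M_out: "?M n i = 1" if "i \<notin> S" for n i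
    using that by (simp add: num_messages_def R_def incidence_def)
  have "\<exists>e. \<forall>n. separated_code n P \<epsilon> \<Delta> (nat \<lceil>2 powr (real n * r)\<rceil>) (e n)"
    by (intro choice allI code)
  then obtain e where e: "\<And>n. separated_code n P \<epsilon> \<Delta> (nat \<lceil>2 powr (real n * r)\<rceil>) (e n)" by blast
  have e_pow: "(cmod (e n w t))\<^sup>2 \<le> P" if "w \<in> {1..nat \<lceil>2 powr (real n * r)\<rceil>}" "t < n" for n w t
    using e[of n] that unfolding separated_code_def by blast
  have e_dist: "2 * \<epsilon> * n < card {t. t < n \<and> \<Delta> \<le> cmod (e n w t - e n w' t)}"
    if "w \<in> {1..nat \<lceil>2 powr (real n * r)\<rceil>}" "w' \<in> {1..nat \<lceil>2 powr (real n * r)\<rceil>}" "w \<noteq> w'" for n w w'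
    using e[of n] that unfolding separated_code_def by blast
  define f where "f n i w t = (if i \<in> S then e n w t else 0)" for n i w t
  define g where "g n = min_distance_decoder T n (?M n) (f n)" for n
  have power: "avg_power n (?M n) (f n) i \<le> P" for n i
  proof (rule avg_power_le)
    show "1 \<le> ?M n i" by (rule num_messages_ge_1)
    show "(cmod (f n i w t))\<^sup>2 \<le> P" if "w \<in> {1..?M n i}" "t < n" for w t
      using that e_pow[of w n t] M_in[of i n] P by (cases "i \<in> S") (simp_all add: f_def)
  qed (rule P)
  have correct: "decoded \<pi> (g n) h (received T n (f n) h z w) j = w j"
    if h: "chan_good T c n h" and z: "noise_good n z" and w: "\<And>i. w i \<in> {1..?M n i}" for n h z w j
    using \<open>wf \<pi>\<close>
  \<comment> \<open>Along the decoding order: the messages passed to \<open>j\<close> are correct,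
    so the interference is subtracted exactly.\<close>
  proof (induction j rule: wf_induct_rule)
    case (less j)
    let ?v = "restrict (decoded \<pi> (g n) h (received T n (f n) h z w)) {k. (k, j) \<in> \<pi>}"
    let ?y = "received T n (f n) h z w j"
    have "g n j ?y ?v h = w j"
    proof (cases "j \<in> S")
      case False
      then have "?M n j = 1" by (rule M_out)
      then show ?thesis using w[of j] unfolding g_def min_distance_decoder_def
        by (intro Least_equality) auto
    next
      case True
      \<comment> \<open>An interferer outside \<open>S\<close> sends 0; one inside is decoded before
        \<open>j\<close>.\<close>
      have same: "f n i (?v i) t = f n i (w i) t" if "i \<in> T j - {j}" for i t
      proof (cases "i \<in> S")
        case i: True
        then have "(i, j) \<in> \<pi>" using that True by (auto simp: \<pi>_def conflict_arcs_def)
        then show ?thesis using less.IH by simp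
      qed (simp add: f_def)
      have "min_distance_decoder T n (?M n) (f n) j ?y ?v h = w j"
      proof (rule min_distance_decoder_correct[where z = "\<lambda>t. z t j" and w = w])
        show "w j \<in> {1..?M n j}" by (rule w)
        show "(\<Sum>t<n. (cmod (z t j))\<^sup>2) \<le> 4 * real n" using z by (simp add: noise_good_def)
        show "?y t = (\<Sum>i\<in>T j - {j}. h t $ j $ i * f n i (?v i) t) + h t $ j $ j * f n j (w j) t + z t j" if "t < n" for t
        proof -
          have "(\<Sum>i\<in>T j. h t $ j $ i * f n i (w i) t) =
              h t $ j $ j * f n j (w j) t + (\<Sum>i\<in>T j - {j}. h t $ j $ i * f n i (w i) t)"
            by (rule sum.remove) (use T in auto)
          then show ?thesis using that by (simp only: received_def restrict_apply' lessThan_iff same cong: sum.cong) (simp add: same)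
        qed
        fix a assume a: "a \<in> {1..?M n j}" "a \<noteq> w j"
        \<comment> \<open>For \<open>n = 0\<close> there is a single message, hence no competitor
          \<open>a\<close>.\<close>
        have "n \<noteq> 0" using e_dist[of a n "w j"] a w[of j] M_in[OF True] by (cases "n = 0") auto
        show "16 * real n < (\<Sum>t<n. (cmod (h t $ j $ j * (f n j (w j) t - f n j a t)))\<^sup>2)"
        proof (rule faded_distance_gt[OF _ _ c \<epsilon> \<Delta>])
          show "h t $ j $ j \<noteq> 0" for t using h T by (auto simp: chan_good_def)
          have "(\<Sum>t<n. \<bar>ln (cmod (h t $ j $ j))\<bar>) / n \<le> c" using h T by (auto simp: chan_good_def)
          then show "(\<Sum>t<n. \<bar>ln (cmod (h t $ j $ j))\<bar>) \<le> c * n" using \<open>n \<noteq> 0\<close> by (simp add: field_simps)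
          show "2 * \<epsilon> * real n < real (card {t. t < n \<and> \<Delta> \<le> cmod (f n j (w j) t - f n j a t)})"
            using e_dist[of "w j" n a] a w[of j] True by (simp add: f_def M_in)
        qed
      qed
      then show ?thesis by (simp only: g_def)
    qed
    then show ?case by (subst decoded_unfold[OF \<pi>])
  qed
  have err: "(\<lambda>n. Max (range (error_prob T \<mu> \<pi> n (?M n) (f n) (g n)))) \<longlonglongrightarrow> 0" if \<mu>L: "\<mu> \<in> L" for \<mu>
  proof -
    have \<mu>: "prob_space \<mu>" and sets: "sets \<mu> = sets channel_space"
      using reg \<mu>L by (auto simp: regular_channel_laws_def)
    interpret \<mu>: prob_space \<mu> by fact
    interpret N: prob_space "noise_measure :: (nat \<Rightarrow> 'k \<Rightarrow> complex) measure" by (rule prob_space_noise)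
    have [measurable_cong]: "sets \<mu> = sets channel_space" by fact
    let ?\<Omega> = "\<lambda>n. tim_measure \<mu> (?M n)"
    let ?q = "\<lambda>n. \<mu>.prob {h \<in> space \<mu>. chan_good T c n h}"
    let ?up = "\<lambda>n. (1 - ?q n) + real CARD('k) * (2 / exp 2) ^ n"
    have le: "error_prob T \<mu> \<pi> n (?M n) (f n) (g n) j \<le> ?up n" for n j
    proof -
      interpret \<Omega>: prob_space "?\<Omega> n" by (rule prob_space_tim_measure[OF \<mu> num_messages_ge_1])
      let ?H = "{(h, z, w) \<in> space (?\<Omega> n). \<not> chan_good T c n h}" and ?Z = "{(h, z, w) \<in> space (?\<Omega> n). \<not> noise_good n z}"
      have sH: "?H \<in> \<Omega>.events"
      proof -
        note [measurable] = measurable_tim_components(1)[OF sets]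
        have "{x \<in> space (?\<Omega> n). \<not> chan_good T c n (fst x)} \<in> \<Omega>.events" by measurable
        then show ?thesis by (simp add: split_beta')
      qed
      have sZ: "?Z \<in> \<Omega>.events"
      proof -
        note [measurable] = measurable_tim_components(2)[OF sets]
        have "{x \<in> space (?\<Omega> n). \<not> noise_good n (fst (snd x))} \<in> \<Omega>.events" by measurable
        then show ?thesis by (simp add: split_beta')
      qed
      have "\<Omega>.prob ?H = \<mu>.prob {h \<in> space \<mu>. \<not> chan_good T c n h}"
        by (rule measure_tim_measure_marginals[OF \<mu> num_messages_ge_1]) measurable
      also have "\<dots> = 1 - ?q n" by (rule \<mu>.prob_neg) measurable
      finally have H: "\<Omega>.prob ?H = 1 - ?q n" .
      have "\<Omega>.prob ?Z = N.prob {z \<in> space noise_measure. \<not> noise_good n z}"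
        by (rule measure_tim_measure_marginals[OF \<mu> num_messages_ge_1]) measurable
      also have "\<dots> = 1 - N.prob {z \<in> space noise_measure. noise_good n z}" by (rule N.prob_neg) measurable
      also have "\<dots> \<le> real CARD('k) * (2 / exp 2) ^ n" using prob_noise_good[of n, where 'k = 'k] by linarith
      finally have Z: "\<Omega>.prob ?Z \<le> real CARD('k) * (2 / exp 2) ^ n" .
      have "error_prob T \<mu> \<pi> n (?M n) (f n) (g n) j \<le> \<Omega>.prob (?H \<union> ?Z)"
        unfolding error_prob_def
      proof (rule \<Omega>.finite_measure_mono)
        show "{(h, z, w). (h, z, w) \<in> space (?\<Omega> n) \<and> decoded \<pi> (g n) h (received T n (f n) h z w) j \<noteq> w j} \<subseteq> ?H \<union> ?Z"
        proof (clarify, goal_cases)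
          case (1 h z w)
          then have "w i \<in> {1..?M n i}" for i
            by (auto simp: tim_measure_def space_pair_measure space_message_measure PiE_iff)
          with correct[of n h z w j] 1 show ?case by blast
        qed
      qed (use sH sZ in auto)
      also have "\<dots> \<le> \<Omega>.prob ?H + \<Omega>.prob ?Z" by (rule measure_Un_le[OF sH sZ])
      finally show ?thesis using H Z by linarith
    qed
    have pw0: "(\<lambda>n. (2 / exp 2 :: real) ^ n) \<longlonglongrightarrow> 0"
      using exp_ge_add_one_self[of "2::real"] by (intro LIMSEQ_power_zero) auto
    have "?up \<longlonglongrightarrow> (1 - 1) + real CARD('k) * 0"
      by (intro tendsto_diff tendsto_add tendsto_mult tendsto_const chan[OF \<mu>L] pw0)
    then have up: "?up \<longlonglongrightarrow> 0" by simp
    \<comment> \<open>Any user will do; this shows that the maximum is nonnegative.\<close>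
    have "error_prob T \<mu> \<pi> n (?M n) (f n) (g n) undefined \<le> Max (range (error_prob T \<mu> \<pi> n (?M n) (f n) (g n)))" for n
      by (intro Max_ge) auto
    moreover have "0 \<le> error_prob T \<mu> \<pi> n (?M n) (f n) (g n) undefined" for n by (simp add: error_prob_def)
    ultimately have "0 \<le> Max (range (error_prob T \<mu> \<pi> n (?M n) (f n) (g n)))" for n using order.trans by blast
    moreover have "Max (range (error_prob T \<mu> \<pi> n (?M n) (f n) (g n))) \<le> ?up n" for n
      by (subst Max_le_iff) (use le in auto)
    ultimately show ?thesis
      by (intro tendsto_sandwich[OF always_eventually always_eventually tendsto_const up]) blast+
  qed
  have "0 \<le> R $ i" for i using r by (simp add: R_def incidence_def)
  moreover have "measurable_decoders n (g n)" for n unfolding g_def by (rule measurable_min_distance_decoder)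
  ultimately show ?thesis
    unfolding achievable_def R_def[symmetric] \<pi>_def[symmetric]
    using power err by (intro conjI allI exI[of _ f] exI[of _ g] ballI) auto
qed

section \<open>Codes with one degree of freedom\<close>

text \<open>The logarithm of the Gilbert-Varshamov condition for alphabet size
  \<open>N\<^sup>2\<close> and distance \<open>2 * \<epsilon> * n\<close>: the ball takes the
  fraction \<open>2 * \<epsilon>\<close> of the logarithm of the alphabet size, and the final
  \<open>- 1\<close> pays for the factor \<open>2 ^ n\<close>.\<close>

lemma separated_code_exists:
  fixes P r \<epsilon> \<Delta> :: real
  assumes \<epsilon>: "0 < \<epsilon>" and \<Delta>: "0 < \<Delta>" and N: "1 \<le> N" and P: "2 * (real N)\<^sup>2 * \<Delta>\<^sup>2 \<le> P"
    and r: "r \<le> (1 - 2 * \<epsilon>) * log 2 ((real N)\<^sup>2) - 1"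
  shows "\<exists>e. separated_code n P \<epsilon> \<Delta> (nat \<lceil>2 powr (real n * r)\<rceil>) e"
proof -
  define M where "M = nat \<lceil>2 powr (real n * r)\<rceil>"
  have "0 < \<lceil>2 powr (real n * r)\<rceil>" by simp
  then have M1: "1 \<le> M" unfolding M_def by linarith
  \<comment> \<open>\<open>Suc m\<close> codewords need \<open>m\<close> balls, and rounding up in
    \<open>M\<close> gives the strict bound on \<open>m\<close>.\<close>
  define m where "m = M - 1"
  have Mm: "M = Suc m" using M1 by (simp add: m_def)
  have m: "real m < 2 powr (real n * r)"
    using \<open>0 < \<lceil>2 powr (real n * r)\<rceil>\<close> unfolding m_def M_def by linarith
  \<comment> \<open>Rounded down: a Hamming distance is an integer, so if it exceeds
    \<open>d\<close> it exceeds \<open>2 * \<epsilon> * n\<close>.\<close>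
  define d where "d = nat \<lfloor>2 * \<epsilon> * n\<rfloor>"
  have d: "real d \<le> 2 * \<epsilon> * n" "2 * \<epsilon> * n < real d + 1"
    unfolding d_def using \<epsilon> by (auto simp: of_nat_nat)
  define l where "l = log 2 ((real N)\<^sup>2)"
  have N2: "1 \<le> (real N)\<^sup>2" using N by simp
  then have l0: "0 \<le> l" unfolding l_def by (subst zero_le_log_cancel_iff) (use N in auto)
  have q: "(real N)\<^sup>2 = 2 powr l" unfolding l_def by (subst powr_log_cancel) (use N in auto)
  have qpow: "((real N)\<^sup>2) ^ k = 2 powr (l * real k)" for k
    unfolding q by (simp add: powr_powr[symmetric] powr_realpow)
  have "real (m * (2 ^ n * (N\<^sup>2) ^ d)) = real m * (2 powr real n * 2 powr (l * d))"
    using qpow[of d] by (simp add: powr_realpow)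
  also have "\<dots> < 2 powr (real n * r) * (2 powr real n * 2 powr (l * d))"
    by (rule mult_strict_right_mono[OF m]) simp
  also have "\<dots> = 2 powr (real n * r + (real n + l * d))" by (simp add: powr_add)
  also have "\<dots> \<le> 2 powr (l * n)"
  proof (rule powr_mono)
    have "l * d \<le> l * (2 * \<epsilon> * n)" by (rule mult_left_mono[OF d(1) l0])
    moreover have "real n * (r + 1) \<le> real n * ((1 - 2 * \<epsilon>) * l)"
      using r by (intro mult_left_mono) (auto simp: l_def)
    ultimately show "real n * r + (real n + l * d) \<le> l * n" by (simp add: algebra_simps)
  qed simp
  also have "\<dots> = real ((N\<^sup>2) ^ n)" using qpow[of n] by simp
  finally have "m * (2 ^ n * (N\<^sup>2) ^ d) < (N\<^sup>2) ^ n" by (simp only: of_nat_less_iff)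
  from complex_code_exists[OF N \<Delta> this] obtain e where
    e: "\<And>w t. w \<in> {1..Suc m} \<Longrightarrow> t < n \<Longrightarrow> (cmod (e w t))\<^sup>2 \<le> 2 * (real N)\<^sup>2 * \<Delta>\<^sup>2"
    "\<And>w w'. w \<in> {1..Suc m} \<Longrightarrow> w' \<in> {1..Suc m} \<Longrightarrow> w \<noteq> w' \<Longrightarrow> d < card {t. t < n \<and> \<Delta> \<le> cmod (e w t - e w' t)}"
    by blast
  have "2 * \<epsilon> * n < card {t. t < n \<and> \<Delta> \<le> cmod (e w t - e w' t)}"
    if "w \<in> {1..Suc m}" "w' \<in> {1..Suc m}" "w \<noteq> w'" for w w'
    using e(2)[OF that] d(2) by linarith
  then have "separated_code n P \<epsilon> \<Delta> M e"
    unfolding separated_code_def Mm using e(1) P order.trans by blast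
  then show ?thesis unfolding M_def by blast
qed

text \<open>
  The choice \<open>\<epsilon> = 1 / sqrt (ln P)\<close> keeps both losses, the fraction of faded positions and the
  alphabet spacing forced by fading, of order \<open>o(log P)\<close>.
\<close>

lemma dof_one_rate_exists:
  fixes c :: real
  assumes c: "0 < c"
  shows "\<exists>r. ((\<lambda>P. r P / log 2 P) \<longlongrightarrow> 1) at_top \<and> (\<forall>P>0. 0 \<le> r P \<and>
    (\<exists>\<epsilon> \<Delta>. 0 < \<epsilon> \<and> 0 < \<Delta> \<and> 16 \<le> \<epsilon> * (exp (- c / \<epsilon>))\<^sup>2 * \<Delta>\<^sup>2 \<and>
        (\<forall>n. \<exists>e. separated_code n P \<epsilon> \<Delta> (nat \<lceil>2 powr (real n * r P)\<rceil>) e)))"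
proof -
  define \<epsilon> where "\<epsilon> P = 1 / sqrt (ln P)" for P :: real
  \<comment> \<open>The solution of \<open>16 = \<epsilon> * (exp (- c / \<epsilon>))\<^sup>2 *
    \<Delta>\<^sup>2\<close>; its logarithm is of order \<open>sqrt (ln P)\<close>.\<close>
  define \<Delta> where "\<Delta> P = 4 * exp (c / \<epsilon> P) / sqrt (\<epsilon> P)" for P
  \<comment> \<open>The grid size \<open>N\<close> below is at least half of
    \<open>sqrt (P / (2 * (\<Delta> P)\<^sup>2))\<close>, hence \<open>N\<^sup>2\<close> at least
    \<open>P / (8 * (\<Delta> P)\<^sup>2)\<close>.\<close>
  define r0 where "r0 P = (1 - 2 * \<epsilon> P) * log 2 (P / (8 * (\<Delta> P)\<^sup>2)) - 1" for P
  \<comment> \<open>The powers for which these formulas make sense; elsewhere the rate is set to 0,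
    which does not affect the limit.\<close>
  define Q where "Q P \<longleftrightarrow> 1 < P \<and> 2 * \<epsilon> P \<le> 1 \<and> 1 \<le> P / (2 * (\<Delta> P)\<^sup>2) \<and> 0 \<le> r0 P" for P
  define r where "r P = (if Q P then r0 P else 0)" for P
  have "eventually (\<lambda>P. 1 < P \<and> 2 * \<epsilon> P \<le> 1) at_top"
    unfolding \<epsilon>_def by (intro eventually_conj) real_asymp+
  moreover have "eventually (\<lambda>P. 1 \<le> P / (2 * (\<Delta> P)\<^sup>2)) at_top"
    unfolding \<Delta>_def \<epsilon>_def using c by real_asymp
  moreover have "eventually (\<lambda>P. 0 \<le> r0 P) at_top"
    unfolding r0_def \<Delta>_def \<epsilon>_def using c by real_asymp
  ultimately have Q: "eventually Q at_top"
    by eventually_elim (simp add: Q_def)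
  have "((\<lambda>P. r0 P / log 2 P) \<longlongrightarrow> 1) at_top"
    unfolding r0_def \<Delta>_def \<epsilon>_def using c by real_asymp
  then have lim: "((\<lambda>P. r P / log 2 P) \<longlongrightarrow> 1) at_top"
    by (rule Lim_transform_eventually) (use Q in eventually_elim, simp add: r_def)
  show ?thesis
  proof (intro exI[of _ r] conjI[OF lim] allI impI conjI)
    fix P :: real assume P: "0 < P"
    show "0 \<le> r P" by (simp add: r_def Q_def)
    show "\<exists>\<epsilon> \<Delta>. 0 < \<epsilon> \<and> 0 < \<Delta> \<and> 16 \<le> \<epsilon> * (exp (- c / \<epsilon>))\<^sup>2 * \<Delta>\<^sup>2 \<and>
        (\<forall>n. \<exists>e. separated_code n P \<epsilon> \<Delta> (nat \<lceil>2 powr (real n * r P)\<rceil>) e)"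
    proof (cases "Q P")
      case True
      have \<epsilon>0: "0 < \<epsilon> P" using True by (simp add: \<epsilon>_def Q_def)
      then have \<Delta>0: "0 < \<Delta> P" by (simp add: \<Delta>_def)
      have 16: "16 \<le> \<epsilon> P * (exp (- c / \<epsilon> P))\<^sup>2 * (\<Delta> P)\<^sup>2"
      proof -
        have "\<epsilon> P * (exp (- c / \<epsilon> P))\<^sup>2 * (\<Delta> P)\<^sup>2 =
            16 * (exp (- c / \<epsilon> P) * exp (c / \<epsilon> P))\<^sup>2 * (\<epsilon> P / (sqrt (\<epsilon> P))\<^sup>2)"
          by (simp add: \<Delta>_def power_mult_distrib power_divide)
        moreover have "exp (- c / \<epsilon> P) * exp (c / \<epsilon> P) = 1" by (simp add: exp_add[symmetric])
        ultimately show ?thesis using \<epsilon>0 by simp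
      qed
      define x where "x = sqrt (P / (2 * (\<Delta> P)\<^sup>2))"
      have x1: "1 \<le> x" using True by (simp add: x_def Q_def)
      have x2: "x\<^sup>2 = P / (2 * (\<Delta> P)\<^sup>2)" using P by (simp add: x_def)
      define N where "N = nat \<lfloor>x\<rfloor>"
      have fl: "1 \<le> \<lfloor>x\<rfloor>" using x1 by simp
      then have Nx: "real N = real_of_int \<lfloor>x\<rfloor>" by (simp add: N_def)
      have N1: "1 \<le> N" using fl unfolding N_def by linarith
      then have "1 \<le> real N" by simp
      with Nx floor_correct[of x] N1 have N: "1 \<le> N" "real N \<le> x" "x / 2 \<le> real N" by linarith+
      have "(real N)\<^sup>2 \<le> x\<^sup>2" using N by (intro power_mono) auto
      then have pow: "2 * (real N)\<^sup>2 * (\<Delta> P)\<^sup>2 \<le> P"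
        using \<Delta>0 by (simp add: x2 field_simps)
      have "(x / 2)\<^sup>2 \<le> (real N)\<^sup>2" using N x1 by (intro power_mono) auto
      moreover have "(x / 2)\<^sup>2 = P / (8 * (\<Delta> P)\<^sup>2)" by (simp add: power_divide x2)
      ultimately have "log 2 (P / (8 * (\<Delta> P)\<^sup>2)) \<le> log 2 ((real N)\<^sup>2)"
        using P \<Delta>0 by (intro log_mono) auto
      then have "r0 P \<le> (1 - 2 * \<epsilon> P) * log 2 ((real N)\<^sup>2) - 1"
        unfolding r0_def using True by (intro diff_right_mono mult_left_mono) (auto simp: Q_def)
      from separated_code_exists[OF \<epsilon>0 \<Delta>0 N(1) pow this] \<epsilon>0 \<Delta>0 16 True show ?thesis
        unfolding r_def by auto
    next
      case False
      \<comment> \<open>Rate 0 means one message, so separation is void and the zero codeword will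
        do; \<open>4 * exp c\<close> is the spacing that fits \<open>\<epsilon> = 1\<close>.\<close>
      have "separated_code n P 1 (4 * exp c) (nat \<lceil>2 powr (real n * r P)\<rceil>) (\<lambda>_ _. 0)" for n
        using P False by (auto simp: separated_code_def r_def)
      moreover have "(16 :: real) \<le> 1 * (exp (- c / 1))\<^sup>2 * (4 * exp c)\<^sup>2"
        by (simp add: power_mult_distrib exp_minus power_inverse)
      ultimately show ?thesis by (intro exI[of _ 1] exI[of _ "4 * exp c"]) auto
    qed
  qed
qed

section \<open>Inner and outer bound of the DoF region\<close>

text \<open>The weights that express \<open>d\<close> by incidence vectors are the same for all
  powers, so one scalar function \<open>r\<close> gives rate tuples \<open>r P *\<^sub>R d\<close>
  in the capacity region. Since r(P) / log P has a genuine limit, the limits superior are attained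
  jointly along any sequence of powers, for instance P = m.\<close>

lemma orthogonal_access_subset_dof:
  fixes T :: "'k::finite \<Rightarrow> 'k set"
  assumes T: "\<And>j. j \<in> T j" and reg: "regular_channel_laws T L"
  shows "orthogonal_access_region T \<subseteq> dof_region T L"
proof
  fix d assume d: "d \<in> orthogonal_access_region T"
  let ?X = "incidence ` {S. acyclic_set (conflict_digraph T) S} :: (real ^ 'k) set"
  obtain c where c: "1 \<le> c" "\<And>\<mu>. \<mu> \<in> L \<Longrightarrow> (\<lambda>n. measure \<mu> {h \<in> space \<mu>. chan_good T c n h}) \<longlonglongrightarrow> 1"
    using prob_chan_good[OF reg] by blast
  have c0: "0 < c" using c(1) by simp
  from dof_one_rate_exists[OF c0] obtain r where r: "((\<lambda>P. r P / log 2 P) \<longlongrightarrow> 1) at_top"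
    and r': "\<forall>P>0. 0 \<le> r P \<and> (\<exists>\<epsilon> \<Delta>. 0 < \<epsilon> \<and> 0 < \<Delta> \<and> 16 \<le> \<epsilon> * (exp (- c / \<epsilon>))\<^sup>2 * \<Delta>\<^sup>2 \<and>
        (\<forall>n. \<exists>e. separated_code n P \<epsilon> \<Delta> (nat \<lceil>2 powr (real n * r P)\<rceil>) e))"
    by (elim exE conjE)
  have cap: "r P *\<^sub>R d \<in> capacity_region T L P" if P: "0 < P" for P
  proof -
    from r' P have r0: "0 \<le> r P" by blast
    from r' P obtain \<epsilon> \<Delta> where e: "0 < \<epsilon>" "0 < \<Delta>" "16 \<le> \<epsilon> * (exp (- c / \<epsilon>))\<^sup>2 * \<Delta>\<^sup>2"
        "\<And>n. \<exists>e. separated_code n P \<epsilon> \<Delta> (nat \<lceil>2 powr (real n * r P)\<rceil>) e" by blast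
    have "r P *\<^sub>R d \<in> (\<lambda>x. r P *\<^sub>R x) ` (convex hull ?X)"
      using d by (auto simp: orthogonal_access_region_def)
    also have "\<dots> = convex hull ((\<lambda>x. r P *\<^sub>R x) ` ?X)" by (rule convex_hull_scaling[symmetric])
    also have "\<dots> \<subseteq> capacity_region T L P"
      unfolding capacity_region_def
    proof (rule hull_mono, clarify)
      fix S assume S: "acyclic_set (conflict_digraph T) S"
      have "achievable T L P ((conflict_arcs T S)\<^sup>+) (r P *\<^sub>R incidence S)"
        by (rule achievable_acyclic[OF T reg c(2) c0 S P r0 e])
      then show "r P *\<^sub>R incidence S \<in> (\<Union>\<pi>\<in>{\<pi>. decoding_order \<pi>}. {R. achievable T L P \<pi> R})"
        using acyclic_imp_decoding_order[OF S] by blast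
    qed
    finally show ?thesis .
  qed
  have lim: "((\<lambda>P. (r P *\<^sub>R d) $ k / log 2 P) \<longlongrightarrow> d $ k) at_top" for k
    using tendsto_mult_right[OF r, of "d $ k"] by simp
  have "?X \<subseteq> {x. \<forall>k. 0 \<le> x $ k}" by (auto simp: incidence_def)
  moreover have "convex {x :: real ^ 'k. \<forall>k. 0 \<le> x $ k}" by (auto simp: convex_def)
  ultimately have "convex hull ?X \<subseteq> {x. \<forall>k. 0 \<le> x $ k}" by (rule hull_minimal)
  then have nonneg: "0 \<le> d $ k" for k
    using d unfolding orthogonal_access_region_def by blast
  show "d \<in> dof_region T L"
    unfolding dof_region_def
  proof (intro CollectI conjI allI exI[of _ "\<lambda>P. r P *\<^sub>R d"] impI exI[of _ real])
    show "0 \<le> d $ k" for k by (rule nonneg)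
    show "r P *\<^sub>R d \<in> capacity_region T L P" if "0 < P" for P by (rule cap[OF that])
    show "Limsup at_top (\<lambda>P. ereal ((r P *\<^sub>R d) $ k / log 2 P)) = ereal (d $ k)" for k
      by (rule lim_imp_Limsup) (use lim in auto)
    show "filterlim real at_top sequentially" by (rule filterlim_real_sequentially)
    show "(\<lambda>m. (r (real m) *\<^sub>R d) $ k / log 2 (real m)) \<longlonglongrightarrow> d $ k" for k
      using filterlim_compose[OF lim filterlim_real_sequentially] .
  qed
qed

text \<open>The common sequence of powers makes sums of coordinates converge. A bound whose constant
  does not depend on the order defines a half-space, so it holds on the convex hull, and division by
  log P removes \<open>C\<close>.\<close>

lemma dof_subset_dicycle_polytope:
  fixes T :: "'k::finite \<Rightarrow> 'k set"
  assumes T: "\<And>j. j \<in> T j" and reg: "regular_channel_laws T L"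
  shows "dof_region T L \<subseteq> dicycle_polytope T"
proof
  fix d assume "d \<in> dof_region T L"
  then obtain R and p :: "nat \<Rightarrow> real" where R: "\<And>P. 0 < P \<Longrightarrow> R P \<in> capacity_region T L P"
    and p: "filterlim p at_top sequentially" and lim: "\<And>k. (\<lambda>m. R (p m) $ k / log 2 (p m)) \<longlonglongrightarrow> d $ k"
    and d0: "\<And>k. 0 \<le> d $ k"
    unfolding dof_region_def by blast
  obtain C where C: "\<And>P \<pi> R k. 1 \<le> P \<Longrightarrow> decoding_order \<pi> \<Longrightarrow> achievable T L P \<pi> R \<Longrightarrow> R $ k \<le> log 2 P + C"
    "\<And>P \<pi> R i j. 1 \<le> P \<Longrightarrow> decoding_order \<pi> \<Longrightarrow> achievable T L P \<pi> R \<Longrightarrow>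
       i \<noteq> j \<Longrightarrow> i \<in> T j \<Longrightarrow> (i, j) \<notin> \<pi> \<Longrightarrow> R $ i + R $ j \<le> log 2 P + C"
    using achievable_bounds[OF T reg] by metis
  have log_p: "filterlim (\<lambda>m. log 2 (p m)) at_top sequentially"
    by (rule filterlim_compose[OF _ p]) real_asymp
  have inv: "(\<lambda>m. C / log 2 (p m)) \<longlonglongrightarrow> 0"
    by (rule tendsto_divide_0[OF tendsto_const filterlim_at_top_imp_at_infinity[OF log_p]])
  have large: "eventually (\<lambda>m. 1 < p m) sequentially"
    using p by (simp add: filterlim_at_top_dense)
  have bound: "(\<Sum>k\<in>A. d $ k) \<le> a"
    if A: "\<And>P \<pi> R. 1 \<le> P \<Longrightarrow> decoding_order \<pi> \<Longrightarrow> achievable T L P \<pi> R \<Longrightarrow> (\<Sum>k\<in>A. R $ k) \<le> a * (log 2 P + C)" for A a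
  proof -
    have cap: "(\<Sum>k\<in>A. x $ k) \<le> a * (log 2 P + C)" if P: "1 \<le> P" and x: "x \<in> capacity_region T L P" for P x
    proof -
      have "convex {x :: real ^ 'k. (\<Sum>k\<in>A. x $ k) \<le> a * (log 2 P + C)}"
      proof (rule convexI, clarify)
        fix x y :: "real ^ 'k" and u v :: real
        assume xy: "(\<Sum>k\<in>A. x $ k) \<le> a * (log 2 P + C)" "(\<Sum>k\<in>A. y $ k) \<le> a * (log 2 P + C)" and uv: "0 \<le> u" "0 \<le> v" "u + v = 1"
        have "(\<Sum>k\<in>A. (u *\<^sub>R x + v *\<^sub>R y) $ k) = u * (\<Sum>k\<in>A. x $ k) + v * (\<Sum>k\<in>A. y $ k)"
          by (simp add: sum.distrib sum_distrib_left)
        also have "\<dots> \<le> a * (log 2 P + C)" by (rule convex_bound_le[OF xy uv])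
        finally show "(\<Sum>k\<in>A. (u *\<^sub>R x + v *\<^sub>R y) $ k) \<le> a * (log 2 P + C)" .
      qed
      moreover have "(\<Union>\<pi>\<in>{\<pi>. decoding_order \<pi>}. {R. achievable T L P \<pi> R}) \<subseteq> {x. (\<Sum>k\<in>A. x $ k) \<le> a * (log 2 P + C)}"
        using A[OF P] by blast
      ultimately have "capacity_region T L P \<subseteq> {x. (\<Sum>k\<in>A. x $ k) \<le> a * (log 2 P + C)}"
        unfolding capacity_region_def by (intro hull_minimal)
      with x show ?thesis by blast
    qed
    have "(\<lambda>m. \<Sum>k\<in>A. R (p m) $ k / log 2 (p m)) \<longlonglongrightarrow> (\<Sum>k\<in>A. d $ k)"
      by (intro tendsto_sum lim)
    moreover have "(\<lambda>m. a * (1 + C / log 2 (p m))) \<longlonglongrightarrow> a * (1 + 0)"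
      by (intro tendsto_mult tendsto_add tendsto_const inv)
    moreover have "eventually (\<lambda>m. (\<Sum>k\<in>A. R (p m) $ k / log 2 (p m)) \<le> a * (1 + C / log 2 (p m))) sequentially"
      using large
    proof eventually_elim
      case (elim m)
      have pos: "0 < log 2 (p m)" using elim by simp
      have "(\<Sum>k\<in>A. R (p m) $ k) / log 2 (p m) \<le> a * (log 2 (p m) + C) / log 2 (p m)"
        using elim pos by (intro divide_right_mono cap R) auto
      also have "\<dots> = a * (1 + C / log 2 (p m))" using pos by (simp add: field_simps)
      finally show ?case by (simp only: sum_divide_distrib)
    qed
    ultimately have "(\<Sum>k\<in>A. d $ k) \<le> a * (1 + 0)" using tendsto_le[OF sequentially_bot] by blast
    then show ?thesis by simp
  qed
  have "d $ k \<le> 1" for k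
    using bound[of "{k}" 1] C(1) by simp
  moreover have "(\<Sum>k\<in>Y. d $ k) \<le> real (card Y) - 1" if Y: "Y \<in> chordless_dicycles (conflict_digraph T)" for Y
  proof (rule bound)
    fix P \<pi> and R :: "real ^ 'k" assume *: "1 \<le> P" "decoding_order \<pi>" "achievable T L P \<pi> R"
    from cycle_has_arc_not_in_order[OF Y *(2)] obtain i j where
      ij: "i \<in> Y" "j \<in> Y" "i \<noteq> j" "i \<in> T j" "(i, j) \<notin> \<pi>" by blast
    have card: "card Y = card (Y - {i, j}) + 2"
      using ij card_Diff_subset[of "{i, j}" Y] card_mono[of Y "{i, j}"] by simp
    \<comment> \<open>\<open>i\<close> and \<open>j\<close> share one log P, and every other user of
      the dicycle has one of its own: \<open>card Y - 1\<close> in total.\<close>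
    have "(\<Sum>k\<in>Y. R $ k) = (\<Sum>k\<in>Y - {i, j}. R $ k) + (R $ i + R $ j)"
      using sum.subset_diff[of "{i, j}" Y "\<lambda>k. R $ k"] ij by simp
    also have "\<dots> \<le> (\<Sum>k\<in>Y - {i, j}. log 2 P + C) + (log 2 P + C)"
      by (rule add_mono[OF sum_mono[OF C(1)[OF *]] C(2)[OF * ij(3-5)]])
    also have "\<dots> = (real (card Y) - 1) * (log 2 P + C)"
      unfolding card by (simp add: algebra_simps)
    finally show "(\<Sum>k\<in>Y. R $ k) \<le> (real (card Y) - 1) * (log 2 P + C)" .
  qed
  ultimately show "d \<in> dicycle_polytope T" using d0 by (simp add: dicycle_polytope_def)
qed

theorem theorem4:
  fixes T :: "'k::finite \<Rightarrow> 'k set" and L :: "'k channel measure set"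
  assumes "\<forall>j. j \<in> T j"
    and "regular_channel_laws T L"
    and "\<not> (\<exists>Q n. n \<ge> 3 \<and> complete_digraph n (conflict_digraph T \<restriction> Q))"
    and "ideal_matrix (chordless_dicycles (conflict_digraph T)) (incidence :: 'k set \<Rightarrow> real ^ 'k)"
  shows "dof_region T L =
           {d. (\<forall>k. 0 \<le> d $ k \<and> d $ k \<le> 1) \<and>
               (\<forall>C\<in>chordless_dicycles (conflict_digraph T). (\<Sum>k\<in>C. d $ k) \<le> real (card C) - 1)}
         \<and> dof_region T L = orthogonal_access_region T
         \<and> (\<lambda>d. \<chi> k. 1 - d $ k) ` dof_region T L =
             covering_polytope (chordless_dicycles (conflict_digraph T)) incidence"
proof -
  have T: "j \<in> T j" for j using assms(1) by blast
  have "dof_region T L \<subseteq> dicycle_polytope T" by (rule dof_subset_dicycle_polytope[OF T assms(2)])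
  moreover have "dicycle_polytope T \<subseteq> orthogonal_access_region T"
    by (rule dicycle_polytope_subset_orthogonal_access[OF assms(4)])
  moreover have "orthogonal_access_region T \<subseteq> dof_region T L"
    by (rule orthogonal_access_subset_dof[OF T assms(2)])
  ultimately have eq: "dof_region T L = dicycle_polytope T" "orthogonal_access_region T = dicycle_polytope T"
    by blast+
  show ?thesis
    unfolding eq complement_dicycle_polytope by (simp add: dicycle_polytope_def)
qed

end
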